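(* Let $S$ be a recurrent specular set on the finite alphabet $A$ relative to the involution $\theta$. For any nonempty $w\in S$ such that $w$ and $w^{-1}$ do not overlap, the set $\mathcal{MR}_S(w)$ of mixed return words to $w$ in $S$ is a monoidal basis of the group $G_\theta$.
   Context: Words are over a finite alphabet $A$; $\varepsilon$ is the empty word. A set $S$ of words on $A$ is factorial if it contains $A$ and all the factors of its elements. For $w\in S$ let $L(w)=\{a\in A\mid aw\in S\}$, $R(w)=\{a\in A\mid wa\in S\}$, $B(w)=\{(a,b)\in A\times A\mid awb\in S\}$. A factorial set $S$ is biextendable if $B(w)\neq\emptyset$ for all $w\in S$. The extension graph $\mathcal{E}(w)$ is the undirected graph whose vertex set is the disjoint union of $L(w)$ and $R(w)$ and whose edges are the pairs in $B(w)$. A biextendable set $S$ is a tree set of characteristic $c$ if $\mathcal{E}(w)$ is a tree for every nonempty $w\in S$ and $\mathcal{E}(\varepsilon)$ is a disjoint union of $c$ trees. Let $\theta$ be an involution on $A$ (possibly with fixed points) and let $G_\theta$ be the group generated by $A$ with relations $a\theta(a)=1$, $a\in A$ (so $a^{-1}=\theta(a)$). A word is reduced if it has no factor $a\theta(a)$ with $a\in A$; every element of $G_\theta$ is represented by a unique reduced word, reduced words are identified with elements of $G_\theta$, and the inverse $w^{-1}$ of a reduced word $w=a_1\cdots a_n$ is the reduced word $\theta(a_n)\cdots\theta(a_1)$. A laminary set on $A$ relative to $\theta$ is a biextendable set of reduced words closed under taking inverses. A specular set is a laminary set which is a tree set of characteristic $2$. A set $S\ne\{\varepsilon\}$ is recurrent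 if it is factorial and for all $u,w\in S$ there is $v\in S$ with $uvw\in S$. A subset $X$ of a group $G$ is a monoidal basis of $G$ if it is symmetric (closed under taking inverses), the monoid it generates is $G$, and any product $x_1x_2\cdots x_m$ ($m\ge1$) of elements of $X$ such that $x_kx_{k+1}\neq 1$ for $1\le k\le m-1$ is different from $1$. For a set $X\subset S$ of nonempty words, a complete return word to $X$ is a word of $S$ with a proper prefix in $X$, a proper suffix in $X$ but no internal factor in $X$ ($v$ is an internal factor of $y$ if $y=uvw$ with $u,w$ nonempty). Two words $u,v$ overlap if a nonempty suffix of one of them is a prefix of the other. If $w,w^{-1}$ do not overlap, with each complete return word $u$ to $\{w,w^{-1}\}$ one associates the word $N(u)$ obtained from $u$ by erasing the prefix $w$ if $u$ has $w$ as a prefix, and erasing the suffix $w^{-1}$ if $u$ has $w^{-1}$ as a suffix. The set $\mathcal{MR}_S(w)$ of mixed return words to $w$ is the set of words $N(u)$ for $u$ a complete return word to $\{w,w^{-1}\}$. *)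

theory Defs
  imports "HOL-Algebra.Group" "HOL-Library.Sublist" "HOL-Library.Disjoint_Sets" "HOL.Hull"
begin

text \<open>An undirected simple graph is given by a vertex set \<open>V\<close> and a set \<open>E\<close> of two-element
  subsets of \<open>V\<close>. The notion of tree in \<open>Graph_Theory\<close> is not usable here: it forbids directed
  cycles, hence no symmetric digraph with an edge is a tree, and every digraph with all arcs
  going from left to right is a forest.\<close>

definition graph_connected :: "'v set \<Rightarrow> 'v set set \<Rightarrow> bool" where
  "graph_connected V E \<longleftrightarrow> (\<forall>u\<in>V. \<forall>v\<in>V. (u, v) \<in> {(x, y). {x, y} \<in> E}\<^sup>*)"

definition graph_cycle :: "'v set \<Rightarrow> 'v set set \<Rightarrow> 'v list \<Rightarrow> bool" where
  "graph_cycle V E p \<longleftrightarrow> 3 \<le> length p \<and> distinct p \<and> set p \<subseteq> V \<and>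
     (\<forall>i<length p. {p ! i, p ! (Suc i mod length p)} \<in> E)"

definition graph_tree :: "'v set \<Rightarrow> 'v set set \<Rightarrow> bool" where
  "graph_tree V E \<longleftrightarrow> V \<noteq> {} \<and> graph_connected V E \<and> (\<nexists>p. graph_cycle V E p)"

definition disjoint_union_of_trees :: "nat \<Rightarrow> 'v set \<Rightarrow> 'v set set \<Rightarrow> bool" where
  "disjoint_union_of_trees c V E \<longleftrightarrow>
     (\<exists>P. partition_on V P \<and> finite P \<and> card P = c \<and>
          (\<forall>e\<in>E. \<exists>C\<in>P. e \<subseteq> C) \<and>
          (\<forall>C\<in>P. graph_tree C {e \<in> E. e \<subseteq> C}))"

definition factorial_set :: "'a set \<Rightarrow> 'a list set \<Rightarrow> bool" where
  "factorial_set A S \<longleftrightarrow> S \<subseteq> lists A \<and> (\<forall>a\<in>A. [a] \<in> S) \<and>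
     (\<forall>w\<in>S. \<forall>v. sublist v w \<longrightarrow> v \<in> S)"

definition left_ext :: "'a set \<Rightarrow> 'a list set \<Rightarrow> 'a list \<Rightarrow> 'a set" where
  "left_ext A S w = {a \<in> A. a # w \<in> S}"

definition right_ext :: "'a set \<Rightarrow> 'a list set \<Rightarrow> 'a list \<Rightarrow> 'a set" where
  "right_ext A S w = {a \<in> A. w @ [a] \<in> S}"

definition bi_ext :: "'a set \<Rightarrow> 'a list set \<Rightarrow> 'a list \<Rightarrow> ('a \<times> 'a) set" where
  "bi_ext A S w = {(a, b) \<in> A \<times> A. a # w @ [b] \<in> S}"

definition biextendable :: "'a set \<Rightarrow> 'a list set \<Rightarrow> bool" where
  "biextendable A S \<longleftrightarrow> factorial_set A S \<and> (\<forall>w\<in>S. bi_ext A S w \<noteq> {})"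

definition ext_vertices :: "'a set \<Rightarrow> 'a list set \<Rightarrow> 'a list \<Rightarrow> ('a + 'a) set" where
  "ext_vertices A S w = left_ext A S w <+> right_ext A S w"

definition ext_edges :: "'a set \<Rightarrow> 'a list set \<Rightarrow> 'a list \<Rightarrow> ('a + 'a) set set" where
  "ext_edges A S w = (\<lambda>(a, b). {Inl a, Inr b}) ` bi_ext A S w"

definition tree_set :: "'a set \<Rightarrow> nat \<Rightarrow> 'a list set \<Rightarrow> bool" where
  "tree_set A c S \<longleftrightarrow> biextendable A S \<and>
     (\<forall>w\<in>S. w \<noteq> [] \<longrightarrow> graph_tree (ext_vertices A S w) (ext_edges A S w)) \<and>
     disjoint_union_of_trees c (ext_vertices A S []) (ext_edges A S [])"

definition recurrent :: "'a set \<Rightarrow> 'a list set \<Rightarrow> bool" where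
  "recurrent A S \<longleftrightarrow> S \<noteq> {[]} \<and> factorial_set A S \<and>
     (\<forall>u\<in>S. \<forall>w\<in>S. \<exists>v\<in>S. u @ v @ w \<in> S)"

definition involution_on :: "'a set \<Rightarrow> ('a \<Rightarrow> 'a) \<Rightarrow> bool" where
  "involution_on A \<theta> \<longleftrightarrow> (\<forall>a\<in>A. \<theta> a \<in> A \<and> \<theta> (\<theta> a) = a)"

definition reduced :: "'a set \<Rightarrow> ('a \<Rightarrow> 'a) \<Rightarrow> 'a list \<Rightarrow> bool" where
  "reduced A \<theta> w \<longleftrightarrow> w \<in> lists A \<and> (\<forall>a\<in>A. \<not> sublist [a, \<theta> a] w)"

definition word_inv :: "('a \<Rightarrow> 'a) \<Rightarrow> 'a list \<Rightarrow> 'a list" where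
  "word_inv \<theta> w = rev (map \<theta> w)"

definition laminary :: "'a set \<Rightarrow> ('a \<Rightarrow> 'a) \<Rightarrow> 'a list set \<Rightarrow> bool" where
  "laminary A \<theta> S \<longleftrightarrow> biextendable A S \<and> (\<forall>w\<in>S. reduced A \<theta> w) \<and> (\<forall>w\<in>S. word_inv \<theta> w \<in> S)"

definition specular :: "'a set \<Rightarrow> ('a \<Rightarrow> 'a) \<Rightarrow> 'a list set \<Rightarrow> bool" where
  "specular A \<theta> S \<longleftrightarrow> laminary A \<theta> S \<and> tree_set A 2 S"

definition internal_factor :: "'a list \<Rightarrow> 'a list \<Rightarrow> bool" where
  "internal_factor v y \<longleftrightarrow> (\<exists>u w. u \<noteq> [] \<and> w \<noteq> [] \<and> y = u @ v @ w)"

definition complete_return_words :: "'a list set \<Rightarrow> 'a list set \<Rightarrow> 'a list set" where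
  "complete_return_words S X =
     {u \<in> S. (\<exists>x\<in>X. strict_prefix x u) \<and> (\<exists>x\<in>X. strict_suffix x u) \<and>
             (\<forall>x\<in>X. \<not> internal_factor x u)}"

definition overlap :: "'a list \<Rightarrow> 'a list \<Rightarrow> bool" where
  "overlap u v \<longleftrightarrow> (\<exists>s. s \<noteq> [] \<and> (suffix s u \<and> prefix s v \<or> suffix s v \<and> prefix s u))"

text \<open>Both erasures are decided by the original word \<open>u\<close>.\<close>

definition mixed_erase :: "('a \<Rightarrow> 'a) \<Rightarrow> 'a list \<Rightarrow> 'a list \<Rightarrow> 'a list" where
  "mixed_erase \<theta> w u =
     (let u' = (if prefix w u then drop (length w) u else u)
      in if suffix (word_inv \<theta> w) u then take (length u' - length (word_inv \<theta> w)) u' else u')"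

definition mixed_return_words :: "('a \<Rightarrow> 'a) \<Rightarrow> 'a list set \<Rightarrow> 'a list \<Rightarrow> 'a list set" where
  "mixed_return_words \<theta> S w = mixed_erase \<theta> w ` complete_return_words S {w, word_inv \<theta> w}"

text \<open>A signed letter \<open>(a, True)\<close> stands for \<open>a\<close> and \<open>(a, False)\<close> for its formal inverse.
  The group generated by \<open>A\<close> with relations \<open>r = 1\<close>, for \<open>r \<in> Rs\<close>, consists of the classes of
  words of signed letters modulo the congruence generated by free cancellation and \<open>Rs\<close>.\<close>

abbreviation signed_words :: "'a set \<Rightarrow> ('a \<times> bool) list set" where
  "signed_words A \<equiv> lists (A \<times> UNIV)"

inductive pres_eq ::
  "'a set \<Rightarrow> ('a \<times> bool) list set \<Rightarrow> ('a \<times> bool) list \<Rightarrow> ('a \<times> bool) list \<Rightarrow> bool"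
  for A Rs where
  pres_refl: "u \<in> signed_words A \<Longrightarrow> pres_eq A Rs u u"
| pres_sym: "pres_eq A Rs u v \<Longrightarrow> pres_eq A Rs v u"
| pres_trans: "pres_eq A Rs u v \<Longrightarrow> pres_eq A Rs v w \<Longrightarrow> pres_eq A Rs u w"
| pres_cancel: "a \<in> A \<Longrightarrow> x \<in> signed_words A \<Longrightarrow> y \<in> signed_words A \<Longrightarrow>
    pres_eq A Rs (x @ [(a, s), (a, \<not> s)] @ y) (x @ y)"
| pres_relator: "r \<in> Rs \<Longrightarrow> r \<in> signed_words A \<Longrightarrow> x \<in> signed_words A \<Longrightarrow> y \<in> signed_words A \<Longrightarrow>
    pres_eq A Rs (x @ r @ y) (x @ y)"

definition pres_rel :: "'a set \<Rightarrow> ('a \<times> bool) list set \<Rightarrow> ('a \<times> bool) list rel" where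
  "pres_rel A Rs = {(u, v). pres_eq A Rs u v}"

definition presented_group ::
  "'a set \<Rightarrow> ('a \<times> bool) list set \<Rightarrow> ('a \<times> bool) list set monoid" where
  "presented_group A Rs =
     \<lparr>carrier = signed_words A // pres_rel A Rs,
      mult = (\<lambda>X Y. \<Union>x\<in>X. \<Union>y\<in>Y. pres_rel A Rs `` {x @ y}),
      one = pres_rel A Rs `` {[]}\<rparr>"

definition theta_relators :: "'a set \<Rightarrow> ('a \<Rightarrow> 'a) \<Rightarrow> ('a \<times> bool) list set" where
  "theta_relators A \<theta> = {[(a, True), (\<theta> a, True)] | a. a \<in> A}"

definition G_theta :: "'a set \<Rightarrow> ('a \<Rightarrow> 'a) \<Rightarrow> ('a \<times> bool) list set monoid" where
  "G_theta A \<theta> = presented_group A (theta_relators A \<theta>)"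

text \<open>Every element of \<open>G_theta A \<theta>\<close> is represented by a unique reduced word over \<open>A\<close>; the
  identification of reduced words with group elements is made explicit by the following map.\<close>

definition word_elem :: "'a set \<Rightarrow> ('a \<Rightarrow> 'a) \<Rightarrow> 'a list \<Rightarrow> ('a \<times> bool) list set" where
  "word_elem A \<theta> w = pres_rel A (theta_relators A \<theta>) `` {map (\<lambda>a. (a, True)) w}"

lemma pres_eq_words: "pres_eq A Rs u v \<Longrightarrow> u \<in> signed_words A \<and> v \<in> signed_words A"
  by (induction rule: pres_eq.induct) auto

lemma equiv_pres_rel: "equiv (signed_words A) (pres_rel A Rs)"
proof (rule equivI)
  show "pres_rel A Rs \<subseteq> signed_words A \<times> signed_words A"
    using pres_eq_words unfolding pres_rel_def by blast
  show "refl_on (signed_words A) (pres_rel A Rs)"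
    unfolding refl_on_def pres_rel_def by (simp add: pres_refl)
  show "sym (pres_rel A Rs)"
    unfolding pres_rel_def by (rule symI) (simp add: pres_sym)
  show "trans (pres_rel A Rs)"
    unfolding pres_rel_def by (rule transI) (simp, rule pres_trans)
qed

lemma pres_eq_context:
  assumes "pres_eq A Rs u v" "p \<in> signed_words A" "q \<in> signed_words A"
  shows "pres_eq A Rs (p @ u @ q) (p @ v @ q)"
  using assms
proof (induction rule: pres_eq.induct)
  case (pres_cancel a x y s)
  then show ?case using pres_eq.pres_cancel[of a A "p @ x" "y @ q" Rs s] by simp
next
  case (pres_relator r x y)
  then show ?case using pres_eq.pres_relator[of r Rs A "p @ x" "y @ q"] by simp
next
  case (pres_refl u)
  then show ?case by (intro pres_eq.pres_refl) simp
next
  case (pres_sym u v)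
  then show ?case by (blast intro: pres_eq.pres_sym)
next
  case (pres_trans u v w)
  show ?case
    by (rule pres_eq.pres_trans[OF pres_trans.IH(1)[OF pres_trans.prems]
          pres_trans.IH(2)[OF pres_trans.prems]])
qed

lemma pres_eq_append:
  assumes "pres_eq A Rs u u'" "pres_eq A Rs v v'"
  shows "pres_eq A Rs (u @ v) (u' @ v')"
proof (rule pres_trans)
  show "pres_eq A Rs (u @ v) (u' @ v)"
    using pres_eq_context[OF assms(1), of "[]" v] pres_eq_words[OF assms(2)] by simp
  show "pres_eq A Rs (u' @ v) (u' @ v')"
    using pres_eq_context[OF assms(2), of u' "[]"] pres_eq_words[OF assms(1)] by simp
qed

lemma presented_mult:
  assumes "u \<in> signed_words A" "v \<in> signed_words A"
  shows "pres_rel A Rs `` {u} \<otimes>\<^bsub>presented_group A Rs\<^esub> pres_rel A Rs `` {v}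
         = pres_rel A Rs `` {u @ v}"
proof -
  have "congruent2 (pres_rel A Rs) (pres_rel A Rs) (\<lambda>x y. pres_rel A Rs `` {x @ y})"
    by (rule congruent2I', rule equiv_class_eq[OF equiv_pres_rel])
       (simp add: pres_rel_def pres_eq_append)
  then show ?thesis
    using UN_equiv_class2[OF equiv_pres_rel equiv_pres_rel] assms
    by (simp add: presented_group_def)
qed

lemma presented_carrier:
  "carrier (presented_group A Rs) = (\<lambda>u. pres_rel A Rs `` {u}) ` signed_words A"
  by (auto simp: presented_group_def quotient_def)

lemma formal_inverse_words: "u \<in> signed_words A \<Longrightarrow> map (apsnd Not) (rev u) \<in> signed_words A"
  by (force simp: lists_eq_set)

lemma presented_inverse:
  assumes "u \<in> signed_words A"
  shows "pres_eq A Rs (map (apsnd Not) (rev u) @ u) []"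
  using assms
proof (induction u)
  case Nil
  show ?case by (simp add: pres_refl)
next
  case (Cons b u)
  obtain a s where b: "b = (a, s)" by (cases b)
  have "pres_eq A Rs (map (apsnd Not) (rev u) @ [(a, \<not> s), (a, \<not> \<not> s)] @ u)
                     (map (apsnd Not) (rev u) @ u)"
    using Cons.hyps b by (intro pres_cancel formal_inverse_words) auto
  then show ?case using pres_trans[OF _ Cons.IH] b by simp
qed

lemma group_presented_group: "group (presented_group A Rs)"
proof (rule groupI)
  have one: "\<one>\<^bsub>presented_group A Rs\<^esub> = pres_rel A Rs `` {[]}"
    by (simp add: presented_group_def)
  show "\<one>\<^bsub>presented_group A Rs\<^esub> \<in> carrier (presented_group A Rs)"
    unfolding one presented_carrier by auto
  fix X assume "X \<in> carrier (presented_group A Rs)"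
  then obtain u where u: "u \<in> signed_words A" "X = pres_rel A Rs `` {u}"
    by (auto simp: presented_carrier)
  show "\<one>\<^bsub>presented_group A Rs\<^esub> \<otimes>\<^bsub>presented_group A Rs\<^esub> X = X"
    unfolding one u(2) using u(1) by (subst presented_mult) auto
  show "\<exists>Y\<in>carrier (presented_group A Rs).
          Y \<otimes>\<^bsub>presented_group A Rs\<^esub> X = \<one>\<^bsub>presented_group A Rs\<^esub>"
  proof
    let ?v = "map (apsnd Not) (rev u)"
    have v: "?v \<in> signed_words A" using u(1) by (rule formal_inverse_words)
    show "pres_rel A Rs `` {?v} \<in> carrier (presented_group A Rs)"
      unfolding presented_carrier using v by blast
    show "pres_rel A Rs `` {?v} \<otimes>\<^bsub>presented_group A Rs\<^esub> X = \<one>\<^bsub>presented_group A Rs\<^esub>"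
      unfolding one u(2) presented_mult[OF v u(1)]
      using presented_inverse[OF u(1), of Rs]
      by (intro equiv_class_eq[OF equiv_pres_rel]) (simp add: pres_rel_def)
  qed
next
  fix X Y Z
  assume "X \<in> carrier (presented_group A Rs)" "Y \<in> carrier (presented_group A Rs)"
    "Z \<in> carrier (presented_group A Rs)"
  then obtain x y z where xyz:
      "x \<in> signed_words A" "X = pres_rel A Rs `` {x}"
      "y \<in> signed_words A" "Y = pres_rel A Rs `` {y}"
      "z \<in> signed_words A" "Z = pres_rel A Rs `` {z}"
    unfolding presented_carrier by blast
  then have xy: "x @ y \<in> signed_words A" and yz: "y @ z \<in> signed_words A" by simp_all
  show "X \<otimes>\<^bsub>presented_group A Rs\<^esub> Y \<otimes>\<^bsub>presented_group A Rs\<^esub> Z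
      = X \<otimes>\<^bsub>presented_group A Rs\<^esub> (Y \<otimes>\<^bsub>presented_group A Rs\<^esub> Z)"
    unfolding xyz(2,4,6) presented_mult[OF xyz(1,3)] presented_mult[OF xyz(3,5)]
      presented_mult[OF xy xyz(5)] presented_mult[OF xyz(1) yz] by simp
next
  fix X Y
  assume "X \<in> carrier (presented_group A Rs)" "Y \<in> carrier (presented_group A Rs)"
  then obtain x y where xy:
      "x \<in> signed_words A" "X = pres_rel A Rs `` {x}"
      "y \<in> signed_words A" "Y = pres_rel A Rs `` {y}"
    unfolding presented_carrier by blast
  then have "x @ y \<in> signed_words A" by simp
  then show "X \<otimes>\<^bsub>presented_group A Rs\<^esub> Y \<in> carrier (presented_group A Rs)"
    unfolding xy(2,4) presented_mult[OF xy(1,3)] presented_carrier by (rule imageI)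
qed

lemma group_G_theta: "group (G_theta A \<theta>)"
  unfolding G_theta_def by (rule group_presented_group)

definition monoidal_basis :: "('g, 'm) monoid_scheme \<Rightarrow> 'g set \<Rightarrow> bool" where
  "monoidal_basis G X \<longleftrightarrow> X \<subseteq> carrier G \<and> (\<forall>x\<in>X. inv\<^bsub>G\<^esub> x \<in> X) \<and>
     (\<lambda>H. submonoid H G) hull X = carrier G \<and>
     (\<forall>xs\<in>lists X. xs \<noteq> [] \<longrightarrow>
        (\<forall>k. Suc k < length xs \<longrightarrow> xs ! k \<otimes>\<^bsub>G\<^esub> xs ! Suc k \<noteq> \<one>\<^bsub>G\<^esub>) \<longrightarrow>
        foldr (\<otimes>\<^bsub>G\<^esub>) xs \<one>\<^bsub>G\<^esub> \<noteq> \<one>\<^bsub>G\<^esub>)"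

end

theory Submission
  imports Defs "HOL-Library.Numeral_Type" "HOL-Algebra.Coset"
begin

text \<open>Call a position of a word a marker if \<open>w\<close> ends or \<open>w\<inverse>\<close> starts there. Since \<open>w\<close> and \<open>w\<inverse>\<close> do not
  overlap, mixed return words are the words read between consecutive markers, a description which is
  invariant under inversion.

  Generation uses the connectedness of the extension graphs. Let \<open>H\<close> be the subgroup generated by
  the mixed return words and attach to each position the coset of \<open>H\<close> reached from a marker. Any long
  word contains a marker, so this coset is determined by the long past and also by the long future
  of the position; by connectedness it depends only on the next letter, and then only on
  the component of that letter in the extension graph of the empty word. Inversion exchanges the two
  components, so all cosets equal \<open>H\<close>.

  Freeness uses the acyclicity of the extension graphs. A labelling of the edges of a forest by elements
  of a group has a potential. Hence a group-valued function of the factors of length \<open>m + 1\<close> is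
  cohomologous to one of the factors of length \<open>m\<close>, and finally to one of the letters. Any
  inverse-preserving map from the mixed return words to a group thus extends to \<open>G_theta A \<theta>\<close>; take the
  free product on the mixed return words, realised as permutations of its reduced words.\<close>

section \<open>Potentials on forests\<close>

text \<open>Labels live in an arbitrary \<open>group_add\<close>, written additively but not
  commutative, so the order of the summands matters in every potential. Two points need more than
  acyclicity. A return word can be charged to its first letter by looking at a bounded window only
  if the gaps between markers are bounded, and the definition of recurrence gives no such bound; it
  comes from counting branchings in the extension graphs. Moreover, the letter function so obtained
  is defective: it carries boundary terms \<open>gp\<close> and \<open>gm\<close> depending on the
  kind of marker, and it need not send \<open>\<theta> a\<close> to the inverse. The connectedness
  argument that gives generation also repairs this. It is therefore stated for an abstract action of
  letters on states and used twice: with right cosets under multiplication, and with group elements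
  under \<open>k \<mapsto> - \<phi>' a + k + \<phi> a\<close>, where \<open>\<phi>'\<close> is the
  mirror image of \<open>\<phi>\<close>. Both times the exchange of the two components by inversion
  finishes the argument.\<close>

lemma graph_treeD: "graph_tree V E \<Longrightarrow> u \<in> V \<Longrightarrow> v \<in> V \<Longrightarrow> (u, v) \<in> {(x, y). {x, y} \<in> E}\<^sup>*"
  by (simp only: graph_tree_def graph_connected_def)

lemma edge_invariant:
  assumes "(u, v) \<in> {(x, y). {x, y} \<in> E}\<^sup>*" and "\<And>x y. {x, y} \<in> E \<Longrightarrow> h x = h y"
  shows "h u = h v"
  using assms(1) by (induction rule: rtrancl_induct) (auto dest: assms(2))

lemma connected_invariant:
  assumes "graph_connected V E" and "\<And>x y. {x, y} \<in> E \<Longrightarrow> h x = h y"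
    and "u \<in> V" "v \<in> V"
  shows "h u = h v"
  using assms edge_invariant[of u v E h] by (auto simp: graph_connected_def)

text \<open>Cycles have no repeated vertices, so reachability must be turned into a simple path; a
  walk returning to a vertex of the path is cut back there.\<close>

lemma rtrancl_distinct_path:
  assumes "(u, v) \<in> {(x, y). {x, y} \<in> E}\<^sup>*"
  shows "\<exists>p. p \<noteq> [] \<and> distinct p \<and> hd p = u \<and> last p = v \<and>
           (\<forall>i. Suc i < length p \<longrightarrow> {p ! i, p ! Suc i} \<in> E)"
  using assms
proof (induction rule: rtrancl_induct)
  case base
  show ?case by (rule exI[of _ "[u]"]) simp
next
  case (step y z)
  then obtain p where p: "p \<noteq> []" "distinct p" "hd p = u" "last p = y"
      "\<And>i. Suc i < length p \<Longrightarrow> {p ! i, p ! Suc i} \<in> E" by blast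
  show ?case
  proof (cases "z \<in> set p")
    case True
    then obtain i where i: "i < length p" "p ! i = z" by (auto simp: in_set_conv_nth)
    have "last (take (Suc i) p) = z"
      using i by (simp add: take_Suc_conv_app_nth)
    then show ?thesis using i p by (intro exI[of _ "take (Suc i) p"]) auto
  next
    case False
    have "{(p @ [z]) ! i, (p @ [z]) ! Suc i} \<in> E" if "Suc i < length (p @ [z])" for i
    proof (cases "Suc i < length p")
      case False
      then have "i = length p - 1" "Suc i = length p" using that by auto
      then show ?thesis using p(1,4) step.hyps(2) by (simp add: nth_append last_conv_nth)
    qed (use p in \<open>simp add: nth_append\<close>)
    then show ?thesis using p False by (intro exI[of _ "p @ [z]"]) auto
  qed
qed

lemma graph_cycle_mono: "graph_cycle V E p \<Longrightarrow> E \<subseteq> F \<Longrightarrow> graph_cycle V F p"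
  unfolding graph_cycle_def by (elim conjE, intro conjI allI impI) (assumption+, erule subsetD, simp)

text \<open>Edges are added one at a time. The endpoints of a new edge lie in different components
  of the old graph, so the potential on the component of \<open>Inl a\<close> can be shifted by
  \<open>d\<close> without touching the other endpoint. On an old edge of that component the shift
  cancels as \<open>\<alpha> x + d + (- d + \<beta> y)\<close>, without commutativity.\<close>

lemma forest_potential_aux:
  fixes f :: "'a \<Rightarrow> 'b \<Rightarrow> 'g :: group_add"
  assumes "finite B" "\<nexists>p. graph_cycle UNIV ((\<lambda>(a, b). {Inl a, Inr b}) ` B) p"
  shows "\<exists>\<alpha> \<beta>. \<forall>a b. (a, b) \<in> B \<longrightarrow> f a b = \<alpha> a + \<beta> b"
  using assms
proof (induction B)
  case empty
  show ?case by simp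
next
  case (insert e B)
  obtain a b where e: "e = (a, b)" by (cases e)
  let ?E = "\<lambda>B. (\<lambda>(a, b). {Inl a, Inr b}) ` B"
  have "\<nexists>p. graph_cycle UNIV (?E B) p"
    using insert.prems graph_cycle_mono[of UNIV "?E B" _ "?E (insert e B)"] by blast
  then obtain \<alpha> \<beta> where ab: "\<And>x y. (x, y) \<in> B \<Longrightarrow> f x y = \<alpha> x + \<beta> y"
    using insert.IH by blast
  define C where "C = {v. (Inl a, v) \<in> {(x, y). {x, y} \<in> ?E B}\<^sup>*}"
  have C_iff: "v \<in> C \<longleftrightarrow> (Inl a, v) \<in> {(x, y). {x, y} \<in> ?E B}\<^sup>*" for v
    by (simp add: C_def)
  \<comment> \<open>A simple path between the endpoints in the old graph would close to a cycle with
    the new edge. Length 2 is impossible, since the path would then be the new edge itself.\<close>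
  have notin: "Inr b \<notin> C"
  proof
    assume "Inr b \<in> C"
    then obtain p where p: "p \<noteq> []" "distinct p" "hd p = Inl a" "last p = Inr b"
      "\<And>i. Suc i < length p \<Longrightarrow> {p ! i, p ! Suc i} \<in> ?E B"
      using rtrancl_distinct_path[of "Inl a" "Inr b" "?E B"] unfolding C_def by (simp only: mem_Collect_eq) metis
    have p0: "p ! 0 = Inl a" "p ! (length p - 1) = Inr b"
      using p by (simp_all add: hd_conv_nth last_conv_nth)
    have "length p \<noteq> 1"
    proof
      assume "length p = 1"
      then show False using p0 by simp
    qed
    moreover have "length p \<noteq> 2"
    proof
      assume l: "length p = 2"
      then have "{Inl a, Inr b} \<in> ?E B" using p(5)[of 0] p0 by (simp add: numeral_2_eq_2)
      then show False using insert.hyps(2) e by (auto simp: doubleton_eq_iff)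
    qed
    ultimately have len: "3 \<le> length p"
      using p(1) by (cases "length p"; cases "length p - 1") auto
    have "{p ! i, p ! (Suc i mod length p)} \<in> ?E (insert e B)" if "i < length p" for i
    proof (cases "Suc i < length p")
      case True
      then show ?thesis using p(5)[OF True] by auto
    next
      case False
      then have "Suc i = length p" "i = length p - 1" using that by auto
      then show ?thesis using p0 e by (simp add: insert_commute)
    qed
    then have "graph_cycle UNIV (?E (insert e B)) p"
      using len p(2) by (simp add: graph_cycle_def)
    then show False using insert.prems by blast
  qed
  have aC: "Inl a \<in> C" by (simp add: C_def)
  have closed: "Inl x \<in> C \<longleftrightarrow> Inr y \<in> C" if "(x, y) \<in> B" for x y
  proof -
    let ?R = "{(x, y). {x, y} \<in> ?E B}"
    have "(Inl x, Inr y) \<in> ?R" "(Inr y, Inl x) \<in> ?R"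
      using that by (force simp: insert_commute)+
    then show ?thesis
      unfolding C_iff
      using rtrancl_into_rtrancl[of "Inl a" "Inl x" ?R "Inr y"]
        rtrancl_into_rtrancl[of "Inl a" "Inr y" ?R "Inl x"] by argo
  qed
  \<comment> \<open>Forced by \<open>\<alpha> a + d + \<beta> b = f a b\<close>.\<close>
  define d where "d = - \<alpha> a + f a b - \<beta> b"
  define \<alpha>' where "\<alpha>' x = (if Inl x \<in> C then \<alpha> x + d else \<alpha> x)" for x
  define \<beta>' where "\<beta>' y = (if Inr y \<in> C then - d + \<beta> y else \<beta> y)" for y
  have "f x y = \<alpha>' x + \<beta>' y" if "(x, y) \<in> insert e B" for x y
  proof (cases "(x, y) \<in> B")
    case True
    then show ?thesis using ab[OF True] closed[OF True]
      by (simp add: \<alpha>'_def \<beta>'_def add.assoc)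
  next
    case False
    then have "x = a" "y = b" using that e by auto
    then show ?thesis using aC notin by (simp add: \<alpha>'_def \<beta>'_def d_def add.assoc)
  qed
  then show ?case by blast
qed

text \<open>A cycle visits only endpoints of edges, so acyclicity within \<open>V\<close> is
  acyclicity in the whole type.\<close>

lemma forest_potential:
  fixes f :: "'a \<Rightarrow> 'b \<Rightarrow> 'g :: group_add"
  assumes "finite B" and cyc: "\<nexists>p. graph_cycle V ((\<lambda>(a, b). {Inl a, Inr b}) ` B) p"
    and V: "\<And>a b. (a, b) \<in> B \<Longrightarrow> Inl a \<in> V \<and> Inr b \<in> V"
  obtains \<alpha> \<beta> where "\<And>a b. (a, b) \<in> B \<Longrightarrow> f a b = \<alpha> a + \<beta> b"
proof -
  have "\<nexists>p. graph_cycle UNIV ((\<lambda>(a, b). {Inl a, Inr b}) ` B) p"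
  proof
    assume "\<exists>p. graph_cycle UNIV ((\<lambda>(a, b). {Inl a, Inr b}) ` B) p"
    then obtain p where p: "graph_cycle UNIV ((\<lambda>(a, b). {Inl a, Inr b}) ` B) p" ..
    have "set p \<subseteq> V"
    proof
      fix x assume "x \<in> set p"
      then obtain i where "i < length p" "x = p ! i" by (auto simp: in_set_conv_nth)
      then have "{x, p ! (Suc i mod length p)} \<in> (\<lambda>(a, b). {Inl a, Inr b}) ` B"
        using p by (auto simp: graph_cycle_def)
      then show "x \<in> V" using V by (auto simp: doubleton_eq_iff)
    qed
    then have "graph_cycle V ((\<lambda>(a, b). {Inl a, Inr b}) ` B) p"
      using p by (simp add: graph_cycle_def)
    then show False using cyc by blast
  qed
  from forest_potential_aux[OF assms(1) this, of f] show thesis using that by blast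
qed

text \<open>A potential with values in the two-element group can be normalised to vanish at one vertex,
  so there are at least as many functions on the remaining vertices as on the edges.\<close>

lemma forest_card_edges:
  fixes L :: "'a set" and R :: "'b set"
  assumes fin: "finite L" "finite R" and B: "B \<subseteq> L \<times> R" and "L \<noteq> {}"
    and cyc: "\<nexists>p. graph_cycle (L <+> R) ((\<lambda>(a, b). {Inl a, Inr b}) ` B) p"
  shows "card B + 1 \<le> card L + card R"
proof -
  obtain a0 where a0: "a0 \<in> L" using \<open>L \<noteq> {}\<close> by blast
  have finB: "finite B" using fin B by (meson finite_SigmaI finite_subset)
  define P where "P = (PiE ((L - {a0}) <+> R) (\<lambda>_. UNIV :: 2 set))"
  define \<Phi> where "\<Phi> h = (\<lambda>(a, b)\<in>B. (if a = a0 then 0 else h (Inl a)) + h (Inr b))"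
    for h :: "'a + 'b \<Rightarrow> 2"
  have "PiE B (\<lambda>_. UNIV :: 2 set) \<subseteq> \<Phi> ` P"
  proof
    fix f :: "'a \<times> 'b \<Rightarrow> 2" assume f: "f \<in> PiE B (\<lambda>_. UNIV)"
    obtain \<alpha> \<beta> where ab: "\<And>a b. (a, b) \<in> B \<Longrightarrow> f (a, b) = \<alpha> a + \<beta> b"
      using forest_potential[OF finB cyc, of "\<lambda>a b. f (a, b)"] B by (auto 4 4)
    \<comment> \<open>Moving \<open>\<alpha> a0\<close> from the left values to the right ones keeps
      the sums and makes the value at \<open>Inl a0\<close> zero, the default built into
      \<open>\<Phi>\<close>.\<close>
    define h where "h = (\<lambda>v\<in>(L - {a0}) <+> R.
        case v of Inl a \<Rightarrow> \<alpha> a - \<alpha> a0 | Inr b \<Rightarrow> \<alpha> a0 + \<beta> b)"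
    have "\<Phi> h = f"
    proof
      fix e show "\<Phi> h e = f e"
      proof (cases "e \<in> B")
        case True
        then show ?thesis using B ab by (cases e) (auto simp: \<Phi>_def h_def)
      next
        case False
        then show ?thesis using f by (cases e) (auto simp: \<Phi>_def PiE_def extensional_def)
      qed
    qed
    moreover have "h \<in> P" by (auto simp: P_def h_def)
    ultimately show "f \<in> \<Phi> ` P" by blast
  qed
  moreover have "finite P" using fin by (auto simp: P_def intro!: finite_PiE)
  ultimately have "card (PiE B (\<lambda>_. UNIV :: 2 set)) \<le> card P"
    by (meson card_image_le card_mono finite_imageI le_trans)
  then have "(2::nat) ^ card B \<le> 2 ^ card ((L - {a0}) <+> R)"
    using fin finB by (simp add: P_def card_PiE)
  then have "card B \<le> card ((L - {a0}) <+> R)"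
    by (rule power_le_imp_le_exp[rotated]) simp
  also have "\<dots> = card L - 1 + card R" using fin a0 by (simp add: card_Plus)
  finally have "card B \<le> card L - 1 + card R" .
  moreover have "card L > 0" using a0 fin by (auto simp: card_gt_0_iff)
  ultimately show ?thesis by linarith
qed

section \<open>Extension graphs of specular sets\<close>

locale recurrent_specular =
  fixes A :: "'a set" and \<theta> :: "'a \<Rightarrow> 'a" and S :: "'a list set"
  assumes finite_A: "finite A" and involution: "involution_on A \<theta>"
    and specular: "specular A \<theta> S" and recurrent: "recurrent A S"
begin

abbreviation wi :: "'a list \<Rightarrow> 'a list" where "wi \<equiv> word_inv \<theta>"

lemma \<theta>_in: "a \<in> A \<Longrightarrow> \<theta> a \<in> A" and \<theta>_\<theta>: "a \<in> A \<Longrightarrow> \<theta> (\<theta> a) = a"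
  using involution by (auto simp: involution_on_def)

lemma wi_append: "wi (x @ y) = wi y @ wi x"
  by (simp add: word_inv_def)

lemma length_wi [simp]: "length (wi x) = length x"
  by (simp add: word_inv_def)

lemma wi_Nil [simp]: "wi [] = []" and wi_single [simp]: "wi [a] = [\<theta> a]"
  and wi_eq_Nil [simp]: "wi x = [] \<longleftrightarrow> x = []"
  by (simp_all add: word_inv_def)

lemma wi_wi: "x \<in> lists A \<Longrightarrow> wi (wi x) = x"
  by (induction x) (auto simp: word_inv_def \<theta>_\<theta> rev_map)

lemma factorial: "factorial_set A S"
  using recurrent by (simp add: recurrent_def)

lemma S_lists: "x \<in> S \<Longrightarrow> x \<in> lists A" and letters: "a \<in> A \<Longrightarrow> [a] \<in> S"
  and S_sublist: "x \<in> S \<Longrightarrow> sublist y x \<Longrightarrow> y \<in> S"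
  using factorial by (auto simp: factorial_set_def)

lemma S_infix: "p @ x @ q \<in> S \<Longrightarrow> x \<in> S" and S_prefix: "x @ q \<in> S \<Longrightarrow> x \<in> S"
  and S_suffix: "p @ x \<in> S \<Longrightarrow> x \<in> S"
  by (erule S_sublist; simp add: sublist_appendI)+

lemma S_Cons: "a # x \<in> S \<Longrightarrow> x \<in> S"
  using S_suffix[of "[a]" x] by simp

lemma S_take: "x \<in> S \<Longrightarrow> take i x \<in> S" and S_drop: "x \<in> S \<Longrightarrow> drop i x \<in> S"
  by (metis S_prefix append_take_drop_id, metis S_suffix append_take_drop_id)

lemma laminary: "laminary A \<theta> S" and tree_set: "tree_set A 2 S"
  using specular by (auto simp: specular_def)

lemma S_wi: "x \<in> S \<Longrightarrow> wi x \<in> S"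
  using laminary by (auto simp: laminary_def)

lemma S_reduced: "p @ [a, \<theta> a] @ q \<notin> S"
proof
  assume *: "p @ [a, \<theta> a] @ q \<in> S"
  then have "reduced A \<theta> (p @ [a, \<theta> a] @ q)" "a \<in> A"
    using laminary S_lists[OF *] by (auto simp: laminary_def)
  moreover have "sublist [a, \<theta> a] (p @ [a, \<theta> a] @ q)" by (rule sublist_appendI)
  ultimately show False unfolding reduced_def by blast
qed

lemma biext: "x \<in> S \<Longrightarrow> \<exists>a b. a # x @ [b] \<in> S"
  using laminary by (fastforce simp: laminary_def biextendable_def bi_ext_def)

lemma ext_right: "x \<in> S \<Longrightarrow> \<exists>b. x @ [b] \<in> S" and ext_left: "x \<in> S \<Longrightarrow> \<exists>a. a # x \<in> S"
proof -
  assume "x \<in> S"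
  then obtain a b where ab: "a # x @ [b] \<in> S" using biext by blast
  show "\<exists>b. x @ [b] \<in> S" using S_Cons[OF ab] by blast
  show "\<exists>a. a # x \<in> S" using S_prefix[of "a # x" "[b]"] ab by auto
qed

lemma ext_right_n: "x \<in> S \<Longrightarrow> \<exists>t. length t = k \<and> x @ t \<in> S"
proof (induction k)
  case (Suc k)
  then obtain t where "length t = k" "x @ t \<in> S" by blast
  moreover obtain b where "(x @ t) @ [b] \<in> S" using ext_right calculation by blast
  ultimately show ?case by (intro exI[of _ "t @ [b]"]) auto
qed simp

lemma ext_left_n: "x \<in> S \<Longrightarrow> \<exists>t. length t = k \<and> t @ x \<in> S"
proof (induction k)
  case (Suc k)
  then obtain t where "length t = k" "t @ x \<in> S" by blast
  moreover obtain a where "a # t @ x \<in> S" using ext_left calculation by blast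
  ultimately show ?case by (intro exI[of _ "a # t"]) auto
qed simp

lemma bi_ext_iff: "(a, b) \<in> bi_ext A S u \<longleftrightarrow> a # u @ [b] \<in> S"
  using S_lists[of "a # u @ [b]"] by (auto simp: bi_ext_def)

lemma left_ext_iff: "a \<in> left_ext A S u \<longleftrightarrow> a # u \<in> S"
  using S_lists[of "a # u"] by (auto simp: left_ext_def)

lemma right_ext_iff: "b \<in> right_ext A S u \<longleftrightarrow> u @ [b] \<in> S"
  using S_lists[of "u @ [b]"] by (auto simp: right_ext_def)

lemma bi_ext_subset: "bi_ext A S u \<subseteq> left_ext A S u \<times> right_ext A S u"
proof
  fix e assume e: "e \<in> bi_ext A S u"
  then obtain a b where ab: "e = (a, b)" "a # u @ [b] \<in> S"
    using bi_ext_iff by (cases e) blast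
  then show "e \<in> left_ext A S u \<times> right_ext A S u"
    using S_prefix[of "a # u" "[b]"] S_Cons by (auto simp: left_ext_iff right_ext_iff)
qed

lemma finite_ext: "finite (left_ext A S u)" "finite (right_ext A S u)" "finite (bi_ext A S u)"
  using finite_A by (auto simp: left_ext_def right_ext_def bi_ext_def intro: finite_subset[of _ "A \<times> A"])

lemma ext_edges_iff: "{Inl a, Inr b} \<in> ext_edges A S u \<longleftrightarrow> a # u @ [b] \<in> S"
  by (auto simp: ext_edges_def bi_ext_iff[symmetric] doubleton_eq_iff)

lemma ext_edgesE:
  assumes "{x, y} \<in> ext_edges A S u"
  obtains a b where "a # u @ [b] \<in> S" "x = Inl a \<and> y = Inr b \<or> x = Inr b \<and> y = Inl a"
proof -
  obtain a b where "(a, b) \<in> bi_ext A S u" "{x, y} = {Inl a, Inr b}"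
    using assms by (auto simp: ext_edges_def)
  then show thesis using that[of a b] by (auto simp: bi_ext_iff doubleton_eq_iff)
qed

lemma ext_tree: "u \<in> S \<Longrightarrow> u \<noteq> [] \<Longrightarrow> graph_tree (ext_vertices A S u) (ext_edges A S u)"
  using tree_set by (auto simp: tree_set_def)

lemma ext_graph_invariant:
  fixes h :: "'a + 'a \<Rightarrow> 'q"
  assumes u: "u \<in> S" "u \<noteq> []"
    and h: "\<And>a b. a # u @ [b] \<in> S \<Longrightarrow> h (Inl a) = h (Inr b)"
  shows "\<exists>q. (\<forall>a. a # u \<in> S \<longrightarrow> h (Inl a) = q) \<and> (\<forall>b. u @ [b] \<in> S \<longrightarrow> h (Inr b) = q)"
proof -
  obtain b0 where b0: "u @ [b0] \<in> S" using ext_right u by blast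
  have "h v = h (Inr b0)" if "v \<in> ext_vertices A S u" for v
  proof (rule connected_invariant[of "ext_vertices A S u" "ext_edges A S u" h])
    show "graph_connected (ext_vertices A S u) (ext_edges A S u)"
      using ext_tree[OF u] by (simp add: graph_tree_def)
    show "h x = h y" if "{x, y} \<in> ext_edges A S u" for x y
      using that by (rule ext_edgesE) (use h in auto)
  qed (use that b0 in \<open>auto simp: ext_vertices_def right_ext_iff\<close>)
  then show ?thesis
    by (intro exI[of _ "h (Inr b0)"]) (simp add: ext_vertices_def right_ext_iff left_ext_iff InlI InrI)
qed

lemma empty_components:
  "\<exists>C D. C \<union> D = ext_vertices A S [] \<and> C \<inter> D = {} \<and>
    (\<forall>e\<in>ext_edges A S []. e \<subseteq> C \<or> e \<subseteq> D) \<and>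
    graph_tree C {e \<in> ext_edges A S []. e \<subseteq> C} \<and>
    graph_tree D {e \<in> ext_edges A S []. e \<subseteq> D}"
proof -
  obtain P where P: "partition_on (ext_vertices A S []) P" "card P = 2"
    "\<And>e. e \<in> ext_edges A S [] \<Longrightarrow> \<exists>C\<in>P. e \<subseteq> C"
    "\<And>C. C \<in> P \<Longrightarrow> graph_tree C {e \<in> ext_edges A S []. e \<subseteq> C}"
    using tree_set by (auto simp: tree_set_def disjoint_union_of_trees_def)
  obtain C D where CD: "P = {C, D}" "C \<noteq> D" using P(2) by (auto simp: card_2_iff)
  have dj: "C \<inter> D = {}" using P(1) CD by (auto simp: partition_on_def disjoint_def)
  have un: "C \<union> D = ext_vertices A S []" using P(1) CD by (auto simp: partition_on_def)
  have "e \<subseteq> C \<or> e \<subseteq> D" if "e \<in> ext_edges A S []" for e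
    using P(3)[OF that] CD(1) by blast
  then show ?thesis using un dj P(4) CD(1)
    by (intro exI[of _ C] exI[of _ D]) simp
qed

lemma component_potential:
  fixes f :: "'a \<Rightarrow> 'a \<Rightarrow> 'g :: group_add"
  assumes "graph_tree C {e \<in> ext_edges A S u. e \<subseteq> C}"
  obtains \<alpha> \<beta> where "\<And>a b. a # u @ [b] \<in> S \<Longrightarrow> Inl a \<in> C \<Longrightarrow> Inr b \<in> C \<Longrightarrow> f a b = \<alpha> a + \<beta> b"
proof -
  let ?B = "{(a, b) \<in> bi_ext A S u. Inl a \<in> C \<and> Inr b \<in> C}"
  have eq: "(\<lambda>(a, b). {Inl a, Inr b}) ` ?B = {e \<in> ext_edges A S u. e \<subseteq> C}"
    by (auto simp: ext_edges_def)
  have "finite ?B" using finite_ext(3)[of u] by (rule finite_subset[rotated]) auto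
  moreover have "\<nexists>p. graph_cycle C ((\<lambda>(a, b). {Inl a, Inr b}) ` ?B) p"
    using assms unfolding eq graph_tree_def by (elim conjE)
  moreover have "Inl a \<in> C \<and> Inr b \<in> C" if "(a, b) \<in> ?B" for a b using that by auto
  ultimately obtain \<alpha> \<beta> where "\<And>a b. (a, b) \<in> ?B \<Longrightarrow> f a b = \<alpha> a + \<beta> b"
    using forest_potential[of ?B C f] by blast
  then show thesis using that[of \<alpha> \<beta>] by (auto simp: bi_ext_iff)
qed

text \<open>A potential needs acyclicity only. For the empty word the potentials of the two
  components are glued, as no edge joins them.\<close>

lemma ext_potential:
  fixes f :: "'a \<Rightarrow> 'a \<Rightarrow> 'g :: group_add"
  assumes "u \<in> S"
  shows "\<exists>\<alpha> \<beta>. \<forall>a b. a # u @ [b] \<in> S \<longrightarrow> f a b = \<alpha> a + \<beta> b"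
proof (cases "u = []")
  case False
  have sub: "e \<subseteq> ext_vertices A S u" if "e \<in> ext_edges A S u" for e
    using that bi_ext_subset[of u] by (auto simp: ext_edges_def ext_vertices_def)
  have "{e \<in> ext_edges A S u. e \<subseteq> ext_vertices A S u} = ext_edges A S u"
    using sub by blast
  with ext_tree[OF assms False]
  have "graph_tree (ext_vertices A S u) {e \<in> ext_edges A S u. e \<subseteq> ext_vertices A S u}"
    by simp
  from component_potential[OF this, of f] obtain \<alpha> \<beta> where
    ab: "\<And>a b. a # u @ [b] \<in> S \<Longrightarrow> Inl a \<in> ext_vertices A S u \<Longrightarrow> Inr b \<in> ext_vertices A S u
      \<Longrightarrow> f a b = \<alpha> a + \<beta> b" by blast
  have "f a b = \<alpha> a + \<beta> b" if "a # u @ [b] \<in> S" for a b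
    using that sub[of "{Inl a, Inr b}"] by (intro ab) (auto simp: ext_edges_iff)
  then show ?thesis by blast
next
  case True
  obtain C D where "C \<union> D = ext_vertices A S []" and CD: "C \<inter> D = {}"
    "\<forall>e\<in>ext_edges A S []. e \<subseteq> C \<or> e \<subseteq> D"
    and C: "graph_tree C {e \<in> ext_edges A S []. e \<subseteq> C}"
    and D: "graph_tree D {e \<in> ext_edges A S []. e \<subseteq> D}"
    using empty_components by (elim exE conjE) blast
  obtain \<alpha> \<beta> where ab: "\<And>a b. a # [] @ [b] \<in> S \<Longrightarrow> Inl a \<in> C \<Longrightarrow> Inr b \<in> C \<Longrightarrow> f a b = \<alpha> a + \<beta> b"
    using component_potential[OF C, of f] by blast
  obtain \<alpha>' \<beta>' where ab': "\<And>a b. a # [] @ [b] \<in> S \<Longrightarrow> Inl a \<in> D \<Longrightarrow> Inr b \<in> D \<Longrightarrow> f a b = \<alpha>' a + \<beta>' b"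
    using component_potential[OF D, of f] by blast
  have "f a b = (if Inl a \<in> C then \<alpha> a else \<alpha>' a) + (if Inr b \<in> C then \<beta> b else \<beta>' b)"
    if "a # u @ [b] \<in> S" for a b
  proof -
    have *: "a # [] @ [b] \<in> S" using that True by simp
    then have "{Inl a, Inr b} \<subseteq> C \<or> {Inl a, Inr b} \<subseteq> D"
      using CD(2) ext_edges_iff[of a b "[]"] by blast
    then show ?thesis using ab[OF *] ab'[OF *] CD(1) by auto
  qed
  then show ?thesis
    by (intro exI[of _ "\<lambda>a. if Inl a \<in> C then \<alpha> a else \<alpha>' a"]
        exI[of _ "\<lambda>b. if Inr b \<in> C then \<beta> b else \<beta>' b"]) blast
qed

text \<open>Inversion acts on the extension graph of the empty word by exchanging left and right.
  A component preserved by it would admit a labelling of its edges by 0 and 1 in which an edge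
  and its image get different labels (no edge is fixed, because words of \<open>S\<close> are reduced),
  and a potential of this labelling would solve \<open>2 * x = 1\<close> in the integers.\<close>

lemma component_not_symmetric:
  assumes CD: "C \<inter> D = {}" "\<And>e. e \<in> ext_edges A S [] \<Longrightarrow> e \<subseteq> C \<or> e \<subseteq> D"
    and tree: "graph_tree C {e \<in> ext_edges A S []. e \<subseteq> C}"
    and sub: "C \<subseteq> ext_vertices A S []"
    and a0: "Inl a0 \<in> C" "Inr (\<theta> a0) \<in> C"
  shows False
proof -
  define \<sigma> where "\<sigma> v = (case v of Inl a \<Rightarrow> Inr (\<theta> a) | Inr b \<Rightarrow> Inl (\<theta> b))" for v :: "'a + 'a"
  have conn: "graph_connected C {e \<in> ext_edges A S []. e \<subseteq> C}"
    using tree by (simp add: graph_tree_def)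
  have mirror: "[\<theta> b, \<theta> a] \<in> S" if "[a, b] \<in> S" for a b
    using S_wi[OF that] by (simp add: word_inv_def)
  have inC: "Inl a \<in> C \<longleftrightarrow> Inr b \<in> C" if "[a, b] \<in> S" for a b
    using CD(2)[of "{Inl a, Inr b}"] CD(1) ext_edges_iff[of a b "[]"] that by auto
  \<comment> \<open>The mirror image of an edge of \<open>C\<close> joins the images of its
    endpoints, so lying in \<open>C\<close> propagates from the image of \<open>Inl a0\<close> to
    all images.\<close>
  have \<sigma>C: "\<sigma> v \<in> C" if "v \<in> C" for v
  proof -
    have "(\<sigma> v \<in> C) = (\<sigma> (Inl a0) \<in> C)"
    proof (rule connected_invariant[OF conn, of "\<lambda>v. \<sigma> v \<in> C"])
      fix x y assume "{x, y} \<in> {e \<in> ext_edges A S []. e \<subseteq> C}"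
      then have "{x, y} \<in> ext_edges A S []" by blast
      then obtain a b where "a # [] @ [b] \<in> S" "x = Inl a \<and> y = Inr b \<or> x = Inr b \<and> y = Inl a"
        by (rule ext_edgesE)
      then show "(\<sigma> x \<in> C) = (\<sigma> y \<in> C)"
        using inC[OF mirror[of a b]] by (auto simp: \<sigma>_def)
    qed (use that a0 in auto)
    then show ?thesis using a0(2) by (simp add: \<sigma>_def)
  qed
  \<comment> \<open>Of an edge and its mirror image exactly one gets label 1: both are compared with
    a choice from the same two-element set.\<close>
  define f :: "'a \<Rightarrow> 'a \<Rightarrow> int"
    where "f a b = (if (a, b) = (SOME e. e \<in> {(a, b), (\<theta> b, \<theta> a)}) then 1 else 0)" for a b
  have f: "f a b + f (\<theta> b) (\<theta> a) = 1" if "[a, b] \<in> S" for a b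
  proof -
    have A: "a \<in> A" "b \<in> A" using S_lists[OF that] by auto
    have ne: "(a, b) \<noteq> (\<theta> b, \<theta> a)" using S_reduced[of "[]" a "[]"] that by auto
    let ?e = "SOME e. e \<in> {(a, b), (\<theta> b, \<theta> a)}"
    have "?e \<in> {(a, b), (\<theta> b, \<theta> a)}" by (rule someI[of _ "(a, b)"]) simp
    moreover have "{(\<theta> b, \<theta> a), (\<theta> (\<theta> a), \<theta> (\<theta> b))} = {(a, b), (\<theta> b, \<theta> a)}"
      using A by (auto simp: \<theta>_\<theta>)
    then have "f a b = (if (a, b) = ?e then 1 else 0)"
      "f (\<theta> b) (\<theta> a) = (if (\<theta> b, \<theta> a) = ?e then 1 else 0)"
      unfolding f_def by (simp_all only:)
    ultimately show ?thesis using ne by (elim insertE emptyE) auto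
  qed
  obtain \<alpha> \<beta> where ab: "\<And>a b. a # [] @ [b] \<in> S \<Longrightarrow> Inl a \<in> C \<Longrightarrow> Inr b \<in> C \<Longrightarrow> f a b = \<alpha> a + \<beta> b"
    using component_potential[OF tree, of f] by blast
  \<comment> \<open>The values at the ends of an edge agree because the labels of the edge and its
    mirror image add up to 1. At \<open>Inl a0\<close> and its mirror image they are
    \<open>x\<close> and \<open>1 - x\<close>, with
    \<open>x = \<alpha> a0 + \<beta> (\<theta> a0)\<close>.\<close>
  define h where "h v = (case v of Inl a \<Rightarrow> \<alpha> a + \<beta> (\<theta> a) | Inr b \<Rightarrow> 1 - (\<beta> b + \<alpha> (\<theta> b)))" for v
  have "h (Inl a0) = h (Inr (\<theta> a0))"
  proof (rule connected_invariant[OF conn])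
    fix x y assume *: "{x, y} \<in> {e \<in> ext_edges A S []. e \<subseteq> C}"
    then have "{x, y} \<in> ext_edges A S []" by blast
    then obtain a b where S: "a # [] @ [b] \<in> S" and xy: "x = Inl a \<and> y = Inr b \<or> x = Inr b \<and> y = Inl a"
      by (rule ext_edgesE)
    have C: "Inl a \<in> C" "Inr b \<in> C" using xy * by auto
    then have "Inr (\<theta> a) \<in> C" "Inl (\<theta> b) \<in> C" using \<sigma>C by (force simp: \<sigma>_def)+
    then have "f a b = \<alpha> a + \<beta> b" "f (\<theta> b) (\<theta> a) = \<alpha> (\<theta> b) + \<beta> (\<theta> a)" "f a b + f (\<theta> b) (\<theta> a) = 1"
      using ab[OF S C] ab[of "\<theta> b" "\<theta> a"] mirror[of a b] f[of a b] S by auto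
    then show "h x = h y" using xy by (auto simp: h_def)
  qed (use a0 in auto)
  moreover have "a0 \<in> A" using sub a0(1) by (auto simp: ext_vertices_def left_ext_def)
  ultimately have "2 * (\<alpha> a0 + \<beta> (\<theta> a0)) = 1" by (simp add: h_def \<theta>_\<theta>)
  then show False by presburger
qed

text \<open>The predicate \<open>J\<close> tells in which of the two components of the extension graph of the empty word
  a left vertex lies; the right vertex \<open>\<theta> a\<close> always lies in the other one.\<close>

lemma empty_graph_sides:
  obtains J where "\<And>a b. [a, b] \<in> S \<Longrightarrow> J a = (\<not> J (\<theta> b))"
    "\<And>a b. a \<in> A \<Longrightarrow> b \<in> A \<Longrightarrow> J a = J b \<Longrightarrow>
       (Inl a, Inl b) \<in> {(x, y). {x, y} \<in> ext_edges A S []}\<^sup>*"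
proof -
  obtain C D where un: "C \<union> D = ext_vertices A S []" and dj: "C \<inter> D = {}"
    and edges': "\<forall>e\<in>ext_edges A S []. e \<subseteq> C \<or> e \<subseteq> D"
    and C: "graph_tree C {e \<in> ext_edges A S []. e \<subseteq> C}"
    and D: "graph_tree D {e \<in> ext_edges A S []. e \<subseteq> D}"
    using empty_components by (elim exE conjE) blast
  have edges: "e \<subseteq> C \<or> e \<subseteq> D" if "e \<in> ext_edges A S []" for e using edges' that by (rule bspec)
  have vertex: "Inl a \<in> C \<union> D" "Inr a \<in> C \<union> D" if "a \<in> A" for a
    using that letters[OF that] by (auto simp: un ext_vertices_def left_ext_iff right_ext_iff)
  \<comment> \<open>\<open>component_not_symmetric\<close> is applied to each of the two components,
    whose roles are interchangeable.\<close>
  have swap: "Inr (\<theta> a) \<in> C \<longleftrightarrow> Inl a \<notin> C" if "a \<in> A" for a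
  proof
    show "Inl a \<notin> C" if "Inr (\<theta> a) \<in> C"
      using component_not_symmetric[OF dj edges C] un that by blast
    show "Inr (\<theta> a) \<in> C" if "Inl a \<notin> C"
      using component_not_symmetric[of D C a] dj edges D un that vertex[OF \<open>a \<in> A\<close>]
        vertex[OF \<theta>_in[OF \<open>a \<in> A\<close>]] by blast
  qed
  show thesis
  proof (rule that[of "\<lambda>a. Inl a \<in> C"])
    fix a b assume ab: "[a, b] \<in> S"
    then have "b \<in> A" using S_lists[OF ab] by simp
    have "{Inl a, Inr b} \<subseteq> C \<or> {Inl a, Inr b} \<subseteq> D"
      by (rule edges) (use ab in \<open>simp add: ext_edges_iff\<close>)
    then have "Inl a \<in> C \<longleftrightarrow> Inr b \<in> C" using dj by blast
    then show "(Inl a \<in> C) = (Inl (\<theta> b) \<notin> C)"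
      using swap[OF \<theta>_in[OF \<open>b \<in> A\<close>]] by (simp add: \<theta>_\<theta>[OF \<open>b \<in> A\<close>])
  next
    fix a b assume ab: "a \<in> A" "b \<in> A" "(Inl a \<in> C) = (Inl b \<in> C)"
    have mono: "{(x, y). {x, y} \<in> {e \<in> ext_edges A S []. e \<subseteq> X}}\<^sup>* \<subseteq> {(x, y). {x, y} \<in> ext_edges A S []}\<^sup>*"
      for X by (rule rtrancl_mono) blast
    show "(Inl a, Inl b) \<in> {(x, y). {x, y} \<in> ext_edges A S []}\<^sup>*"
    proof (cases "Inl a \<in> C")
      case True
      then have "(Inl a, Inl b) \<in> {(x, y). {x, y} \<in> {e \<in> ext_edges A S []. e \<subseteq> C}}\<^sup>*"
        using ab by (intro graph_treeD[OF C]) simp_all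
      then show ?thesis using mono by (rule subsetD[rotated])
    next
      case False
      then have "Inl a \<in> D" "Inl b \<in> D" using vertex ab by auto
      then have "(Inl a, Inl b) \<in> {(x, y). {x, y} \<in> {e \<in> ext_edges A S []. e \<subseteq> D}}\<^sup>*"
        by (rule graph_treeD[OF D])
      then show ?thesis using mono by (rule subsetD[rotated])
    qed
  qed
qed

text \<open>The hypotheses say that \<open>h\<close> agrees on pairs sharing a component, so the
  lemma expresses connectedness of the graph of pairs \<open>(s, t)\<close> with
  \<open>s @ u @ t\<close> in \<open>S\<close>. Peeling off the last letter of the right word
  reduces to extension graphs of words \<open>u @ t\<close>; a nonempty \<open>u\<close> avoids the
  disconnected graph of the empty word.\<close>

lemma two_sided_invariant_left1:
  fixes h :: "'a list \<Rightarrow> 'a list \<Rightarrow> 'q"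
  assumes "u \<noteq> []"
    and "\<And>s t t'. length s = 1 \<Longrightarrow> length t = l \<Longrightarrow> length t' = l \<Longrightarrow> s @ u @ t \<in> S \<Longrightarrow> s @ u @ t' \<in> S
      \<Longrightarrow> h s t = h s t'"
    and "\<And>s s' t. length s = 1 \<Longrightarrow> length s' = 1 \<Longrightarrow> length t = l \<Longrightarrow> s @ u @ t \<in> S \<Longrightarrow> s' @ u @ t \<in> S
      \<Longrightarrow> h s t = h s' t"
  shows "\<exists>q. \<forall>s t. length s = 1 \<longrightarrow> length t = l \<longrightarrow> s @ u @ t \<in> S \<longrightarrow> h s t = q"
  using assms
proof (induction l arbitrary: h)
  case 0
  show ?case
  proof (cases "\<exists>s. length s = 1 \<and> s @ u \<in> S")
    case True
    then obtain s where s: "length s = 1" "s @ u \<in> S" by blast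
    have "h s' t = h s []" if "length s' = 1" "length t = 0" "s' @ u @ t \<in> S" for s' t
      using 0(3)[of s' s "[]"] s that by simp
    then show ?thesis by blast
  qed auto
next
  case (Suc l)
  have const: "\<exists>q. \<forall>a b. a # u @ t @ [b] \<in> S \<longrightarrow> h [a] (t @ [b]) = q" if t: "length t = l" for t
  proof (cases "u @ t \<in> S")
    case False
    then show ?thesis using S_infix[of "[_]" "u @ t" "[_]"] by auto
  next
    case True
    \<comment> \<open>The value on an edge is determined by either endpoint, so any completion
      picked by \<open>SOME\<close> gives the label of the vertex.\<close>
    define H where "H v = (case v of
        Inl a \<Rightarrow> h [a] (t @ [SOME b. a # u @ t @ [b] \<in> S])
      | Inr b \<Rightarrow> h [SOME a. a # u @ t @ [b] \<in> S] (t @ [b]))" for v :: "'a + 'a"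
    have H: "H (Inl a) = h [a] (t @ [b]) \<and> H (Inr b) = h [a] (t @ [b])"
      if ab: "a # (u @ t) @ [b] \<in> S" for a b
    proof -
      have "a # u @ t @ [SOME b. a # u @ t @ [b] \<in> S] \<in> S"
        using ab someI[of "\<lambda>b. a # u @ t @ [b] \<in> S" b] by simp
      moreover have "(SOME a. a # u @ t @ [b] \<in> S) # u @ t @ [b] \<in> S"
        using ab someI[of "\<lambda>a. a # u @ t @ [b] \<in> S" a] by simp
      ultimately show ?thesis
        using ab t Suc.prems(2)[of "[a]" "t @ [b]" "t @ [SOME b. a # u @ t @ [b] \<in> S]"]
          Suc.prems(3)[of "[a]" "[SOME a. a # u @ t @ [b] \<in> S]" "t @ [b]"]
        by (simp add: H_def)
    qed
    have "\<exists>q. (\<forall>a. a # u @ t \<in> S \<longrightarrow> H (Inl a) = q) \<and> (\<forall>b. (u @ t) @ [b] \<in> S \<longrightarrow> H (Inr b) = q)"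
      by (rule ext_graph_invariant) (use True Suc.prems(1) H in auto)
    then obtain q where q: "\<And>a. a # u @ t \<in> S \<Longrightarrow> H (Inl a) = q" by blast
    have "h [a] (t @ [b]) = q" if "a # u @ t @ [b] \<in> S" for a b
      using H[of a b] q[of a] S_prefix[of "a # u @ t" "[b]"] that by auto
    then show ?thesis by blast
  qed
  then obtain k where k: "\<And>t a b. length t = l \<Longrightarrow> a # u @ t @ [b] \<in> S \<Longrightarrow> h [a] (t @ [b]) = k t"
    by metis
  have "\<exists>q. \<forall>s t. length s = 1 \<longrightarrow> length t = l \<longrightarrow> s @ u @ t \<in> S \<longrightarrow> k t = q"
  proof (rule Suc.IH[OF Suc.prems(1)])
    fix s t t' :: "'a list"
    assume *: "length s = 1" "length t = l" "length t' = l" "s @ u @ t \<in> S" "s @ u @ t' \<in> S"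
    then obtain a where a: "s = [a]" by (auto simp: length_Suc_conv)
    obtain b b' where b: "a # u @ t @ [b] \<in> S" "a # u @ t' @ [b'] \<in> S"
      using ext_right[OF *(4)] ext_right[OF *(5)] a by auto
    then show "k t = k t'"
      using k[OF *(2), of a b] k[OF *(3), of a b'] Suc.prems(2)[of "[a]" "t @ [b]" "t' @ [b']"] * by simp
  qed simp
  then obtain q where q: "\<And>s t. length s = 1 \<Longrightarrow> length t = l \<Longrightarrow> s @ u @ t \<in> S \<Longrightarrow> k t = q" by blast
  have "h s t = q" if st: "length s = 1" "length t = Suc l" "s @ u @ t \<in> S" for s t
  proof -
    obtain a where a: "s = [a]" using st(1) by (auto simp: length_Suc_conv)
    obtain t' b where t: "t = t' @ [b]" "length t' = l"
      using st(2) by (metis append_butlast_last_id diff_Suc_1 length_0_conv length_butlast nat.distinct(1))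
    have "a # u @ t' @ [b] \<in> S" using st a t by simp
    moreover have "[a] @ u @ t' \<in> S" using S_prefix[of "a # u @ t'" "[b]"] calculation by simp
    ultimately show ?thesis using k[OF t(2)] q[of "[a]" t'] t a by simp
  qed
  then show ?case by blast
qed

text \<open>For fixed \<open>s\<close> the one-letter case with core \<open>s @ u\<close> removes
  the dependence on the outermost left letter and on \<open>t\<close>; what remains is a function of
  the shorter \<open>s\<close>.\<close>

lemma two_sided_invariant:
  fixes h :: "'a list \<Rightarrow> 'a list \<Rightarrow> 'q"
  assumes "u \<noteq> []"
    and "\<And>s t t'. length s = k \<Longrightarrow> length t = l \<Longrightarrow> length t' = l \<Longrightarrow> s @ u @ t \<in> S \<Longrightarrow> s @ u @ t' \<in> S
      \<Longrightarrow> h s t = h s t'"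
    and "\<And>s s' t. length s = k \<Longrightarrow> length s' = k \<Longrightarrow> length t = l \<Longrightarrow> s @ u @ t \<in> S \<Longrightarrow> s' @ u @ t \<in> S
      \<Longrightarrow> h s t = h s' t"
  shows "\<exists>q. \<forall>s t. length s = k \<longrightarrow> length t = l \<longrightarrow> s @ u @ t \<in> S \<longrightarrow> h s t = q"
  using assms
proof (induction k arbitrary: h)
  case 0
  show ?case
  proof (cases "\<exists>t. length t = l \<and> u @ t \<in> S")
    case True
    then obtain t where t: "length t = l" "u @ t \<in> S" by blast
    have "h s t' = h [] t" if "length s = 0" "length t' = l" "s @ u @ t' \<in> S" for s t'
      using 0(2)[of "[]" t' t] t that by simp
    then show ?thesis by blast
  qed auto
next
  case (Suc k)
  have const: "\<exists>q. \<forall>a t. length t = l \<longrightarrow> a # s @ u @ t \<in> S \<longrightarrow> h (a # s) t = q" if s: "length s = k" for s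
  proof -
    have "\<exists>q. \<forall>x t. length x = 1 \<longrightarrow> length t = l \<longrightarrow> x @ (s @ u) @ t \<in> S \<longrightarrow> h (x @ s) t = q"
    proof (rule two_sided_invariant_left1)
      show "h (x @ s) t = h (x @ s) t'"
        if "length x = 1" "length t = l" "length t' = l" "x @ (s @ u) @ t \<in> S" "x @ (s @ u) @ t' \<in> S" for x t t'
        using that s by (intro Suc.prems(2)) simp_all
      show "h (x @ s) t = h (x' @ s) t"
        if "length x = 1" "length x' = 1" "length t = l" "x @ (s @ u) @ t \<in> S" "x' @ (s @ u) @ t \<in> S" for x x' t
        using that s by (intro Suc.prems(3)) simp_all
    qed (use Suc.prems(1) in simp)
    then obtain q where "\<And>x t. length x = 1 \<Longrightarrow> length t = l \<Longrightarrow> x @ (s @ u) @ t \<in> S \<Longrightarrow> h (x @ s) t = q"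
      by blast
    from this[of "[_]"] show ?thesis by auto
  qed
  then obtain m where m: "\<And>s a t. length s = k \<Longrightarrow> length t = l \<Longrightarrow> a # s @ u @ t \<in> S \<Longrightarrow> h (a # s) t = m s"
    by metis
  have m_eq: "m s = m s'"
    if *: "length s = k" "length s' = k" "length t = l" "s @ u @ t \<in> S" "s' @ u @ t \<in> S" for s s' t
  proof -
    obtain a a' where "a # s @ u @ t \<in> S" "a' # s' @ u @ t \<in> S"
      using ext_left[OF *(4)] ext_left[OF *(5)] by auto
    then show ?thesis
      using m[OF *(1,3)] m[OF *(2,3)] Suc.prems(3)[of "a # s" "a' # s'" t] * by simp
  qed
  have "\<exists>q. \<forall>s t. length s = k \<longrightarrow> length t = l \<longrightarrow> s @ u @ t \<in> S \<longrightarrow> m s = q"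
    by (rule Suc.IH[OF Suc.prems(1) refl]) (rule m_eq)
  then obtain q where q: "\<And>s t. length s = k \<Longrightarrow> length t = l \<Longrightarrow> s @ u @ t \<in> S \<Longrightarrow> m s = q" by blast
  have "h s t = q" if st: "length s = Suc k" "length t = l" "s @ u @ t \<in> S" for s t
  proof -
    obtain a s' where s: "s = a # s'" "length s' = k" using st(1) by (auto simp: length_Suc_conv)
    then show ?thesis using m[OF s(2) st(2), of a] q[OF s(2) st(2)] st S_Cons by simp
  qed
  then show ?case by blast
qed

end

section \<open>Uniform recurrence\<close>

context recurrent_specular
begin

lemma finite_words: "finite {x \<in> S. length x = n}"
  by (rule finite_subset[OF _ finite_lists_length_eq[OF finite_A, of n]]) (use S_lists in auto)

text \<open>Every word of \<open>S\<close> has a right extension, so on \<open>S\<close> the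
  subtraction is never truncated.\<close>

definition branching :: "'a list \<Rightarrow> nat" where
  "branching x = card (right_ext A S x) - 1"

text \<open>The edges are counted by summing \<open>card (right_ext A S (a # x))\<close> over
  \<open>a\<close>, and a nonempty forest has fewer edges than vertices.\<close>

lemma sum_branching_le:
  assumes "x \<in> S" "x \<noteq> []"
  shows "(\<Sum>a\<in>left_ext A S x. branching (a # x)) \<le> branching x"
proof -
  let ?L = "left_ext A S x" and ?R = "right_ext A S x" and ?B = "bi_ext A S x"
  have "?B = Sigma ?L (\<lambda>a. right_ext A S (a # x))"
    using bi_ext_subset[of x] by (auto simp: bi_ext_iff right_ext_iff)
  then have B: "card ?B = (\<Sum>a\<in>?L. card (right_ext A S (a # x)))"
    using finite_ext by simp
  have "card (right_ext A S (a # x)) = branching (a # x) + 1" if "a \<in> ?L" for a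
  proof -
    have "right_ext A S (a # x) \<noteq> {}"
      using ext_right[of "a # x"] that by (auto simp: left_ext_iff right_ext_iff)
    then have "card (right_ext A S (a # x)) > 0" using finite_ext by (simp add: card_gt_0_iff)
    then show ?thesis by (simp add: branching_def)
  qed
  then have "card ?B = (\<Sum>a\<in>?L. branching (a # x)) + card ?L"
    using B by (simp add: sum_Suc)
  moreover have "card ?B + 1 \<le> card ?L + card ?R"
  proof (rule forest_card_edges)
    show "?L \<noteq> {}" using ext_left[OF assms(1)] by (auto simp: left_ext_iff)
    show "\<nexists>p. graph_cycle (?L <+> ?R) ((\<lambda>(a, b). {Inl a, Inr b}) ` ?B) p"
      using ext_tree[OF assms] unfolding graph_tree_def ext_vertices_def ext_edges_def by (elim conjE)
  qed (use finite_ext bi_ext_subset in auto)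
  ultimately show ?thesis by (simp add: branching_def)
qed

definition avoiding :: "'a list \<Rightarrow> nat \<Rightarrow> 'a list set" where
  "avoiding w n = {x \<in> S. length x = n \<and> \<not> sublist w x}"

text \<open>These are the left extensions at which a word avoiding \<open>w\<close> first meets it:
  the only occurrence is as a prefix.\<close>

definition entering :: "'a list \<Rightarrow> nat \<Rightarrow> 'a list set" where
  "entering w n = {y \<in> S. length y = Suc n \<and> sublist w y \<and> \<not> sublist w (tl y)}"

lemma finite_avoiding: "finite (avoiding w n)" and finite_entering: "finite (entering w n)"
  by (rule finite_subset[OF _ finite_words[of n]], simp add: avoiding_def subset_eq)
     (rule finite_subset[OF _ finite_words[of "Suc n"]], simp add: entering_def subset_eq)

text \<open>Prolonging the words avoiding \<open>w\<close> by one letter on the left produces the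
  two families on the left-hand side, each word once. The bound for a single word requires it to be
  nonempty, hence \<open>n > 0\<close>.\<close>

lemma sum_avoiding_Suc_le:
  assumes "n > 0"
  shows "sum branching (avoiding w (Suc n)) + sum branching (entering w n)
    \<le> sum branching (avoiding w n)"
proof -
  let ?U = "avoiding w (Suc n) \<union> entering w n"
  let ?P = "Sigma (avoiding w n) (left_ext A S)"
  have sub_tl: "sublist w (tl y) \<Longrightarrow> sublist w y" for y
    by (meson sublist_order.order_trans sublist_tl)
  have U: "?U = (\<lambda>(x, a). a # x) ` ?P"
  proof (intro equalityI subsetI)
    fix y assume "y \<in> ?U"
    then have y: "y \<in> S" "length y = Suc n" "\<not> sublist w (tl y)"
      using sub_tl by (auto simp: avoiding_def entering_def)
    then obtain a x where ax: "y = a # x" by (cases y) auto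
    then have "(x, a) \<in> ?P" using y S_Cons by (auto simp: avoiding_def left_ext_iff)
    then show "y \<in> (\<lambda>(x, a). a # x) ` ?P" using ax by force
  next
    fix y assume "y \<in> (\<lambda>(x, a). a # x) ` ?P"
    then show "y \<in> ?U" by (auto simp: avoiding_def entering_def left_ext_iff)
  qed
  have "sum branching (avoiding w (Suc n)) + sum branching (entering w n) = sum branching ?U"
    by (rule sum.union_disjoint[symmetric, OF finite_avoiding finite_entering])
       (auto simp: avoiding_def entering_def)
  also have "\<dots> = (\<Sum>(x, a)\<in>?P. branching (a # x))"
    unfolding U by (subst sum.reindex) (auto simp: inj_on_def intro!: sum.cong)
  also have "\<dots> = (\<Sum>x\<in>avoiding w n. \<Sum>a\<in>left_ext A S x. branching (a # x))"
    by (rule sum.Sigma[symmetric]) (auto simp: finite_avoiding finite_ext)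
  also have "\<dots> \<le> sum branching (avoiding w n)"
    by (rule sum_mono, rule sum_branching_le) (use assms in \<open>auto simp: avoiding_def\<close>)
  finally show ?thesis .
qed

text \<open>The total branching of the words avoiding \<open>w\<close> decreases with the length, hence is eventually
  constant; from then on nothing branches after the last occurrence of \<open>w\<close>.\<close>

lemma eventually_deterministic:
  obtains n0 where "n0 \<ge> K"
    "\<And>y a b. n0 < length y \<Longrightarrow> sublist w y \<Longrightarrow> \<not> sublist w (tl y) \<Longrightarrow> y @ [a] \<in> S \<Longrightarrow> y @ [b] \<in> S
      \<Longrightarrow> a = b"
proof -
  let ?s = "\<lambda>n. sum branching (avoiding w n)"
  \<comment> \<open>\<open>Suc K\<close> instead of \<open>K\<close> keeps the lengths positive, as
    monotonicity of the totals requires.\<close>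
  obtain n0 where n0: "n0 \<ge> Suc K" "\<And>n. n \<ge> Suc K \<Longrightarrow> ?s n0 \<le> ?s n"
    using ex_has_least_nat[of "\<lambda>n. n \<ge> Suc K" "Suc K" ?s] by auto
  have anti: "?s n \<le> ?s n0" if "n \<ge> n0" for n
    using that
  proof (induction n rule: dec_induct)
    case (step n)
    then show ?case using sum_avoiding_Suc_le[of n w] n0(1) by linarith
  qed simp
  have "a = b" if y: "n0 < length y" "sublist w y" "\<not> sublist w (tl y)" "y @ [a] \<in> S" "y @ [b] \<in> S"
    for y a b
  proof -
    obtain n where n: "length y = Suc n" using y(1) by (cases "length y") auto
    then have "n \<ge> n0" using y(1) by simp
    then have "sum branching (entering w n) = 0"
      using sum_avoiding_Suc_le[of n w] n0(1) n0(2)[of "Suc n"] anti[of n] by simp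
    moreover have "y \<in> entering w n" using y n S_prefix by (auto simp: entering_def)
    ultimately have "branching y = 0" using finite_entering by auto
    then have "card (right_ext A S y) \<le> 1" by (simp add: branching_def)
    moreover have "a \<in> right_ext A S y" "b \<in> right_ext A S y" using y by (auto simp: right_ext_iff)
    ultimately show ?thesis using finite_ext(2)[of y] by (simp add: card_le_Suc0_iff_eq)
  qed
  then show thesis using that[of n0] n0(1) by simp
qed

text \<open>Beyond length \<open>n0\<close> a word with \<open>w\<close> only at its start has a
  forced continuation. Recurrence shows that this continuation meets \<open>w\<close> again, and the
  waiting time is bounded because there are finitely many words of length
  \<open>Suc n0\<close>.\<close>

lemma uniformly_recurrent:
  assumes "w \<in> S" "w \<noteq> []"
  obtains M where "\<And>x. x \<in> S \<Longrightarrow> M \<le> length x \<Longrightarrow> sublist w x"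
proof -
  obtain n0 where n0: "length w \<le> n0"
    and det: "\<And>y a b. n0 < length y \<Longrightarrow> sublist w y \<Longrightarrow> \<not> sublist w (tl y) \<Longrightarrow> y @ [a] \<in> S \<Longrightarrow> y @ [b] \<in> S
      \<Longrightarrow> a = b"
    by (rule eventually_deterministic[of "length w" w]) blast
  let ?Y = "{y \<in> S. length y = Suc n0}"
  have "\<forall>y\<in>?Y. \<exists>v. y @ v @ w \<in> S" using recurrent assms(1) by (auto simp: recurrent_def)
  then obtain v where v: "\<And>y. y \<in> ?Y \<Longrightarrow> y @ v y @ w \<in> S" by metis
  have "finite ((\<lambda>y. length (y @ v y @ w)) ` ?Y)" using finite_words by simp
  then obtain M0 where M0: "\<And>y. y \<in> ?Y \<Longrightarrow> length (y @ v y @ w) \<le> M0"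
    by (auto simp: finite_nat_set_iff_bounded_le)
  define M where "M = max M0 (Suc n0)"
  have short: "length y' < M" if y': "y' \<in> S" "prefix w y'" "\<not> sublist w (tl y')" for y'
  proof (rule ccontr)
    assume "\<not> length y' < M"
    then have len: "M0 \<le> length y'" "Suc n0 \<le> length y'" by (auto simp: M_def)
    let ?y = "take (Suc n0) y'"
    let ?z = "?y @ v ?y @ w"
    have y: "?y \<in> ?Y" using len S_take y' by simp
    have zS: "?z \<in> S" and zlen: "length ?z \<le> length y'" using v[OF y] M0[OF y] len by auto
    \<comment> \<open>The common prefix starts with \<open>w\<close> and contains it nowhere else,
      so determinism propagates the agreement letter by letter.\<close>
    have "take k ?z = take k y'" if "Suc n0 \<le> k" "k \<le> length ?z" for k
      using that
    proof (induction k rule: dec_induct)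
      case base
      show ?case using len by simp
    next
      case (step k)
      let ?t = "take k y'"
      have t: "take k ?z = ?t" using step by simp
      have 1: "n0 < length ?t" using step zlen by simp
      have "prefix w ?t" using y'(2) n0 step by (auto simp: prefix_def)
      then have 2: "sublist w ?t" by (rule prefix_imp_sublist)
      have "prefix (tl ?t) (tl y')" by (metis prefix_def append_take_drop_id tl_append2 tl_Nil append_Nil prefix_order.refl take_tl take_is_prefix take_Nil list.sel(2) tl_take)
      then have 3: "\<not> sublist w (tl ?t)" using y'(3)
        by (meson prefix_imp_sublist sublist_order.order_trans)
      have z': "take (Suc k) ?z = ?t @ [?z ! k]" using step t by (subst take_Suc_conv_app_nth) auto
      have y'': "take (Suc k) y' = ?t @ [y' ! k]" using step zlen by (subst take_Suc_conv_app_nth) auto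
      have "?t @ [?z ! k] \<in> S" "?t @ [y' ! k] \<in> S"
        using S_take[OF zS, of "Suc k"] S_take[OF y'(1), of "Suc k"] z' y'' by simp_all
      then show ?case using det[OF 1 2 3] z' y'' by simp
    qed
    from this[of "length ?z"] have "take (length ?z) ?z = take (length ?z) y'" using len by simp
    then have "?z = take (length ?z) y'" by (simp only: take_all order_refl)
    then have "y' = ?z @ drop (length ?z) y'" by (metis append_take_drop_id)
    moreover have "?y \<noteq> []" using len by (cases y') auto
    ultimately have "tl y' = (tl ?y @ v ?y) @ w @ drop (length ?z) y'" by (metis append.assoc tl_append2)
    then show False using y'(3) by (metis sublist_appendI)
  qed
  have "sublist w x" if x: "x \<in> S" "M \<le> length x" for x
  proof (rule ccontr)
    assume no: "\<not> sublist w x"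
    obtain u where u: "w @ u @ x \<in> S" using recurrent assms(1) x(1) by (auto simp: recurrent_def)
    define z where "z = w @ u @ x"
    let ?I = "{i. i \<le> length z \<and> prefix w (drop i z)}"
    \<comment> \<open>The last occurrence of \<open>w\<close> in \<open>w @ u @ x\<close>. By
      \<open>short\<close> the suffix from there on is shorter than \<open>x\<close>, hence lies
      inside \<open>x\<close>.\<close>
    define m where "m = Max ?I"
    have finI: "finite ?I" by (rule finite_subset[of _ "{..length z}"]) auto
    have "0 \<in> ?I" by (simp add: z_def)
    then have "?I \<noteq> {}" by blast
    note i = Max_in[OF finI this, folded m_def] Max_ge[OF finI, folded m_def]
    have "\<not> sublist w (tl (drop m z))"
    proof
      assume "sublist w (tl (drop m z))"
      then obtain p q where pq: "drop (Suc m) z = p @ w @ q"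
        by (auto simp: sublist_def drop_Suc tl_drop)
      then have "drop (Suc m + length p) z = w @ q"
        by (metis add.commute append_eq_conv_conj drop_drop)
      moreover have "Suc m + length p \<le> length z"
        using arg_cong[OF pq, of length] assms(2) by (cases w) auto
      ultimately have "Suc m + length p \<in> ?I" by simp
      then show False using i(2) by fastforce
    qed
    then have "length (drop m z) < length x"
      using short[of "drop m z"] i(1) u x S_drop[of z m] by (simp add: z_def)
    then have "drop m z = drop (m - length w - length u) x" by (simp add: z_def)
    moreover have "sublist w (drop m z)" using i(1) by (simp add: prefix_imp_sublist)
    ultimately show False using no by (metis sublist_drop sublist_order.order_trans)
  qed
  then show thesis using that by blast
qed

end

section \<open>Markers and mixed return words\<close>

definition slice :: "'a list \<Rightarrow> nat \<Rightarrow> nat \<Rightarrow> 'a list" where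
  "slice y i j = take (j - i) (drop i y)"

text \<open>\<open>take\<close> truncates at the end of \<open>y\<close>, so for nonempty
  \<open>v\<close> the equation already forces the occurrence to fit.\<close>

definition occurs_at :: "'a list \<Rightarrow> 'a list \<Rightarrow> nat \<Rightarrow> bool" where
  "occurs_at y v i \<longleftrightarrow> take (length v) (drop i y) = v"

lemma length_slice: "j \<le> length y \<Longrightarrow> length (slice y i j) = j - i"
  by (simp add: slice_def)

lemma slice_append: "i \<le> j \<Longrightarrow> j \<le> k \<Longrightarrow> slice y i j @ slice y j k = slice y i k"
  unfolding slice_def using take_add[of "j - i" "k - j" "drop i y"] by (simp add: add.commute)

lemma slice_same [simp]: "slice y i i = []"
  by (simp add: slice_def)

lemma slice_slice: "a + j \<le> b \<Longrightarrow> slice (slice y a b) i j = slice y (a + i) (a + j)"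
  by (simp add: slice_def drop_take min_def add.commute)

lemma slice_Suc: "i < length y \<Longrightarrow> slice y i (Suc i) = [y ! i]"
  by (simp add: slice_def take_Suc hd_drop_conv_nth)

lemma slice_Cons: "i < j \<Longrightarrow> i < length y \<Longrightarrow> slice y i j = y ! i # slice y (Suc i) j"
  using slice_append[of i "Suc i" j y] by (simp add: slice_Suc)

lemma slice_decomp: "i \<le> j \<Longrightarrow> y = take i y @ slice y i j @ drop j y"
  using append_take_drop_id[of "j - i" "drop i y"] by (simp add: slice_def)

lemma slice_middle: "slice (p @ x @ q) (length p) (length p + length x) = x"
  by (simp add: slice_def)

lemma occurs_at_slice:
  "a + k + length v \<le> b \<Longrightarrow> occurs_at (slice y a b) v k \<longleftrightarrow> occurs_at y v (a + k)"
  by (simp add: occurs_at_def slice_def drop_take min_def add.commute)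

lemma occurs_at_length: "occurs_at y v i \<Longrightarrow> v \<noteq> [] \<Longrightarrow> i + length v \<le> length y"
  unfolding occurs_at_def by (drule arg_cong[of _ _ length]) (cases v, auto)

lemma occurs_at_0: "occurs_at y v 0 \<longleftrightarrow> prefix v y"
  by (auto simp: occurs_at_def prefix_def) (metis append_take_drop_id)

lemma occurs_at_end: "length v \<le> length y \<Longrightarrow> occurs_at y v (length y - length v) \<longleftrightarrow> suffix v y"
  by (auto simp: occurs_at_def suffix_def) (metis append_take_drop_id)

lemma occurs_at_decomp: "occurs_at y v i \<Longrightarrow> y = take i y @ v @ drop (i + length v) y"
  unfolding occurs_at_def by (metis append_take_drop_id drop_drop add.commute)

lemma occurs_at_append: "occurs_at (p @ v @ q) v (length p)"
  by (simp add: occurs_at_def)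

lemma sublist_occurs_at: "sublist v y \<longleftrightarrow> (\<exists>i. occurs_at y v i)"
  by (metis occurs_at_append occurs_at_decomp sublist_def)

lemma occurs_at_slice_eq: "occurs_at y v i \<longleftrightarrow> slice y i (i + length v) = v"
  by (simp add: occurs_at_def slice_def)

context recurrent_specular
begin

lemma S_slice: "y \<in> S \<Longrightarrow> slice y i j \<in> S"
  by (simp add: slice_def S_take S_drop)

lemma slice_wi:
  assumes "i \<le> j" "j \<le> length y"
  shows "slice (wi y) (length y - j) (length y - i) = wi (slice y i j)"
proof -
  have "wi y = wi (drop j y) @ wi (slice y i j) @ wi (take i y)"
    using arg_cong[OF slice_decomp[OF assms(1), of y], of wi] by (simp only: wi_append append.assoc)
  moreover have "length y - j = length (wi (drop j y))"
    "length y - i = length (wi (drop j y)) + length (wi (slice y i j))"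
    using assms by (simp_all add: length_slice)
  ultimately show ?thesis by (simp only: slice_middle)
qed

lemma occurs_at_wi:
  assumes "y \<in> S" "i + length v \<le> length y" "v \<in> S"
  shows "occurs_at (wi y) (wi v) (length y - (i + length v)) \<longleftrightarrow> occurs_at y v i"
proof -
  have "slice (wi y) (length y - (i + length v)) (length y - i) = wi (slice y i (i + length v))"
    by (rule slice_wi) (use assms in auto)
  moreover have "length y - (i + length v) + length (wi v) = length y - i" using assms by simp
  moreover have "wi (slice y i (i + length v)) = wi v \<longleftrightarrow> slice y i (i + length v) = v"
    using wi_wi[OF S_lists[OF S_slice[OF assms(1), of i "i + length v"]]] wi_wi[OF S_lists[OF assms(3)]]
    by metis
  ultimately show ?thesis by (simp add: occurs_at_slice_eq)
qed

end

locale recurrent_specular_word = recurrent_specular +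
  fixes w :: "'a list"
  assumes w_in: "w \<in> S" and w_Nil: "w \<noteq> []" and no_overlap: "\<not> overlap w (word_inv \<theta> w)"
begin

abbreviation w' :: "'a list" where "w' \<equiv> wi w"

lemma w'_in: "w' \<in> S" and w'_Nil: "w' \<noteq> []"
  using S_wi[OF w_in] w_Nil by auto

lemma w_neq_w': "w \<noteq> w'"
proof
  assume "w = w'"
  then have "overlap w w'" using w_Nil unfolding overlap_def by (intro exI[of _ w]) auto
  then show False using no_overlap by simp
qed

lemma no_overlap_w': "\<not> overlap w' w"
  using no_overlap by (auto simp: overlap_def)

lemma overlap_of_occurrences:
  assumes "occurs_at y u i" "occurs_at y v j" "i \<le> j" "j < i + length u" "length u = length v"
  shows "overlap u v"
proof -
  let ?s = "slice y j (i + length u)"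
  have "length u \<noteq> 0" using assms by auto
  then have len: "i + length u \<le> length y" using occurs_at_length[OF assms(1)] by fastforce
  have "u = slice y i j @ ?s"
    using assms slice_append[of i j "i + length u" y] by (simp add: occurs_at_slice_eq)
  moreover have "v = ?s @ slice y (i + length u) (j + length v)"
    using assms slice_append[of j "i + length u" "j + length v" y] by (simp add: occurs_at_slice_eq)
  moreover have "?s \<noteq> []" using assms(3-5) length_slice[OF len, of j] by auto
  ultimately show ?thesis unfolding overlap_def suffix_def prefix_def by metis
qed

text \<open>Overlaps are excluded by hypothesis and adjacency by reducedness: at the junction of
  \<open>w @ w'\<close> or \<open>w' @ w\<close> there would be a factor
  \<open>[a, \<theta> a]\<close>. The strict inequalities keep the two kinds of markers from
  coinciding.\<close>

lemma occurrences_apart: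
  assumes "y \<in> S" "occurs_at y w i" "occurs_at y w' j"
  shows "i + length w < j \<or> j + length w < i"
proof (rule ccontr)
  assume *: "\<not> ?thesis"
  have "\<not> (i \<le> j \<and> j < i + length w)"
    using overlap_of_occurrences[OF assms(2,3)] no_overlap length_wi[of w] by metis
  moreover have "\<not> (j \<le> i \<and> i < j + length w)"
    using overlap_of_occurrences[OF assms(3,2)] no_overlap_w' length_wi[of w] by metis
  ultimately consider "j = i + length w" | "i = j + length w" using * by linarith
  then show False
  proof cases
    case 1
    obtain v a where v: "w = v @ [a]" using w_Nil by (metis rev_exhaust)
    have "slice y i (i + length w) @ slice y j (j + length w) = slice y i (j + length w)"
      using 1 by (simp add: slice_append)
    then have "w @ w' \<in> S" using assms S_slice[OF assms(1)] by (metis length_wi occurs_at_slice_eq)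
    then have "v @ [a, \<theta> a] @ wi v \<in> S" by (simp add: v wi_append)
    then show False using S_reduced by blast
  next
    case 2
    obtain v a where v: "w = a # v" using w_Nil by (cases w) auto
    then have a: "a \<in> A" using S_lists[OF w_in] by simp
    have "slice y j (j + length w) @ slice y i (i + length w) = slice y j (i + length w)"
      using 2 by (simp add: slice_append)
    then have "w' @ w \<in> S" using assms S_slice[OF assms(1)] by (metis length_wi occurs_at_slice_eq)
    then have "wi v @ [\<theta> a, \<theta> (\<theta> a)] @ v \<in> S"
      using v wi_append[of "[a]" v] a by (simp add: \<theta>_\<theta>)
    then show False using S_reduced by blast
  qed
qed

text \<open>Without the guard \<open>length w \<le> i\<close>, truncated subtraction would test an
  occurrence at 0.\<close>

definition plus_marker :: "'a list \<Rightarrow> nat \<Rightarrow> bool" where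
  "plus_marker y i \<longleftrightarrow> length w \<le> i \<and> occurs_at y w (i - length w)"

definition marker :: "'a list \<Rightarrow> nat \<Rightarrow> bool" where
  "marker y i \<longleftrightarrow> plus_marker y i \<or> occurs_at y w' i"

definition consecutive :: "'a list \<Rightarrow> nat \<Rightarrow> nat \<Rightarrow> bool" where
  "consecutive y i j \<longleftrightarrow> y \<in> S \<and> i < j \<and> marker y i \<and> marker y j \<and> (\<forall>k. i < k \<longrightarrow> k < j \<longrightarrow> \<not> marker y k)"

lemma marker_le: "marker y i \<Longrightarrow> i \<le> length y"
  using occurs_at_length[of y w "i - length w"] occurs_at_length[of y w' i] w_Nil
  by (auto simp: marker_def plus_marker_def)

lemma not_both: "y \<in> S \<Longrightarrow> plus_marker y i \<Longrightarrow> \<not> occurs_at y w' i"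
  using occurrences_apart[of y "i - length w" i] by (auto simp: plus_marker_def)

lemma plus_marker_wi:
  assumes "y \<in> S" "i \<le> length y"
  shows "occurs_at (wi y) w' (length y - i) \<longleftrightarrow> plus_marker y i"
proof (cases "length w \<le> i")
  case True
  then show ?thesis using occurs_at_wi[of y "i - length w" w] assms w_in by (simp add: plus_marker_def)
next
  case False
  then show ?thesis using occurs_at_length[of "wi y" w' "length y - i"] assms w_Nil
    by (auto simp: plus_marker_def)
qed

lemma minus_marker_wi:
  assumes "y \<in> S" "i \<le> length y"
  shows "plus_marker (wi y) (length y - i) \<longleftrightarrow> occurs_at y w' i"
  using plus_marker_wi[OF S_wi[OF assms(1)], of "length y - i"] assms
  by (simp add: wi_wi[OF S_lists[OF assms(1)]])

lemma marker_wi: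
  assumes "y \<in> S" "i \<le> length y"
  shows "marker (wi y) (length y - i) \<longleftrightarrow> marker y i"
  using plus_marker_wi[OF assms] minus_marker_wi[OF assms] by (auto simp: marker_def)

lemma consecutive_wi:
  assumes "consecutive y i j"
  shows "consecutive (wi y) (length y - j) (length y - i)"
proof -
  have y: "y \<in> S" and le: "i < j" "j \<le> length y"
    using assms marker_le by (auto simp: consecutive_def)
  have "\<not> marker (wi y) k" if "length y - j < k" "k < length y - i" for k
    using marker_wi[OF y, of "length y - k"] that assms by (auto simp: consecutive_def)
  then show ?thesis using marker_wi[OF y, of i] marker_wi[OF y, of j] assms le S_wi[OF y]
    by (auto simp: consecutive_def)
qed

definition returns :: "'a list set" where
  "returns = {slice y i j | y i j. consecutive y i j}"

lemma returnsI: "consecutive y i j \<Longrightarrow> slice y i j \<in> returns"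
  by (auto simp: returns_def)

lemma returns_in: "x \<in> returns \<Longrightarrow> x \<in> S"
  by (auto simp: returns_def consecutive_def S_slice)

lemma returns_wi:
  assumes "x \<in> returns" shows "wi x \<in> returns"
proof -
  obtain y i j where x: "x = slice y i j" "consecutive y i j" using assms by (auto simp: returns_def)
  have "wi x = slice (wi y) (length y - j) (length y - i)"
    unfolding x(1) by (rule slice_wi[symmetric]) (use x marker_le in \<open>auto simp: consecutive_def\<close>)
  then show ?thesis unfolding returns_def using consecutive_wi[OF x(2)] by blast
qed

lemma mixed_erase_eq:
  assumes "prefix x1 u" "suffix x2 u" "x1 \<in> {w, w'}" "x2 \<in> {w, w'}"
  shows "mixed_erase \<theta> w u
    = slice u (if x1 = w then length w else 0) (if x2 = w then length u else length u - length w)"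
proof -
  have "prefix w u \<longleftrightarrow> x1 = w"
    using assms w_neq_w' by (auto simp: prefix_def)
  moreover have "suffix w' u \<longleftrightarrow> x2 \<noteq> w"
    using assms w_neq_w' by (auto simp: suffix_def)
  ultimately show ?thesis by (simp add: mixed_erase_def slice_def Let_def)
qed

lemma complete_return_consecutive:
  assumes u: "u \<in> complete_return_words S {w, w'}"
  shows "mixed_erase \<theta> w u \<in> returns"
proof -
  obtain x1 x2 where x: "strict_prefix x1 u" "strict_suffix x2 u" "x1 \<in> {w, w'}" "x2 \<in> {w, w'}"
    and uS: "u \<in> S" and no: "\<And>v. v \<in> {w, w'} \<Longrightarrow> \<not> internal_factor v u"
    using u by (auto simp: complete_return_words_def)
  let ?n = "length w"
  \<comment> \<open>The ends of what erasing leaves: an initial \<open>w\<close> and a final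
    \<open>w'\<close> are cut off, an initial \<open>w'\<close> and a final \<open>w\<close> are
    kept.\<close>
  let ?i = "if x1 = w then ?n else 0" and ?j = "if x2 = w then length u else length u - ?n"
  have len: "?n < length u"
    using x(1,3) prefix_length_less by fastforce
  have p: "occurs_at u x1 0" using x(1) by (simp add: occurs_at_0 strict_prefix_def)
  have lx: "length x1 = ?n" "length x2 = ?n" using x(3,4) by auto
  have s: "occurs_at u x2 (length u - ?n)"
    using occurs_at_end[of x2 u] x(2) lx len by (simp add: strict_suffix_def)
  have interior: "k = 0 \<or> k + ?n = length u" if "v \<in> {w, w'}" "occurs_at u v k" for v k
  proof (rule ccontr)
    assume k: "\<not> ?thesis"
    have "length v = ?n" using that by auto
    then have "v \<noteq> []" using w_Nil by auto
    then have "k + ?n < length u" using occurs_at_length[OF that(2)] k \<open>length v = ?n\<close> by auto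
    then have "internal_factor v u"
      using occurs_at_decomp[OF that(2)] k \<open>length v = ?n\<close> unfolding internal_factor_def
      by (intro exI[of _ "take k u"] exI[of _ "drop (k + ?n) u"]) auto
    then show False using no that by blast
  qed
  \<comment> \<open>With \<open>w\<close> in front and \<open>w'\<close> at the end, this needs that
    the two occurrences are not even adjacent.\<close>
  have "?i < ?j"
    using x(3,4) p s len occurrences_apart[OF uS, of 0 "length u - ?n"] w_neq_w' w_Nil by auto
  moreover have "marker u ?i"
    using x(3) p by (auto simp: marker_def plus_marker_def)
  moreover have "marker u ?j"
    using x(4) s len by (auto simp: marker_def plus_marker_def)
  moreover have "\<not> marker u k" if k: "?i < k" "k < ?j" for k
  proof
    assume "marker u k"
    then consider "?n \<le> k" "occurs_at u w (k - ?n)" | "occurs_at u w' k"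
      by (auto simp: marker_def plus_marker_def)
    then show False
    proof cases
      case 1
      then have "k = ?n" using interior[of w "k - ?n"] k by (auto split: if_splits)
      then have "x1 = w'" "occurs_at u w 0" using x(3) k 1 by (auto split: if_splits)
      then show False using p w_neq_w' by (simp add: occurs_at_def)
    next
      case 2
      then have "k = length u - ?n" using interior[of w' k] k by auto
      then have "x2 = w" using x(4) k by (auto split: if_splits)
      then show False using s 2 w_neq_w' \<open>k = _\<close> by (simp add: occurs_at_def)
    qed
  qed
  ultimately have "consecutive u ?i ?j" using uS by (simp add: consecutive_def)
  moreover have "mixed_erase \<theta> w u = slice u ?i ?j"
    using x by (intro mixed_erase_eq) (auto simp: strict_prefix_def strict_suffix_def)
  ultimately show ?thesis by (simp only: returnsI)
qed

lemma consecutive_complete_return: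
  assumes "consecutive y i j"
  shows "slice y i j \<in> mixed_erase \<theta> w ` complete_return_words S {w, w'}"
proof -
  let ?n = "length w"
  have y: "y \<in> S" "i < j" and no: "\<And>k. i < k \<Longrightarrow> k < j \<Longrightarrow> \<not> marker y k"
    using assms by (auto simp: consecutive_def)
  \<comment> \<open>\<open>x1\<close> is the occurrence that makes \<open>i\<close> a marker and
    \<open>i'\<close> its starting position: it ends at \<open>i\<close> if it is \<open>w\<close>
    and starts there if it is \<open>w'\<close>.\<close>
  obtain x1 i' where x1: "x1 \<in> {w, w'}" "occurs_at y x1 i'" "i = i' + (if x1 = w then ?n else 0)"
  proof (cases "plus_marker y i")
    case True
    then show ?thesis using that[of w "i - ?n"] by (auto simp: plus_marker_def)
  next
    case False
    then have "occurs_at y w' i" using assms by (auto simp: consecutive_def marker_def)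
    then show ?thesis using that[of w' i] w_neq_w' by auto
  qed
  obtain x2 j'' where x2: "x2 \<in> {w, w'}" "occurs_at y x2 j''" "j = j'' + (if x2 = w then ?n else 0)"
  proof (cases "plus_marker y j")
    case True
    then show ?thesis using that[of w "j - ?n"] by (auto simp: plus_marker_def)
  next
    case False
    then have "occurs_at y w' j" using assms by (auto simp: consecutive_def marker_def)
    then show ?thesis using that[of w' j] w_neq_w' by auto
  qed
  have lx: "length x1 = ?n" "length x2 = ?n" using x1(1) x2(1) by auto
  have npos: "?n > 0" using w_Nil by simp
  have ij: "i' < j''"
    using x1 x2 y(2) occurrences_apart[OF y(1), of i' j''] occurrences_apart[OF y(1), of j'' i'] w_neq_w'
    by (auto split: if_splits)
  let ?u = "slice y i' (j'' + ?n)"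
  have leny: "j'' + ?n \<le> length y" using occurs_at_length[OF x2(2)] lx npos by (cases x2) auto
  have lenu: "length ?u = j'' + ?n - i'" by (rule length_slice[OF leny])
  have p: "prefix x1 ?u"
    using occurs_at_slice[of i' 0 x1 "j'' + ?n" y] x1(2) lx ij by (simp add: occurs_at_0)
  have s: "suffix x2 ?u"
    using occurs_at_slice[of i' "j'' - i'" x2 "j'' + ?n" y] x2(2) lx ij occurs_at_end[of x2 ?u] lenu
    by simp
  have "\<not> internal_factor v ?u" if v: "v \<in> {w, w'}" for v
  proof
    assume "internal_factor v ?u"
    then obtain a b where ab: "a \<noteq> []" "b \<noteq> []" "?u = a @ v @ b" by (auto simp: internal_factor_def)
    have lv: "length v = ?n" using v by auto
    let ?k = "i' + length a"
    have l: "length a + ?n + length b = j'' + ?n - i'" using arg_cong[OF ab(3), of length] lenu lv by simp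
    have k: "i' < ?k" "?k < j''"
      using l ij ab(1,2) by (auto simp flip: length_greater_0_conv)
    have occ: "occurs_at y v ?k"
      using occurs_at_slice[of i' "length a" v "j'' + ?n" y] occurs_at_append[of a v b] ab(3) k lv by simp
    show False
    proof (cases "v = w")
      case True
      then have "marker y (?k + ?n)" using occ by (simp add: marker_def plus_marker_def)
      moreover have "?k + ?n < j"
        using x2 k occurrences_apart[OF y(1), of ?k j''] occ True by (auto split: if_splits)
      moreover have "i < ?k + ?n" using x1 k by (auto split: if_splits)
      ultimately show False using no by blast
    next
      case False
      then have occ': "occurs_at y w' ?k" using occ v by auto
      then have "marker y ?k" by (simp add: marker_def)
      moreover have "?k < j" using x2(3) k by (auto split: if_splits)
      moreover have "i < ?k"
        using x1 k occurrences_apart[OF y(1), of i' ?k] occ' by (auto split: if_splits)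
      ultimately show False using no by blast
    qed
  qed
  moreover have "strict_prefix x1 ?u" "strict_suffix x2 ?u"
    using p s lx lenu ij by (auto simp: strict_prefix_def strict_suffix_def)
  ultimately have "?u \<in> complete_return_words S {w, w'}"
    using x1(1) x2(1) S_slice[OF y(1)] unfolding complete_return_words_def by blast
  moreover have "mixed_erase \<theta> w ?u = slice y i j"
  proof -
    have "mixed_erase \<theta> w ?u = slice ?u (if x1 = w then ?n else 0) (if x2 = w then length ?u else length ?u - ?n)"
      by (rule mixed_erase_eq[OF p s x1(1) x2(1)])
    also have "(if x2 = w then length ?u else length ?u - ?n) = j - i'"
      using lenu x2(3) ij by auto
    also have "slice ?u (if x1 = w then ?n else 0) (j - i') = slice y i j"
      using x1(3) x2(3) ij by (subst slice_slice) (auto split: if_splits)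
    finally show ?thesis .
  qed
  ultimately show ?thesis by (metis imageI)
qed

lemma mixed_return_words_eq: "mixed_return_words \<theta> S w = returns"
  using complete_return_consecutive consecutive_complete_return
  by (auto simp: mixed_return_words_def returns_def)

end

section \<open>Rigidity and generation\<close>

context recurrent_specular_word
begin

text \<open>Recognising a marker takes \<open>length w\<close> letters on each side.\<close>

lemma marker_slice_iff:
  assumes "a + k + length w \<le> b" "length w \<le> k"
  shows "marker (slice y a b) k \<longleftrightarrow> marker y (a + k)"
proof -
  have "occurs_at (slice y a b) w (k - length w) \<longleftrightarrow> occurs_at y w (a + (k - length w))"
    by (rule occurs_at_slice) (use assms in simp)
  moreover have "occurs_at (slice y a b) w' k \<longleftrightarrow> occurs_at y w' (a + k)"
    by (rule occurs_at_slice) (use assms in simp)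
  moreover have "a + (k - length w) = a + k - length w" using assms by simp
  ultimately show ?thesis using assms by (simp add: marker_def plus_marker_def)
qed

lemma plus_marker_slice:
  assumes "plus_marker (slice y a b) k" "b \<le> length y"
  shows "plus_marker y (a + k)"
proof -
  have k: "length w \<le> k" "occurs_at (slice y a b) w (k - length w)"
    using assms by (auto simp: plus_marker_def)
  then have "k \<le> b - a"
    using occurs_at_length[OF k(2) w_Nil] length_slice[OF assms(2), of a] by simp
  moreover have "k > 0" using k w_Nil by (cases w) auto
  ultimately have "a + (k - length w) + length w \<le> b" using k by simp
  then have "occurs_at y w (a + (k - length w))" using k(2) occurs_at_slice by metis
  moreover have "a + (k - length w) = a + k - length w" using k by simp
  ultimately show ?thesis using k by (simp add: plus_marker_def)
qed

lemma plus_marker_le: "plus_marker y i \<Longrightarrow> i \<le> length y"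
  using marker_le by (auto simp: marker_def)

lemma plus_marker_exists:
  obtains K where "\<And>x. x \<in> S \<Longrightarrow> K \<le> length x \<Longrightarrow> \<exists>m. plus_marker x m"
proof -
  obtain K where K: "\<And>x. x \<in> S \<Longrightarrow> K \<le> length x \<Longrightarrow> sublist w x"
    using uniformly_recurrent[OF w_in w_Nil] by blast
  have "\<exists>m. plus_marker x m" if x: "x \<in> S" "K \<le> length x" for x
  proof -
    obtain i where "occurs_at x w i" using K[OF x] by (auto simp: sublist_occurs_at)
    then have "plus_marker x (i + length w)" by (simp add: plus_marker_def)
    then show ?thesis ..
  qed
  then show thesis by (rule that)
qed

lemma marker_action_eq:
  fixes act :: "'a \<Rightarrow> 'q \<Rightarrow> 'q"
  assumes step: "\<And>i j. consecutive y i j \<Longrightarrow>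
      fold act (slice y i j) (if plus_marker y i then cp else cm) = (if plus_marker y j then cp else cm)"
    and "y \<in> S" "marker y i" "marker y j" "i \<le> j"
  shows "fold act (slice y i j) (if plus_marker y i then cp else cm) = (if plus_marker y j then cp else cm)"
  using assms(3-)
proof (induction "j - i" arbitrary: i j rule: less_induct)
  case less
  consider "i = j" | "consecutive y i j" | k where "i < k" "k < j" "marker y k"
    using less.prems \<open>y \<in> S\<close> by (force simp: consecutive_def)
  then show ?case
  proof cases
    case 3
    then have "slice y i j = slice y i k @ slice y k j" by (simp add: slice_append)
    then show ?thesis using less.hyps[of k i] less.hyps[of j k] 3 less.prems by simp
  qed (use step in auto)
qed

text \<open>Because the extension graphs are connected, an action of the letters which is consistent
  along the mixed return words already comes from states attached to the vertices
  of the extension graph of the empty word.\<close>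

lemma rigidity:
  fixes act :: "'a \<Rightarrow> 'q \<Rightarrow> 'q"
  assumes act_in: "\<And>a q. a \<in> A \<Longrightarrow> q \<in> Q \<Longrightarrow> act a q \<in> Q"
    and act_inj: "\<And>a. a \<in> A \<Longrightarrow> inj_on (act a) Q"
    and "cp \<in> Q" "cm \<in> Q"
    and step: "\<And>y i j. consecutive y i j \<Longrightarrow>
      fold act (slice y i j) (if plus_marker y i then cp else cm) = (if plus_marker y j then cp else cm)"
  shows "\<exists>h. (\<forall>a\<in>A. h (Inl a) = act a (h (Inr a))) \<and> (\<forall>a b. [a, b] \<in> S \<longrightarrow> h (Inl a) = h (Inr b)) \<and>
    h (Inl (last w)) = cp \<and> h (Inr (hd w')) = cm"
proof -
  obtain K where K: "\<And>x. x \<in> S \<Longrightarrow> K \<le> length x \<Longrightarrow> \<exists>m. plus_marker x m"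
    using plus_marker_exists by blast
  have fold_in: "fold act r q \<in> Q" if "r \<in> lists A" "q \<in> Q" for r q
    using that by (induction r arbitrary: q) (auto intro: act_in)
  have fold_inj: "q = q'" if "r \<in> lists A" "q \<in> Q" "q' \<in> Q" "fold act r q = fold act r q'" for r q q'
    using that
  proof (induction r arbitrary: q q')
    case (Cons a r)
    then have "a \<in> A" "act a q = act a q'" by (auto intro: act_in)
    then show ?case using inj_onD[OF act_inj, of a q q'] Cons.prems by simp
  qed simp
  define pos where "pos s = (SOME m. plus_marker s m)" for s
  \<comment> \<open>The state after a past \<open>s\<close> of length \<open>K\<close>: start with
    \<open>cp\<close> at an arbitrarily chosen plus marker inside \<open>s\<close> and read
    on.\<close>
  define h0 where "h0 s = fold act (drop (pos s) s) cp" for s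
  have pos: "plus_marker s (pos s)" if "s \<in> S" "length s = K" for s
    unfolding pos_def using someI_ex[OF K[OF that(1)]] that(2) by simp
  have h0_in: "h0 s \<in> Q" if "s \<in> S" for s
    unfolding h0_def using that \<open>cp \<in> Q\<close> by (intro fold_in S_lists S_drop)
  have h0_fold: "fold act (slice y i m) (h0 (slice y (i - K) i)) = (if plus_marker y m then cp else cm)"
    if y: "y \<in> S" "K \<le> i" "i \<le> m" "marker y m" for y i m
  proof -
    let ?s = "slice y (i - K) i"
    have le: "i \<le> length y" using y marker_le by fastforce
    then have s: "length ?s = K" "?s \<in> S" using y by (auto simp: length_slice S_slice)
    then have p: "plus_marker ?s (pos ?s)" by (intro pos)
    then have "pos ?s \<le> K" using plus_marker_le s by fastforce
    let ?m = "i - K + pos ?s"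
    have m: "plus_marker y ?m" using plus_marker_slice[OF p le] .
    have "drop (pos ?s) ?s = slice y ?m i"
      using \<open>pos ?s \<le> K\<close> y(2) by (simp add: slice_def drop_take add.commute)
    then have "fold act (slice y i m) (h0 ?s) = fold act (slice y ?m i @ slice y i m) cp"
      by (simp add: h0_def)
    also have "slice y ?m i @ slice y i m = slice y ?m m"
      using \<open>pos ?s \<le> K\<close> y by (intro slice_append) auto
    finally show ?thesis
      using marker_action_eq[of y act cp cm ?m m, OF step y(1)] m y \<open>pos ?s \<le> K\<close> by (simp add: marker_def)
  qed
  \<comment> \<open>Read on to a plus marker in a right extension, both states become
    \<open>cp\<close>; injectivity of the action makes them equal.\<close>
  have h0_step: "act (y ! i) (h0 (slice y (i - K) i)) = h0 (slice y (Suc i - K) (Suc i))"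
    if y: "y \<in> S" "K \<le> i" "i < length y" for y i
  proof -
    obtain t where t: "length t = K" "y @ t \<in> S" using ext_right_n[OF y(1)] by blast
    let ?z = "y @ t"
    obtain m where "plus_marker t m" using K[of t] S_suffix t by blast
    moreover have "t = slice ?z (length y) (length ?z)" by (simp add: slice_def)
    ultimately have m: "plus_marker ?z (length y + m)" using plus_marker_slice by (metis order_refl)
    let ?m = "length y + m"
    have "fold act (slice ?z i ?m) (h0 (slice ?z (i - K) i)) = cp"
      by (subst h0_fold) (use m t y in \<open>auto simp: marker_def\<close>)
    moreover have "fold act (slice ?z (Suc i) ?m) (h0 (slice ?z (Suc i - K) (Suc i))) = cp"
      by (subst h0_fold) (use m t y in \<open>auto simp: marker_def\<close>)
    moreover have "slice ?z i ?m = ?z ! i # slice ?z (Suc i) ?m"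
      using y by (intro slice_Cons) auto
    moreover have "?z ! i = y ! i" "slice ?z (i - K) i = slice y (i - K) i"
      "slice ?z (Suc i - K) (Suc i) = slice y (Suc i - K) (Suc i)"
      using y by (auto simp: nth_append slice_def)
    ultimately have "fold act (slice ?z (Suc i) ?m) (act (y ! i) (h0 (slice y (i - K) i)))
        = fold act (slice ?z (Suc i) ?m) (h0 (slice y (Suc i - K) (Suc i)))" by simp
    moreover have "y ! i \<in> A" using S_lists[OF y(1)] y(3) by auto
    ultimately show ?thesis
      using fold_inj[OF S_lists[OF S_slice[OF t(2)]]] act_in h0_in S_slice[OF y(1)] by blast
  qed
  \<comment> \<open>The same comparison at a marker in the common future: the state is determined by
    the future as well as by the past.\<close>
  have h0_eq: "h0 s = h0 s'"
    if *: "length s = K" "length s' = K" "length t = K" "s @ [z] @ t \<in> S" "s' @ [z] @ t \<in> S"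
    for s s' t z
  proof -
    obtain m where m: "plus_marker t m" using K[of t] S_suffix[of "s @ [z]" t] * by auto
    have "h0 x = h0 s" if x: "length x = K" "x @ [z] @ t \<in> S" for x
    proof -
      have mark: "plus_marker (x @ [z] @ t) (K + 1 + m)" if "length x = K" for x
      proof -
        have "t = slice (x @ [z] @ t) (K + 1) (length (x @ [z] @ t))" using that by (simp add: slice_def)
        then show ?thesis using plus_marker_slice m by (metis order_refl)
      qed
      have "fold act (z # take m t) (h0 x) = cp" if "length x = K" "x @ [z] @ t \<in> S" for x
      proof -
        have "slice (x @ [z] @ t) K (K + 1 + m) = z # take m t" "slice (x @ [z] @ t) (K - K) K = x"
          using that(1) by (simp_all add: slice_def)
        then show ?thesis
          using h0_fold[OF that(2), of K "K + 1 + m"] mark[OF that(1)] unfolding marker_def by simp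
      qed
      then have "fold act (z # take m t) (h0 x) = fold act (z # take m t) (h0 s)" using * x by simp
      moreover have "z # take m t \<in> lists A"
        using S_lists[OF S_take[OF S_suffix[OF *(4)], of "Suc m"]] by simp
      ultimately show ?thesis using fold_inj h0_in S_prefix x *(4) by blast
    qed
    then show ?thesis using * by metis
  qed
  \<comment> \<open>Being a function of the past alone and of the future alone, the state depends
    only on the core between them. One letter is the shortest core for which connectedness is
    available.\<close>
  have "\<exists>q. \<forall>s t. length s = K \<longrightarrow> length t = K \<longrightarrow> s @ [z] @ t \<in> S \<longrightarrow> h0 s = q" for z
    by (rule two_sided_invariant[OF _ refl]) (simp, rule h0_eq)
  then have "\<exists>k. \<forall>z s t. length s = K \<longrightarrow> length t = K \<longrightarrow> s @ [z] @ t \<in> S \<longrightarrow> h0 s = k z"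
    by (intro choice allI)
  then obtain k where k: "\<And>z s t. length s = K \<Longrightarrow> length t = K \<Longrightarrow> s @ [z] @ t \<in> S \<Longrightarrow> h0 s = k z"
    by blast
  have k: "h0 s = k z" if s: "length s = K" "s @ [z] \<in> S" for s z
  proof -
    obtain t where "length t = K" "(s @ [z]) @ t \<in> S" using ext_right_n[OF s(2)] by blast
    then show ?thesis using k[OF s(1)] by simp
  qed
  \<comment> \<open>Right vertices carry the state before the letter, left vertices the state after
    it.\<close>
  define h where "h v = (case v of Inl a \<Rightarrow> act a (k a) | Inr b \<Rightarrow> k b)" for v :: "'a + 'a"
  have edge: "act a (k a) = k b" if ab: "[a, b] \<in> S" for a b
  proof -
    obtain s where s: "length s = K" "s @ [a, b] \<in> S" using ext_left_n[OF ab] by blast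
    have ka: "h0 s = k a" using k[OF s(1)] S_prefix[of "s @ [a]" "[b]"] s(2) by simp
    let ?s = "drop 1 (s @ [a])"
    have "?s @ [b] = drop 1 (s @ [a, b])" by (cases s) auto
    then have "?s @ [b] \<in> S" using S_drop[OF s(2), of 1] by simp
    then have kb: "h0 ?s = k b" using k s(1) by simp
    have "act ((s @ [a, b]) ! K) (h0 (slice (s @ [a, b]) (K - K) K))
        = h0 (slice (s @ [a, b]) (Suc K - K) (Suc K))"
      by (rule h0_step) (use s in auto)
    moreover have "slice (s @ [a, b]) (K - K) K = s" "(s @ [a, b]) ! K = a"
      using s(1) by (auto simp: slice_def nth_append)
    moreover have "slice (s @ [a, b]) (Suc K - K) (Suc K) = ?s"
      using s(1) by (cases s) (auto simp: slice_def)
    ultimately show ?thesis using ka kb by simp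
  qed
  have cp: "h (Inl (last w)) = cp"
  proof -
    obtain b where b: "w @ [b] \<in> S" using ext_right[OF w_in] by blast
    obtain s where s: "length s = K" "s @ w @ [b] \<in> S" using ext_left_n[OF b] by blast
    let ?y = "s @ w @ [b]" and ?i = "K + length w"
    have p: "plus_marker ?y ?i" using occurs_at_append[of s w "[b]"] s(1) by (simp add: plus_marker_def)
    have "h0 (slice ?y (?i - K) ?i) = cp"
      using h0_fold[OF s(2), of ?i ?i] p by (simp add: marker_def)
    moreover have "slice ?y (?i - K) ?i @ [b] = drop (length w) (s @ w @ [b])"
      using s(1) by (simp add: slice_def)
    then have "slice ?y (?i - K) ?i @ [b] \<in> S" using S_drop[OF s(2), of "length w"] by simp
    moreover have "length (slice ?y (?i - K) ?i) = K" using s(1) by (simp add: length_slice)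
    ultimately have "k b = cp" using k by metis
    moreover have "[last w, b] \<in> S"
      using S_suffix[of "butlast w" "[last w, b]"] b append_butlast_last_id[OF w_Nil]
      by (metis append.assoc append_Cons append_Nil)
    ultimately show ?thesis using edge by (simp add: h_def)
  qed
  have cm: "h (Inr (hd w')) = cm"
  proof -
    obtain s where s: "length s = K" "s @ w' \<in> S" using ext_left_n[OF w'_in] by blast
    have o: "occurs_at (s @ w') w' K" using s(1) by (simp add: occurs_at_def)
    then have "\<not> plus_marker (s @ w') K" using not_both[OF s(2)] by blast
    then have "h0 s = cm"
      using h0_fold[OF s(2), of K K] o s(1) by (simp add: marker_def slice_def)
    moreover have "s @ [hd w'] \<in> S"
      using S_prefix[of "s @ [hd w']" "tl w'"] s(2) w'_Nil by (simp add: hd_Cons_tl)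
    ultimately show ?thesis using k s(1) by (simp add: h_def)
  qed
  show ?thesis using edge cp cm by (intro exI[of _ h]) (simp add: h_def)
qed

lemma hd_w': "hd w' = \<theta> (last w)" and last_w_in: "last w \<in> A"
  using w_Nil S_lists[OF w_in] by (auto simp: word_inv_def hd_rev last_map)

end

context recurrent_specular
begin

lemma edge_invariant_sides:
  fixes h :: "'a + 'a \<Rightarrow> 'q"
  assumes "\<And>a b. [a, b] \<in> S \<Longrightarrow> h (Inl a) = h (Inr b)"
    and "(Inl a, Inl b) \<in> {(x, y). {x, y} \<in> ext_edges A S []}\<^sup>*"
  shows "h (Inl a) = h (Inl b)"
  using assms(2)
proof (rule edge_invariant)
  show "h x = h y" if "{x, y} \<in> ext_edges A S []" for x y
    using that by (rule ext_edgesE) (use assms(1) in auto)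
qed

section \<open>Words over the alphabet as group elements\<close>

abbreviation G where "G \<equiv> G_theta A \<theta>"
abbreviation elem :: "'a list \<Rightarrow> ('a \<times> bool) list set" where "elem \<equiv> word_elem A \<theta>"

lemma signed_in: "x \<in> lists A \<Longrightarrow> map (\<lambda>a. (a, True)) x \<in> signed_words A"
  by auto

lemma elem_carrier: "x \<in> lists A \<Longrightarrow> elem x \<in> carrier G"
  unfolding word_elem_def G_theta_def presented_carrier by (intro imageI signed_in)

lemma elem_append: "x \<in> lists A \<Longrightarrow> y \<in> lists A \<Longrightarrow> elem (x @ y) = elem x \<otimes>\<^bsub>G\<^esub> elem y"
  unfolding word_elem_def G_theta_def by (subst presented_mult) (auto intro: signed_in)

lemma elem_Nil: "elem [] = \<one>\<^bsub>G\<^esub>"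
  by (simp add: word_elem_def G_theta_def presented_group_def)

lemma elem_eq_iff:
  assumes "x \<in> lists A" "y \<in> lists A"
  shows "elem x = elem y \<longleftrightarrow> pres_eq A (theta_relators A \<theta>) (map (\<lambda>a. (a, True)) x) (map (\<lambda>a. (a, True)) y)"
  unfolding word_elem_def
  by (subst eq_equiv_class_iff[OF equiv_pres_rel signed_in[OF assms(1)] signed_in[OF assms(2)]])
     (simp add: pres_rel_def)

lemma elem_\<theta>: "a \<in> A \<Longrightarrow> elem [a, \<theta> a] = \<one>\<^bsub>G\<^esub>"
  using pres_relator[of "[(a, True), (\<theta> a, True)]" "theta_relators A \<theta>" A "[]" "[]"]
  by (subst elem_Nil[symmetric], subst elem_eq_iff) (auto simp: theta_relators_def \<theta>_in)

interpretation G: group G by (rule group_G_theta)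

lemma wi_lists: "x \<in> lists A \<Longrightarrow> wi x \<in> lists A"
  by (auto simp: word_inv_def \<theta>_in)

lemma elem_wi:
  assumes "x \<in> lists A"
  shows "elem (wi x) = inv\<^bsub>G\<^esub> elem x"
proof -
  have "elem x \<otimes>\<^bsub>G\<^esub> elem (wi x) = \<one>\<^bsub>G\<^esub>"
    using assms
  proof (induction x)
    case Nil
    then show ?case by (simp add: elem_Nil)
  next
    case (Cons a x)
    then have A: "a \<in> A" "x \<in> lists A" "wi x \<in> lists A" by (auto simp: wi_lists)
    have a: "elem [a] \<otimes>\<^bsub>G\<^esub> elem [\<theta> a] = \<one>\<^bsub>G\<^esub>"
      using elem_append[of "[a]" "[\<theta> a]"] A elem_\<theta> by (simp add: \<theta>_in)
    have "elem (a # x) = elem [a] \<otimes>\<^bsub>G\<^esub> elem x" "elem (wi (a # x)) = elem (wi x) \<otimes>\<^bsub>G\<^esub> elem [\<theta> a]"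
      using elem_append[of "[a]" x] elem_append[of "wi x" "[\<theta> a]"] wi_append[of "[a]" x] A
      by (simp_all add: \<theta>_in)
    moreover have c: "elem [a] \<in> carrier G" "elem [\<theta> a] \<in> carrier G" "elem x \<in> carrier G" "elem (wi x) \<in> carrier G"
      using A by (auto intro!: elem_carrier simp: \<theta>_in)
    ultimately have "elem (a # x) \<otimes>\<^bsub>G\<^esub> elem (wi (a # x))
        = elem [a] \<otimes>\<^bsub>G\<^esub> (elem x \<otimes>\<^bsub>G\<^esub> elem (wi x)) \<otimes>\<^bsub>G\<^esub> elem [\<theta> a]"
      by (simp add: G.m_assoc)
    then show ?case using Cons.IH A a c by simp
  qed
  then show ?thesis
    using G.inv_equality[of "elem (wi x)" "elem x"] G.inv_comm elem_carrier assms wi_lists by metis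
qed

text \<open>A formal inverse \<open>(a, False)\<close> equals the letter \<open>\<theta> a\<close>
  in the group, so positive words suffice.\<close>

lemma carrier_elem: "carrier G = elem ` lists A"
proof
  show "elem ` lists A \<subseteq> carrier G" using elem_carrier by blast
  show "carrier G \<subseteq> elem ` lists A"
  proof
    fix g assume "g \<in> carrier G"
    then obtain u where u: "u \<in> signed_words A" "g = pres_rel A (theta_relators A \<theta>) `` {u}"
      by (auto simp: G_theta_def presented_carrier)
    let ?c = "\<lambda>u. pres_rel A (theta_relators A \<theta>) `` {u}"
    have "?c u \<in> elem ` lists A" using u(1)
    proof (induction u)
      case Nil
      show ?case by (rule image_eqI[of _ _ "[]"]) (simp_all add: word_elem_def)
    next
      case (Cons b u)
      obtain a s where b: "b = (a, s)" by (cases b)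
      then have A: "a \<in> A" "u \<in> signed_words A" using Cons.hyps by auto
      obtain x where x: "x \<in> lists A" "?c u = elem x" using Cons.IH by blast
      have split: "?c (b # u) = ?c [b] \<otimes>\<^bsub>G\<^esub> ?c u"
        using presented_mult[of "[b]" A u "theta_relators A \<theta>"] A b by (simp add: G_theta_def)
      have "?c [b] \<in> elem ` lists A"
      proof (cases s)
        case True
        then show ?thesis using A b by (intro image_eqI[of _ _ "[a]"]) (auto simp: word_elem_def)
      next
        case False
        have c: "?c [b] \<in> carrier G" using A b by (auto simp: G_theta_def presented_carrier)
        have "pres_eq A (theta_relators A \<theta>) ([] @ [(a, False), (a, \<not> False)] @ []) ([] @ [])"
          using A by (intro pres_cancel) auto
        then have "?c [(a, False), (a, True)] = ?c []"
          by (intro equiv_class_eq[OF equiv_pres_rel]) (simp add: pres_rel_def)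
        then have "?c [b] \<otimes>\<^bsub>G\<^esub> elem [a] = \<one>\<^bsub>G\<^esub>"
          using presented_mult[of "[(a, False)]" A "[(a, True)]" "theta_relators A \<theta>"] A b False
          by (simp add: G_theta_def word_elem_def presented_group_def)
        then have "?c [b] = elem [\<theta> a]"
          using G.inv_equality[of "?c [b]" "elem [a]"] elem_wi[of "[a]"] c elem_carrier[of "[a]"] A by simp
        then show ?thesis using A by (auto simp: \<theta>_in)
      qed
      then obtain x' where "x' \<in> lists A" "?c [b] = elem x'" by blast
      then have "?c (b # u) = elem (x' @ x)" using split x elem_append by simp
      then show ?case using \<open>x' \<in> lists A\<close> x by (intro image_eqI[of _ _ "x' @ x"]) auto
    qed
    then show "g \<in> elem ` lists A" using u by simp
  qed
qed

end

section \<open>Generation by mixed return words\<close>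

context recurrent_specular_word
begin

interpretation G: group G by (rule group_G_theta)

text \<open>Monoid products suffice to form a subgroup, because the mixed return words are closed
  under inversion.\<close>

definition generated :: "('a \<times> bool) list set set" where
  "generated = {elem (concat rs) | rs. rs \<in> lists returns}"

lemma concat_returns: "rs \<in> lists returns \<Longrightarrow> concat rs \<in> lists A"
  using S_lists[OF returns_in] by (induction rs) auto

lemma generated_elem: "r \<in> returns \<Longrightarrow> elem r \<in> generated"
  unfolding generated_def by (intro CollectI exI[of _ "[r]"]) simp

lemma generated_mult:
  assumes "g \<in> generated" "h \<in> generated"
  shows "g \<otimes>\<^bsub>G\<^esub> h \<in> generated"
proof -
  obtain rs rs' where rs: "rs \<in> lists returns" "g = elem (concat rs)"
      "rs' \<in> lists returns" "h = elem (concat rs')"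
    using assms by (auto simp: generated_def)
  then have "g \<otimes>\<^bsub>G\<^esub> h = elem (concat (rs @ rs'))"
    by (simp add: elem_append concat_returns)
  moreover have "rs @ rs' \<in> lists returns" using rs by simp
  ultimately show ?thesis unfolding generated_def by blast
qed

lemma wi_concat: "rs \<in> lists returns \<Longrightarrow> wi (concat rs) = concat (rev (map wi rs))"
  by (induction rs) (auto simp: wi_append)

lemma subgroup_generated: "subgroup generated G"
proof (rule G.subgroupI)
  show "generated \<subseteq> carrier G" using elem_carrier concat_returns by (auto simp: generated_def)
  have "elem (concat []) \<in> generated" unfolding generated_def by blast
  then show "generated \<noteq> {}" by blast
  fix g assume "g \<in> generated"
  then obtain rs where rs: "rs \<in> lists returns" "g = elem (concat rs)" by (auto simp: generated_def)
  then have "inv\<^bsub>G\<^esub> g = elem (concat (rev (map wi rs)))"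
    using elem_wi[OF concat_returns[OF rs(1)]] wi_concat[OF rs(1)] by simp
  moreover have "rev (map wi rs) \<in> lists returns" using rs(1) returns_wi by auto
  ultimately show "inv\<^bsub>G\<^esub> g \<in> generated" unfolding generated_def by blast
qed (rule generated_mult)

text \<open>Rigidity is applied to the right cosets, with both marker states equal to the subgroup
  itself. As \<open>hd w' = \<theta> (last w)\<close>, the vertices \<open>Inl (last w)\<close> and
  \<open>Inr (hd w')\<close> lie in different components, so both components carry that coset, and
  every letter fixes it.\<close>

lemma generated_all: "generated = carrier G"
proof
  let ?H = "generated"
  have H: "?H \<subseteq> carrier G" using subgroup.subset[OF subgroup_generated] .
  then show "?H \<subseteq> carrier G" .
  let ?Q = "(\<lambda>g. ?H #>\<^bsub>G\<^esub> g) ` carrier G"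
  let ?act = "\<lambda>a q. q #>\<^bsub>G\<^esub> elem [a]"
  have single: "elem [a] \<in> carrier G" if "a \<in> A" for a using that by (intro elem_carrier) simp
  have act: "?act a (?H #>\<^bsub>G\<^esub> g) = ?H #>\<^bsub>G\<^esub> (g \<otimes>\<^bsub>G\<^esub> elem [a])" if "a \<in> A" "g \<in> carrier G" for a g
    using G.coset_mult_assoc[OF H that(2) single[OF that(1)]] .
  have H1: "?H = ?H #>\<^bsub>G\<^esub> \<one>\<^bsub>G\<^esub>" using G.coset_mult_one[OF H] by simp
  have fold_act: "fold ?act r (?H #>\<^bsub>G\<^esub> g) = ?H #>\<^bsub>G\<^esub> (g \<otimes>\<^bsub>G\<^esub> elem r)"
    if "r \<in> lists A" "g \<in> carrier G" for r g
    using that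
  proof (induction r arbitrary: g)
    case Nil
    then show ?case by (simp add: elem_Nil)
  next
    case (Cons a r)
    then have "a \<in> A" "r \<in> lists A" by auto
    then show ?case
      using Cons.IH[of "g \<otimes>\<^bsub>G\<^esub> elem [a]"] Cons.prems act[of a g] single[of a] elem_carrier[of r]
        elem_append[of "[a]" r] by (simp add: G.m_assoc)
  qed
  have "\<exists>h. (\<forall>a\<in>A. h (Inl a) = ?act a (h (Inr a))) \<and> (\<forall>a b. [a, b] \<in> S \<longrightarrow> h (Inl a) = h (Inr b)) \<and>
    h (Inl (last w)) = ?H \<and> h (Inr (hd w')) = ?H"
  proof (rule rigidity[where Q = ?Q])
    show "?act a q \<in> ?Q" if "a \<in> A" "q \<in> ?Q" for a q
      using that act single by auto
    show "inj_on (?act a) ?Q" if a: "a \<in> A" for a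
    proof (rule inj_on_inverseI[where g = "\<lambda>q. q #>\<^bsub>G\<^esub> inv\<^bsub>G\<^esub> elem [a]"])
      fix q assume "q \<in> ?Q"
      then obtain g where g: "g \<in> carrier G" "q = ?H #>\<^bsub>G\<^esub> g" by blast
      then show "?act a q #>\<^bsub>G\<^esub> inv\<^bsub>G\<^esub> elem [a] = q"
        using act[OF a g(1)] single[OF a] G.coset_mult_assoc[OF H] by (simp add: G.m_assoc)
    qed
    show "?H \<in> ?Q" "?H \<in> ?Q" using H1 by blast+
    fix y i j assume "consecutive y i j"
    then have r: "slice y i j \<in> returns" by (rule returnsI)
    have "fold ?act (slice y i j) ?H = ?H"
      using fold_act[of "slice y i j" "\<one>\<^bsub>G\<^esub>"] H1 S_lists[OF returns_in[OF r]]
        G.coset_join2[OF _ subgroup_generated generated_elem[OF r]] elem_carrier by simp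
    then show "fold ?act (slice y i j) (if plus_marker y i then ?H else ?H)
        = (if plus_marker y j then ?H else ?H)" by simp
  qed
  then obtain h where h0: "(\<forall>a\<in>A. h (Inl a) = ?act a (h (Inr a))) \<and>
    (\<forall>a b. [a, b] \<in> S \<longrightarrow> h (Inl a) = h (Inr b)) \<and> h (Inl (last w)) = ?H \<and> h (Inr (hd w')) = ?H" ..
  have h: "h (Inl a) = ?act a (h (Inr a))" if "a \<in> A" for a using h0 that by simp
  have h_edge: "h (Inl a) = h (Inr b)" if "[a, b] \<in> S" for a b using h0 that by simp
  have h_end: "h (Inl (last w)) = ?H" "h (Inr (hd w')) = ?H" using h0 by simp_all
  obtain J where J: "\<And>a b. [a, b] \<in> S \<Longrightarrow> J a = (\<not> J (\<theta> b))"
    "\<And>a b. a \<in> A \<Longrightarrow> b \<in> A \<Longrightarrow> J a = J b \<Longrightarrow>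
       (Inl a, Inl b) \<in> {(x, y). {x, y} \<in> ext_edges A S []}\<^sup>*"
    by (rule empty_graph_sides) blast
  \<comment> \<open>\<open>J\<close> speaks of left vertices, so the component of
    \<open>Inr (hd w')\<close> is represented by a left neighbour.\<close>
  obtain c where c: "[c, hd w'] \<in> S"
    using ext_left[OF S_prefix[of "[hd w']" "tl w'"]] w'_in w'_Nil by auto
  have cA: "c \<in> A" using S_lists[OF c] by simp
  have hl: "h (Inl a) = ?H" if "a \<in> A" for a
  proof (cases "J a = J (last w)")
    case True
    then show ?thesis using edge_invariant_sides[OF h_edge J(2)[OF that last_w_in]] h_end(1) by simp
  next
    case False
    then have "J a = J c" using J(1)[OF c] hd_w' last_w_in by (simp add: \<theta>_\<theta>)
    then show ?thesis using edge_invariant_sides[OF h_edge J(2)[OF that cA]] h_edge[OF c] h_end(2) by simp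
  qed
  have letter: "elem [a] \<in> ?H" if a: "a \<in> A" for a
  proof -
    obtain b where b: "[b, a] \<in> S" using ext_left[OF letters[OF a]] by blast
    then have "h (Inr a) = ?H" using hl[of b] h_edge[OF b] S_lists[OF b] by simp
    then have "?H = ?H #>\<^bsub>G\<^esub> elem [a]" using h[OF a] hl[OF a] by simp
    then show ?thesis using G.coset_join1[OF _ single[OF a] subgroup_generated] by simp
  qed
  have elem_H: "elem x \<in> ?H" if "x \<in> lists A" for x
    using that
  proof (induction x)
    case Nil
    show ?case using subgroup.one_closed[OF subgroup_generated] by (simp add: elem_Nil)
  next
    case (Cons a x)
    then show ?case using elem_append[of "[a]" x] letter[of a] generated_mult by simp
  qed
  show "carrier G \<subseteq> ?H" unfolding carrier_elem by (rule image_subsetI) (rule elem_H)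
qed

end

section \<open>Cohomology of functions of factors\<close>

text \<open>Subtractions become additions of inverses, so that associativity and cancellation decide
  the equations; nothing commutes.\<close>

lemmas group_norm = add.assoc diff_conv_add_uminus minus_add

context recurrent_specular
begin

text \<open>For \<open>x = a # u @ [b]\<close> the potential on the extension graph of
  \<open>u\<close> splits \<open>f x\<close> into a function of \<open>a # u = butlast x\<close> and
  one of \<open>u @ [b] = tl x\<close>. Subtracting the first as a coboundary leaves a function of
  the shorter word \<open>tl x\<close>.\<close>

lemma cohomologous_last:
  fixes f :: "'a list \<Rightarrow> 'g :: group_add"
  shows "\<exists>\<phi> g. \<forall>x\<in>S. length x = Suc m \<longrightarrow> f x = g (butlast x) + \<phi> (last x) - g (tl x)"
proof (induction m arbitrary: f)
  case 0
  show ?case by (intro exI[of _ "\<lambda>a. f [a]"] exI[of _ "\<lambda>_. 0"]) (auto simp: length_Suc_conv)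
next
  case (Suc m)
  have "\<forall>u\<in>S. \<exists>p. \<forall>a b. a # u @ [b] \<in> S \<longrightarrow> f (a # u @ [b]) = fst p a + snd p b"
    using ext_potential[of _ "\<lambda>a b. f (a # _ @ [b])"] by (metis fst_conv snd_conv)
  then obtain p where p: "\<And>u a b. u \<in> S \<Longrightarrow> a # u @ [b] \<in> S \<Longrightarrow> f (a # u @ [b]) = fst (p u) a + snd (p u) b"
    by metis
  define g1 where "g1 v = fst (p (tl v)) (hd v)" for v
  define f' where "f' v = snd (p (butlast v)) (last v) + g1 v" for v
  obtain \<phi> g where IH: "\<And>x. x \<in> S \<Longrightarrow> length x = Suc m \<Longrightarrow> f' x = g (butlast x) + \<phi> (last x) - g (tl x)"
    using Suc.IH[of f'] by blast
  define g2 where "g2 v = g1 v + g (tl v)" for v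
  have "f x = g2 (butlast x) + \<phi> (last x) - g2 (tl x)" if x: "x \<in> S" "length x = Suc (Suc m)" for x
  proof -
    obtain a v where av: "x = a # v" "length v = Suc m" using x(2) by (auto simp: length_Suc_conv)
    then obtain u b where ub: "v = u @ [b]" by (metis append_butlast_last_id length_0_conv nat.distinct(1))
    have v: "v \<in> S" "u \<in> S" using x(1) S_Cons[of a v] S_prefix[of u "[b]"] av(1) ub by simp_all
    have "f x = fst (p u) a + snd (p u) b" using p[OF v(2), of a b] x av ub by simp
    moreover have "fst (p u) a = g1 (butlast x)" using av ub by (simp add: g1_def)
    moreover have "snd (p u) b = f' v - g1 v" using ub by (simp add: f'_def)
    ultimately show ?thesis using IH[OF v(1) av(2)] av ub by (simp add: g2_def group_norm del: add_uminus_conv_diff)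
  qed
  then show ?case by blast
qed

text \<open>Moving \<open>\<phi>\<close> from the last letter to the middle one is again a
  coboundary: \<open>g\<close> absorbs the sum of \<open>\<phi>\<close> over the second half of its
  argument. A centred window leaves room for markers on both sides.\<close>

lemma cohomologous_middle:
  fixes f :: "'a list \<Rightarrow> 'g :: group_add"
  shows "\<exists>\<phi> g. \<forall>x\<in>S. length x = Suc (N + N) \<longrightarrow> f x = g (butlast x) + \<phi> (x ! N) - g (tl x)"
proof -
  obtain \<phi> g where g: "\<And>x. x \<in> S \<Longrightarrow> length x = Suc (N + N) \<Longrightarrow> f x = g (butlast x) + \<phi> (last x) - g (tl x)"
    using cohomologous_last[of "N + N" f] by blast
  define g' where "g' v = g v - sum_list (map \<phi> (drop N v))" for v
  have "f x = g' (butlast x) + \<phi> (x ! N) - g' (tl x)" if x: "x \<in> S" "length x = Suc (N + N)" for x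
  proof -
    have "x ! N # drop N (tl x) = drop N x" using x(2) Cons_nth_drop_Suc[of N x] by (simp add: drop_Suc)
    moreover have "drop N (butlast x) @ [last x] = drop N x"
      using x(2) append_butlast_last_id[of x]
      by (metis Zero_not_Suc append_butlast_last_id butlast_drop drop_eq_Nil last_drop length_0_conv not_less_eq_eq le_add1 linorder_not_less less_Suc_eq_le)
    ultimately have "sum_list (map \<phi> (drop N (butlast x))) + \<phi> (last x)
        = \<phi> (x ! N) + sum_list (map \<phi> (drop N (tl x)))"
      by (metis (no_types, lifting) list.simps(8,9) map_append sum_list.Cons sum_list.append sum_list.Nil add_0_right)
    then have "\<phi> (last x) = - sum_list (map \<phi> (drop N (butlast x))) + (\<phi> (x ! N) + sum_list (map \<phi> (drop N (tl x))))"
      by (metis minus_add_cancel)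
    then show ?thesis using g[OF x] by (simp add: g'_def group_norm del: add_uminus_conv_diff)
  qed
  then show ?thesis by blast
qed

end

section \<open>Values of return words spread over positions\<close>

context recurrent_specular_word
begin

text \<open>The occurrence behind an earlier marker ends inside \<open>p @ u\<close>, either by its
  position or because an occurrence of \<open>w'\<close> running past \<open>u = w\<close> would
  overlap or touch it.\<close>

lemma marker_before:
  assumes y: "p @ u @ q \<in> S" and u: "u = w \<and> e = length w \<or> u = w' \<and> e = 0"
    and k: "k < length p + e"
  shows "marker (p @ u @ q) k \<longleftrightarrow> marker (p @ u) k"
proof -
  let ?y = "p @ u @ q"
  have len: "length u = length w" "e \<le> length w" using u by auto
  have occ: "occurs_at ?y v i \<longleftrightarrow> occurs_at (p @ u) v i" if "i + length v \<le> length p + length u" for v i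
    using that by (auto simp: occurs_at_def)
  have plus: "plus_marker ?y k \<longleftrightarrow> plus_marker (p @ u) k"
    using occ[of "k - length w" w] k len by (auto simp: plus_marker_def)
  have "k + length w \<le> length p + length w" if o: "occurs_at ?y w' k \<or> occurs_at (p @ u) w' k"
  proof (cases "u = w'")
    case True
    then show ?thesis using u k w_neq_w' by auto
  next
    case False
    then have uw: "u = w" using u by blast
    have "occurs_at ?y w' k \<or> k + length w \<le> length p + length w"
      using o occurs_at_length[of "p @ u" w' k] w'_Nil len by auto
    then show ?thesis
      using occurrences_apart[OF y, of "length p" k] occurs_at_append[of p w q] uw k u by auto
  qed
  then have "occurs_at ?y w' k \<longleftrightarrow> occurs_at (p @ u) w' k"
    using occ[of k w'] len by auto
  then show ?thesis using plus by (simp add: marker_def)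
qed

text \<open>Mirror image of the previous lemma: an occurrence of \<open>w\<close> starting before
  \<open>u = w'\<close> and ending at its start or inside it is excluded.\<close>

lemma marker_after:
  assumes y: "p @ u @ q \<in> S" and u: "u = w \<and> e = length w \<or> u = w' \<and> e = 0" and k: "e \<le> k"
  shows "marker (p @ u @ q) (length p + k) \<longleftrightarrow> marker (u @ q) k"
proof -
  let ?y = "p @ u @ q"
  have occ: "occurs_at ?y v (length p + i) \<longleftrightarrow> occurs_at (u @ q) v i" for v i
    by (simp add: occurs_at_def)
  have "plus_marker ?y (length p + k) \<longleftrightarrow> plus_marker (u @ q) k"
  proof (cases "length w \<le> k")
    case True
    then show ?thesis using occ[of w "k - length w"] by (simp add: plus_marker_def)
  next
    case False
    then have uw: "u = w'" using u k by auto
    have "\<not> occurs_at ?y w (length p + k - length w)" if "length w \<le> length p + k"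
      using occurrences_apart[OF y, of "length p + k - length w" "length p"] occurs_at_append[of p w' q]
        uw that False by auto
    then show ?thesis using False by (auto simp: plus_marker_def)
  qed
  then show ?thesis using occ[of w' k] by (simp add: marker_def)
qed

text \<open>A new marker between the old ones could only come from an occurrence crossing an end of
  \<open>y\<close>. It would overlap the occurrence that marks \<open>i\<close> or \<open>j\<close>,
  which is of the other kind.\<close>

lemma consecutive_embed:
  assumes c: "consecutive y i j" and z: "p @ y @ q \<in> S"
  shows "consecutive (p @ y @ q) (length p + i) (length p + j)"
    and "plus_marker (p @ y @ q) (length p + i) \<longleftrightarrow> plus_marker y i"
    and "plus_marker (p @ y @ q) (length p + j) \<longleftrightarrow> plus_marker y j"
proof -
  let ?z = "p @ y @ q" and ?n = "length w"
  have ij: "i < j" "marker y i" "marker y j" "j \<le> length y" and y: "y \<in> S"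
    and no: "\<And>k. i < k \<Longrightarrow> k < j \<Longrightarrow> \<not> marker y k"
    using c marker_le by (auto simp: consecutive_def)
  have occ: "occurs_at ?z v (length p + i) \<longleftrightarrow> occurs_at y v i" if "i + length v \<le> length y" for v i
    using that by (simp add: occurs_at_def)
  have occ': "occurs_at ?z v (length p + i)" if "occurs_at y v i" "v \<noteq> []" for v i
    using occ[OF occurs_at_length[OF that]] that by blast
  have plus_in: "plus_marker ?z (length p + k)" if "plus_marker y k" for k
    using that occ'[of w "k - ?n"] w_Nil by (auto simp: plus_marker_def)
  have minus_in: "occurs_at ?z w' (length p + k)" if "occurs_at y w' k" for k
    using occ'[OF that] w_Nil by simp
  have sign: "plus_marker ?z (length p + k) \<longleftrightarrow> plus_marker y k" if "marker y k" for k
    using that plus_in[of k] minus_in[of k] not_both[OF z] by (auto simp: marker_def)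
  show "plus_marker ?z (length p + i) \<longleftrightarrow> plus_marker y i" "plus_marker ?z (length p + j) \<longleftrightarrow> plus_marker y j"
    using sign ij by auto
  have marker_in: "marker ?z (length p + k)" if "marker y k" for k
    using that plus_in[of k] minus_in[of k] by (auto simp: marker_def)
  have "\<not> marker ?z k" if k: "length p + i < k" "k < length p + j" for k
  proof
    assume "marker ?z k"
    then consider "?n \<le> k" "occurs_at ?z w (k - ?n)" | "occurs_at ?z w' k"
      by (auto simp: marker_def plus_marker_def)
    then show False
    proof cases
      case 1
      show False
      proof (cases "length p + ?n \<le> k")
        case True
        then have "occurs_at y w (k - length p - ?n)"
          using occ[of "k - length p - ?n" w] 1 k ij(4) by (simp add: algebra_simps)
        moreover have "?n \<le> k - length p" using True by linarith
        ultimately have "marker y (k - length p)" by (simp add: marker_def plus_marker_def)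
        then show False using no[of "k - length p"] k by linarith
      next
        case False
        then have "\<not> plus_marker y i" using k by (auto simp: plus_marker_def)
        then have "occurs_at ?z w' (length p + i)" using ij(2) minus_in by (simp add: marker_def)
        then show False using occurrences_apart[OF z 1(2)] 1 k False by fastforce
      qed
    next
      case 2
      show False
      proof (cases "k + ?n \<le> length p + length y")
        case True
        then have "occurs_at y w' (k - length p)"
          using occ[of "k - length p" w'] 2 k by simp
        then have "marker y (k - length p)" by (simp add: marker_def)
        then show False using no[of "k - length p"] k by linarith
      next
        case False
        then have "\<not> occurs_at y w' j" using occurs_at_length[of y w' j] k w_Nil by auto
        then have "plus_marker y j" using ij(3) by (simp add: marker_def)
        then have "plus_marker ?z (length p + j)" by (rule plus_in)
        then show False
          using occurrences_apart[OF z _ 2, of "length p + j - ?n"] k False ij(4)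
          by (auto simp: plus_marker_def)
      qed
    qed
  qed
  then show "consecutive ?z (length p + i) (length p + j)"
    using ij marker_in z by (auto simp: consecutive_def)
qed

text \<open>A distance rather than a position, so that it can be compared between words with shifted
  positions. If no marker follows, the value is unspecified.\<close>

definition next_marker :: "'a list \<Rightarrow> nat \<Rightarrow> nat" where
  "next_marker y k = (LEAST d. 0 < d \<and> marker y (k + d))"

lemma next_marker_props:
  assumes "marker y j" "k < j"
  shows "0 < next_marker y k" "marker y (k + next_marker y k)" "k + next_marker y k \<le> j"
    "\<And>d. 0 < d \<Longrightarrow> marker y (k + d) \<Longrightarrow> next_marker y k \<le> d"
proof -
  have *: "0 < j - k \<and> marker y (k + (j - k))" using assms by simp
  show "0 < next_marker y k" "marker y (k + next_marker y k)"
    using LeastI[of "\<lambda>d. 0 < d \<and> marker y (k + d)", OF *] by (auto simp: next_marker_def)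
  show le: "\<And>d. 0 < d \<Longrightarrow> marker y (k + d) \<Longrightarrow> next_marker y k \<le> d"
    unfolding next_marker_def by (rule Least_le) simp
  show "k + next_marker y k \<le> j" using le[of "j - k"] * assms by simp
qed

lemma next_marker_cong:
  assumes "marker y j" "k < j" "k' + j = k + j'"
    and "\<And>d. 0 < d \<Longrightarrow> d \<le> j - k \<Longrightarrow> marker y (k + d) \<longleftrightarrow> marker y' (k' + d)"
  shows "next_marker y k = next_marker y' k'"
proof -
  note p = next_marker_props[OF assms(1,2)]
  show ?thesis
    unfolding next_marker_def[of y']
  proof (rule Least_equality[symmetric])
    show "0 < next_marker y k \<and> marker y' (k' + next_marker y k)"
      using p(1-3) assms(4)[of "next_marker y k"] by auto
    fix d assume d: "0 < d \<and> marker y' (k' + d)"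
    show "next_marker y k \<le> d"
    proof (cases "d \<le> j - k")
      case True
      then show ?thesis using p(4)[of d] assms(4)[of d] d by simp
    next
      case False
      then show ?thesis using p(3) by linarith
    qed
  qed
qed

lemma consecutive_next: "consecutive y i j \<Longrightarrow> next_marker y i = j - i"
  using next_marker_props[of y j i] unfolding consecutive_def
  by (metis add_diff_cancel_left' le_neq_implies_less less_add_same_cancel1)

text \<open>A function of the mixed return words is spread over the positions of a word by charging
  its value on a return word to the first letter of that word.\<close>

definition charge :: "('a list \<Rightarrow> 'g) \<Rightarrow> 'a list \<Rightarrow> nat \<Rightarrow> 'g :: group_add" where
  "charge val y k = (if marker y k then val (slice y k (k + next_marker y k)) else 0)"

lemma charge_sum:
  assumes "consecutive y i j"
  shows "sum_list (map (charge val y) [i..<j]) = val (slice y i j)"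
proof -
  have ij: "i < j" "marker y i" using assms by (auto simp: consecutive_def)
  have "charge val y k = 0" if "k \<in> set [Suc i..<j]" for k
    using that assms by (auto simp: consecutive_def charge_def)
  then have "sum_list (map (charge val y) [Suc i..<j]) = sum_list (map (\<lambda>_. 0) [Suc i..<j])"
    by (metis map_cong)
  moreover have "charge val y i = val (slice y i j)"
    using ij consecutive_next[OF assms] by (simp add: charge_def)
  ultimately show ?thesis using ij by (simp add: upt_conv_Cons sum_list_0)
qed

lemma charge_cong:
  assumes "marker y j" "k < j"
    and mk: "\<And>l. k \<le> l \<Longrightarrow> l \<le> j \<Longrightarrow> marker y l \<longleftrightarrow> marker y' l"
    and sl: "slice y k j = slice y' k j"
  shows "charge val y k = charge val y' k"
proof -
  have "next_marker y k = next_marker y' k"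
    by (rule next_marker_cong[OF assms(1,2) refl]) (use mk in auto)
  moreover have "slice y k (k + next_marker y k) = slice y' k (k + next_marker y k)"
  proof -
    have "slice x k (k + next_marker y k) = take (next_marker y k) (slice x k j)" for x
      using next_marker_props(3)[OF assms(1,2)] by (simp add: slice_def)
    from this[of y] this[of y'] show ?thesis using sl by simp
  qed
  moreover have "marker y k \<longleftrightarrow> marker y' k" using mk assms(2) by simp
  ultimately show ?thesis by (simp add: charge_def)
qed

end

context recurrent_specular
begin

abbreviation ev :: "('a \<Rightarrow> 'g) \<Rightarrow> 'a list \<Rightarrow> 'g :: group_add" where
  "ev \<phi> x \<equiv> sum_list (map \<phi> x)"

text \<open>Windows at successive positions share a factor of length \<open>N + N\<close>, the
  argument of \<open>g\<close>, so the inner \<open>g\<close> terms cancel.\<close>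

lemma ev_telescope:
  fixes g :: "'a list \<Rightarrow> 'g :: group_add"
  assumes f: "\<And>x. x \<in> S \<Longrightarrow> length x = Suc (N + N) \<Longrightarrow> f x = g (butlast x) + \<phi> (x ! N) - g (tl x)"
    and y: "y \<in> S" "N \<le> i" "i \<le> j" "j + N \<le> length y"
  shows "sum_list (map (\<lambda>k. f (slice y (k - N) (Suc (k + N)))) [i..<j])
    = g (slice y (i - N) (i + N)) + ev \<phi> (slice y i j) - g (slice y (j - N) (j + N))"
  using y(3,4)
proof (induction j rule: dec_induct)
  case base
  show ?case by simp
next
  case (step j)
  let ?x = "slice y (j - N) (Suc (j + N))"
  have le: "Suc (j + N) \<le> length y" using step by simp
  have len: "length ?x = Suc (N + N)" using step y le by (simp add: length_slice)
  have "butlast ?x = slice y (j - N) (j + N)"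
    using len step y le by (simp add: butlast_conv_take slice_def min_def)
  moreover have "tl ?x = slice y (Suc j - N) (Suc j + N)"
    using step y by (simp add: slice_def tl_take tl_drop Suc_diff_le flip: drop_Suc)
  moreover have "?x ! N = y ! j" using step y le by (simp add: slice_def)
  ultimately have fx: "f ?x = g (slice y (j - N) (j + N)) + \<phi> (y ! j) - g (slice y (Suc j - N) (Suc j + N))"
    using f[OF S_slice[OF y(1)] len] by simp
  have "slice y i (Suc j) = slice y i j @ [y ! j]"
    using slice_append[of i j "Suc j" y] slice_Suc[of j y] step le by simp
  then show ?case using step fx by (simp add: group_norm del: add_uminus_conv_diff)
qed

end

context recurrent_specular_word
begin

text \<open>From \<open>k\<close> the next marker is at most \<open>K + 1\<close> letters away, and
  recognising it takes \<open>length w\<close> more. The window has \<open>N + 1\<close> letters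
  from \<open>k\<close> on, which is just enough.\<close>

lemma charge_window:
  fixes val :: "'a list \<Rightarrow> 'g :: group_add"
  assumes K: "\<And>x. x \<in> S \<Longrightarrow> K \<le> length x \<Longrightarrow> \<exists>m. plus_marker x m" and N: "K + length w \<le> N"
    and y: "y \<in> S" "N \<le> k" "Suc (k + N) \<le> length y"
  shows "charge val (slice y (k - N) (Suc (k + N))) N = charge val y k"
proof -
  let ?x = "slice y (k - N) (Suc (k + N))"
  have mk: "marker ?x (N + d) \<longleftrightarrow> marker y (k + d)" if "d + length w \<le> Suc N" for d
    using marker_slice_iff[of "k - N" "N + d" "Suc (k + N)" y] that y N by simp
  have "length (slice y (Suc k) (Suc k + K)) = K"
    using y N by (simp add: length_slice)
  then obtain m where m: "plus_marker (slice y (Suc k) (Suc k + K)) m"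
    using K[OF S_slice[OF y(1)], of "Suc k" "Suc k + K"] by auto
  have mK: "m \<le> K" using plus_marker_le[OF m] y N by (simp add: length_slice)
  have "plus_marker y (Suc k + m)" by (rule plus_marker_slice[OF m]) (use y N in simp)
  then have j: "marker y (k + Suc m)" by (simp add: marker_def)
  have x: "marker ?x (N + Suc m)" using mk[of "Suc m"] j mK N by simp
  have nx: "next_marker y k = next_marker ?x N"
    by (rule next_marker_cong[OF j, of k N "N + Suc m"]) (use mk mK N in auto)
  have "next_marker y k \<le> Suc m" using next_marker_props(3)[OF j, of k] by simp
  then have "slice ?x N (N + next_marker y k) = slice y k (k + next_marker y k)"
    using y mK N by (subst slice_slice) auto
  then show ?thesis using mk[of 0] N nx by (simp add: charge_def)
qed

text \<open>At a position whose window lies inside a common past, two words have the same value of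
  \<open>g\<close>, and equal charges carry this over to the marker at \<open>u\<close>. A common
  future works likewise. So the value depends on the past alone and on the future alone, hence on
  neither.\<close>

lemma potential_constant:
  fixes val :: "'a list \<Rightarrow> 'g :: group_add"
  assumes K: "\<And>x. x \<in> S \<Longrightarrow> K \<le> length x \<Longrightarrow> \<exists>m. plus_marker x m" and N: "K + length w \<le> N"
    and pot: "\<And>y i j. y \<in> S \<Longrightarrow> N \<le> i \<Longrightarrow> i \<le> j \<Longrightarrow> j + N \<le> length y \<Longrightarrow>
      sum_list (map (charge val y) [i..<j])
        = g (slice y (i - N) (i + N)) + ev \<phi> (slice y i j) - g (slice y (j - N) (j + N))"
    and u: "u = w \<and> e = length w \<or> u = w' \<and> e = 0" and L: "L = N + N + K"
  shows "\<exists>q. \<forall>s t. length s = L \<longrightarrow> length t = L \<longrightarrow> s @ u @ t \<in> S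
    \<longrightarrow> g (slice (s @ u @ t) (L + e - N) (L + e + N)) = q"
proof -
  have len: "length u = length w" "e \<le> length w" using u by auto
  then have u_Nil: "u \<noteq> []" using w_Nil by auto
  have mark: "marker (s @ u @ t) (length s + e)" for s t
    using u occurs_at_append[of s u t] by (auto simp: marker_def plus_marker_def)
  \<comment> \<open>Since \<open>j\<close> is a marker, no return word charged before it extends
    beyond it. The charges between \<open>i\<close> and \<open>j\<close> coincide, and the
    telescoped sums differ only in their \<open>g\<close> terms.\<close>
  have transfer: "g (slice y (i - N) (i + N)) = g (slice y' (i - N) (i + N)) \<longleftrightarrow>
      g (slice y (j - N) (j + N)) = g (slice y' (j - N) (j + N))"
    if y: "y \<in> S" "y' \<in> S" and ij: "N \<le> i" "i \<le> j" "j + N \<le> length y" "j + N \<le> length y'"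
      and mj: "marker y j" and sl: "slice y i j = slice y' i j"
      and mk: "\<And>l. i \<le> l \<Longrightarrow> l \<le> j \<Longrightarrow> marker y l \<longleftrightarrow> marker y' l" for y y' i j
  proof -
    have "charge val y k = charge val y' k" if "k \<in> set [i..<j]" for k
    proof (rule charge_cong[OF mj])
      have "slice x k j = drop (k - i) (slice x i j)" for x
        using that by (simp add: slice_def drop_take)
      from this[of y] this[of y'] show "slice y k j = slice y' k j" using sl by simp
    qed (use that mk in auto)
    then have eq: "map (charge val y) [i..<j] = map (charge val y') [i..<j]" by (rule map_cong[OF refl])
    have "g (slice y (i - N) (i + N)) + ev \<phi> (slice y i j) - g (slice y (j - N) (j + N))
        = g (slice y' (i - N) (i + N)) + ev \<phi> (slice y i j) - g (slice y' (j - N) (j + N))"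
      using pot[OF y(1) ij(1,2,3)] pot[OF y(2) ij(1,2,4)] unfolding eq sl by (rule trans[OF sym])
    then show ?thesis by (auto simp: diff_conv_add_uminus simp del: add_uminus_conv_diff)
  qed
  have same_left: "g (slice (s @ u @ t) (L + e - N) (L + e + N)) = g (slice (s @ u @ t') (L + e - N) (L + e + N))"
    if st: "length s = L" "length t = L" "length t' = L" "s @ u @ t \<in> S" "s @ u @ t' \<in> S" for s t t'
  proof -
    have "length (slice s N (N + K)) = K" using st L by (simp add: length_slice)
    then obtain m where m: "plus_marker (slice s N (N + K)) m"
      using K[OF S_slice[OF S_prefix[OF st(4)]], of N "N + K"] by auto
    have mK: "m \<le> K" using plus_marker_le[OF m] st L by (simp add: length_slice)
    have sl: "slice (s @ u @ t) a b = slice (s @ u @ t') a b" if "b \<le> length s + e" for a b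
    proof -
      have "slice (s @ u @ x) a b = slice (s @ u) a b" for x
        using that len by (auto simp: slice_def)
      then show ?thesis by metis
    qed
    have "marker (s @ u @ t) l \<longleftrightarrow> marker (s @ u @ t') l" if "l \<le> L + e" for l
      using marker_before[OF st(4) u, of l] marker_before[OF st(5) u, of l] mark[of s t] mark[of s t'] that st(1)
      by (cases "l = L + e") auto
    then have "g (slice (s @ u @ t) (N + m - N) (N + m + N)) = g (slice (s @ u @ t') (N + m - N) (N + m + N)) \<longleftrightarrow>
      g (slice (s @ u @ t) (L + e - N) (L + e + N)) = g (slice (s @ u @ t') (L + e - N) (L + e + N))"
      using st L mK len mark[of s t] N by (intro transfer sl) auto
    then show ?thesis using sl[of "N + m + N"] mK L st by simp
  qed
  have same_right: "g (slice (s @ u @ t) (L + e - N) (L + e + N)) = g (slice (s' @ u @ t) (L + e - N) (L + e + N))"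
    if st: "length s = L" "length s' = L" "length t = L" "s @ u @ t \<in> S" "s' @ u @ t \<in> S" for s s' t
  proof -
    let ?a = "L + length w + N"
    have sl: "slice (s @ u @ t) a b = slice (s' @ u @ t) a b" if "L \<le> a" for a b
      using that st by (simp add: slice_def)
    have lena: "length (slice (s @ u @ t) ?a (?a + K)) = K" using st L len by (simp add: length_slice)
    then obtain m where m: "plus_marker (slice (s @ u @ t) ?a (?a + K)) m"
      using K[OF S_slice[OF st(4)], of ?a "?a + K"] by auto
    have mK: "m \<le> K" using plus_marker_le[OF m] lena by simp
    have "plus_marker (s @ u @ t) (?a + m)"
      by (rule plus_marker_slice[OF m]) (use st L len in simp)
    then have mj: "marker (s @ u @ t) (?a + m)" by (simp add: marker_def)
    have "marker (s @ u @ t) l \<longleftrightarrow> marker (s' @ u @ t) l" if "L + e \<le> l" for l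
      using marker_after[OF st(4) u, of "l - L"] marker_after[OF st(5) u, of "l - L"] that st(1,2) by simp
    then have "g (slice (s @ u @ t) (L + e - N) (L + e + N)) = g (slice (s' @ u @ t) (L + e - N) (L + e + N)) \<longleftrightarrow>
      g (slice (s @ u @ t) (?a + m - N) (?a + m + N)) = g (slice (s' @ u @ t) (?a + m - N) (?a + m + N))"
      using st L mK len mj N by (intro transfer sl) auto
    then show ?thesis using sl[of "?a + m - N"] by simp
  qed
  show ?thesis
    by (rule two_sided_invariant[of u L L "\<lambda>s t. g (slice (s @ u @ t) (L + e - N) (L + e + N))"])
       (rule u_Nil, rule same_left, assumption+, rule same_right)
qed

text \<open>All that survives of \<open>g\<close> at the ends of a return word is one value for each
  kind of marker.\<close>

lemma consecutive_potential:
  fixes val :: "'a list \<Rightarrow> 'g :: group_add"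
  obtains \<phi> gp gm where "\<And>y i j. consecutive y i j \<Longrightarrow>
    val (slice y i j) = (if plus_marker y i then gp else gm) + ev \<phi> (slice y i j) - (if plus_marker y j then gp else gm)"
proof -
  obtain K where K: "\<And>x. x \<in> S \<Longrightarrow> K \<le> length x \<Longrightarrow> \<exists>m. plus_marker x m"
    using plus_marker_exists by blast
  let ?n = "length w"
  define N where "N = K + ?n"
  \<comment> \<open>Room on either side for \<open>K\<close> letters containing a marker, with a
    window of \<open>N\<close> letters around it.\<close>
  define L where "L = N + N + K"
  obtain \<phi> g where g: "\<And>x. x \<in> S \<Longrightarrow> length x = Suc (N + N) \<Longrightarrow>
      charge val x N = g (butlast x) + \<phi> (x ! N) - g (tl x)"
    using cohomologous_middle[of N "\<lambda>x. charge val x N"] by blast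
  have pot: "sum_list (map (charge val y) [i..<j])
        = g (slice y (i - N) (i + N)) + ev \<phi> (slice y i j) - g (slice y (j - N) (j + N))"
    if y: "y \<in> S" "N \<le> i" "i \<le> j" "j + N \<le> length y" for y i j
  proof -
    have "charge val (slice y (k - N) (Suc (k + N))) N = charge val y k" if "k \<in> set [i..<j]" for k
      using that y by (intro charge_window[OF K]) (auto simp: N_def)
    then have eq: "map (\<lambda>k. charge val (slice y (k - N) (Suc (k + N))) N) [i..<j] = map (charge val y) [i..<j]"
      by (rule map_cong[OF refl])
    show ?thesis using ev_telescope[of N "\<lambda>x. charge val x N" g \<phi>, OF g y] by (simp only: eq)
  qed
  note const = potential_constant[OF K _ pot _ L_def]
  obtain gp where gp: "\<And>s t. length s = L \<Longrightarrow> length t = L \<Longrightarrow> s @ w @ t \<in> S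
    \<Longrightarrow> g (slice (s @ w @ t) (L + ?n - N) (L + ?n + N)) = gp"
    using const[of w ?n] by (auto simp: N_def)
  obtain gm where gm: "\<And>s t. length s = L \<Longrightarrow> length t = L \<Longrightarrow> s @ w' @ t \<in> S
    \<Longrightarrow> g (slice (s @ w' @ t) (L - N) (L + N)) = gm"
    using const[of w' 0] by (auto simp: N_def)
  have NL: "N \<le> L" by (simp add: L_def)
  have at_marker: "g (slice y (i - N) (i + N)) = (if plus_marker y i then gp else gm)"
    if y: "y \<in> S" "marker y i" "L + ?n \<le> i" "i + L + ?n \<le> length y" for y i
  proof -
    have split: "slice y a (a + L) @ slice y (a + L) (a + L + ?n) @ slice y (a + L + ?n) (a + L + ?n + L)
        = slice y a (a + L + ?n + L)" for a
      by (simp add: slice_append)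
    show ?thesis
    proof (cases "plus_marker y i")
      case True
      define a where "a = i - ?n - L"
      have a: "a + L = i - ?n" "a + L + ?n = i" using y by (auto simp: a_def)
      have "slice y (a + L) (a + L + ?n) = w"
        using True a by (simp add: plus_marker_def occurs_at_slice_eq)
      then have eq: "slice y a (a + L) @ w @ slice y i (i + L) = slice y a (i + L)"
        using split[of a] a by simp
      have "g (slice (slice y a (i + L)) (L + ?n - N) (L + ?n + N)) = gp"
        using gp[of "slice y a (a + L)" "slice y i (i + L)"] S_slice[OF y(1)] eq y a
        by (simp add: length_slice)
      moreover have "slice (slice y a (i + L)) (L + ?n - N) (L + ?n + N) = slice y (i - N) (i + N)"
      proof -
        have "a + (L + ?n - N) = i - N" "a + (L + ?n + N) = i + N" using a NL by auto
        then show ?thesis using NL by (subst slice_slice) (auto simp: add.assoc)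
      qed
      ultimately show ?thesis using True by simp
    next
      case False
      then have "occurs_at y w' i" using y by (simp add: marker_def)
      then have w': "slice y i (i + ?n) = w'" by (simp add: occurs_at_slice_eq)
      define a where "a = i - L"
      have a: "a + L = i" using y by (auto simp: a_def)
      have eq: "slice y a i @ w' @ slice y (i + ?n) (i + ?n + L) = slice y a (i + ?n + L)"
        using split[of a] a w' by simp
      have "g (slice (slice y a (i + ?n + L)) (L - N) (L + N)) = gm"
        using gm[of "slice y a i" "slice y (i + ?n) (i + ?n + L)"] S_slice[OF y(1)] eq y a
        by (simp add: length_slice)
      moreover have "slice (slice y a (i + ?n + L)) (L - N) (L + N) = slice y (i - N) (i + N)"
      proof -
        have "a + (L - N) = i - N" "a + (L + N) = i + N" using a NL by auto
        then show ?thesis using NL a by (subst slice_slice) (auto simp: add.assoc)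
      qed
      ultimately show ?thesis using False by simp
    qed
  qed
  have "val (slice y i j) = (if plus_marker y i then gp else gm) + ev \<phi> (slice y i j) - (if plus_marker y j then gp else gm)"
    if c: "consecutive y i j" for y i j
  proof -
    have y: "y \<in> S" "i < j" "j \<le> length y" using c marker_le by (auto simp: consecutive_def)
    \<comment> \<open>Padding makes all windows fit; \<open>consecutive_embed\<close> keeps the
      markers consecutive and preserves their kinds.\<close>
    obtain p where p: "length p = L + ?n" "p @ y \<in> S" using ext_left_n[OF y(1)] by blast
    obtain q where q: "length q = L + ?n" "(p @ y) @ q \<in> S" using ext_right_n[OF p(2)] by blast
    then have z: "p @ y @ q \<in> S" by simp
    let ?z = "p @ y @ q" and ?i = "length p + i" and ?j = "length p + j"
    note emb = consecutive_embed[OF c z]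
    have mk: "marker ?z ?i" "marker ?z ?j" using emb(1) by (auto simp: consecutive_def)
    have "val (slice ?z ?i ?j) = g (slice ?z (?i - N) (?i + N)) + ev \<phi> (slice ?z ?i ?j) - g (slice ?z (?j - N) (?j + N))"
      using charge_sum[OF emb(1), of val] pot[OF z, of ?i ?j] p q y NL by simp
    moreover have "slice ?z ?i ?j = slice y i j" using y by (simp add: slice_def)
    moreover have "g (slice ?z (?i - N) (?i + N)) = (if plus_marker y i then gp else gm)"
      using at_marker[OF z mk(1)] emb(2) p q y by simp
    moreover have "g (slice ?z (?j - N) (?j + N)) = (if plus_marker y j then gp else gm)"
      using at_marker[OF z mk(2)] emb(3) p q y by simp
    ultimately show ?thesis by simp
  qed
  then show thesis using that by blast
qed

end

section \<open>Extending maps from return words to letters\<close>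

context recurrent_specular_word
begin

lemma minus_marker_iff: "y \<in> S \<Longrightarrow> marker y i \<Longrightarrow> occurs_at y w' i \<longleftrightarrow> \<not> plus_marker y i"
  using not_both by (auto simp: marker_def)

lemma letter_before_plus: "plus_marker y i \<Longrightarrow> \<exists>k. i = Suc k \<and> y ! k = last w"
proof -
  assume p: "plus_marker y i"
  then have i: "length w \<le> i" "slice y (i - length w) i = w"
    by (auto simp: plus_marker_def occurs_at_slice_eq)
  have n: "length w > 0" using w_Nil by simp
  have "w ! (length w - 1) = slice y (i - length w) i ! (length w - 1)" by (simp only: i(2))
  also have "\<dots> = y ! (i - length w + (length w - 1))" using i(1) n plus_marker_le[OF p] by (simp add: slice_def)
  also have "i - length w + (length w - 1) = i - 1" using i(1) n by linarith
  finally have "y ! (i - 1) = last w" using last_conv_nth[OF w_Nil] by simp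
  moreover have "i = Suc (i - 1)" using i n by linarith
  ultimately show ?thesis by blast
qed

lemma letter_after_minus:
  assumes "occurs_at y w' i" shows "i < length y \<and> y ! i = hd w'"
proof -
  have n: "length w > 0" using w_Nil by simp
  have i: "i < length y" using occurs_at_length[OF assms w'_Nil] n unfolding length_wi by linarith
  have "hd w' = slice y i (i + length w) ! 0"
    using assms w'_Nil by (simp add: occurs_at_slice_eq hd_conv_nth)
  then show ?thesis using i n by (simp add: slice_def)
qed

lemma factor2: "y \<in> S \<Longrightarrow> Suc k < length y \<Longrightarrow> [y ! k, y ! Suc k] \<in> S"
  using S_slice[of y k "Suc (Suc k)"] slice_Cons[of k "Suc (Suc k)" y] slice_Suc[of "Suc k" y] by simp

text \<open>In the application \<open>P\<close> and \<open>R\<close> record the component of a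
  letter as left and as right vertex. The corrections cancel inside the word and survive at its
  ends.\<close>

lemma telescope_sides:
  fixes \<phi> :: "'a \<Rightarrow> 'g :: group_add"
  assumes edge: "\<And>a b. [a, b] \<in> S \<Longrightarrow> P a = R b" and "x \<in> S" "x \<noteq> []"
  shows "ev (\<lambda>a. l (R a) + \<phi> a - l (P a)) x = l (R (hd x)) + ev \<phi> x - l (P (last x))"
  using assms(2,3)
proof (induction x)
  case (Cons a x)
  show ?case
  proof (cases x)
    case Nil
    then show ?thesis by simp
  next
    case (Cons b x')
    then have "[a, b] \<in> S" using Cons.prems S_prefix[of "[a, b]" x'] by simp
    then have "P a = R b" by (rule edge)
    moreover have "x \<in> S" using S_Cons Cons.prems by blast
    ultimately show ?thesis using Cons.IH Cons
      by (simp add: group_norm del: add_uminus_conv_diff)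
  qed
qed simp

lemma ev_wi: "ev \<phi> (wi x) = - ev (\<lambda>a. - \<phi> (\<theta> a)) x" for \<phi> :: "'a \<Rightarrow> 'g :: group_add"
  by (induction x) (simp_all add: word_inv_def minus_add)

lemma fold_conjugate:
  "fold (\<lambda>a k. - \<phi>' a + k + \<phi> a) x k = - ev \<phi>' x + k + ev \<phi> x" for \<phi> :: "'a \<Rightarrow> 'g :: group_add"
  by (induction x arbitrary: k) (simp_all add: group_norm del: add_uminus_conv_diff)

lemma ev_conjugate: "ev (\<lambda>a. c + \<phi> a - c) x = c + ev \<phi> x - c" for \<phi> :: "'a \<Rightarrow> 'g :: group_add"
  by (induction x) (simp_all add: group_norm del: add_uminus_conv_diff)

text \<open>Rigidity compares \<open>\<phi>\<close> with its mirror image and yields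
  \<open>\<phi> (\<theta> a) + h (Inr a) + \<phi> a = h (Inl a)\<close>, where \<open>h\<close> is
  \<open>cp\<close> on one component and \<open>- cp\<close> on the other. A correction depending
  only on components then makes \<open>\<phi>\<close> compatible with inversion and reconciles
  \<open>gp\<close> with \<open>gm\<close>.\<close>

lemma extend_to_letters:
  fixes val :: "'a list \<Rightarrow> 'g :: group_add"
  assumes val: "\<And>r. r \<in> returns \<Longrightarrow> val (wi r) = - val r"
  shows "\<exists>\<psi>. (\<forall>a\<in>A. \<psi> (\<theta> a) = - \<psi> a) \<and> (\<forall>r\<in>returns. ev \<psi> r = val r)"
proof -
  obtain \<phi> gp gm where pot: "\<And>y i j. consecutive y i j \<Longrightarrow>
    val (slice y i j) = (if plus_marker y i then gp else gm) + ev \<phi> (slice y i j) - (if plus_marker y j then gp else gm)"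
    by (rule consecutive_potential[of val]) blast
  define \<phi>' where "\<phi>' a = - \<phi> (\<theta> a)" for a
  have \<phi>'_eq: "(\<lambda>a. - \<phi> (\<theta> a)) = \<phi>'" by (simp add: \<phi>'_def fun_eq_iff)
  \<comment> \<open>At a plus marker this is \<open>- x' + x\<close> for the boundary terms
    \<open>x\<close> of \<open>\<phi>\<close> and \<open>x'\<close> of \<open>\<phi>'\<close>; at
    the other kind of marker it is \<open>cm\<close>.\<close>
  define cp where "cp = - gm + gp"
  define cm where "cm = - gp + gm"
  have cm: "cm = - cp" by (simp add: cp_def cm_def minus_add del: add_uminus_conv_diff)
  define act where "act a k = - \<phi>' a + k + \<phi> a" for a and k :: 'g
  \<comment> \<open>This is \<open>pot\<close> for the inverse word: inversion exchanges the kinds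
    of markers, hence \<open>gp\<close> and \<open>gm\<close>.\<close>
  have pot': "val (slice y i j) = (if plus_marker y i then gm else gp) + ev \<phi>' (slice y i j) - (if plus_marker y j then gm else gp)"
    if c: "consecutive y i j" for y i j
  proof -
    have y: "y \<in> S" "i < j" "j \<le> length y" "marker y i" "marker y j"
      using c marker_le by (auto simp: consecutive_def)
    have sl: "slice (wi y) (length y - j) (length y - i) = wi (slice y i j)"
      using y by (intro slice_wi) auto
    have sign: "plus_marker (wi y) (length y - k) \<longleftrightarrow> \<not> plus_marker y k" if "marker y k" for k
      using minus_marker_wi[OF y(1), of k] minus_marker_iff[OF y(1) that] marker_le[OF that] by simp
    have "- val (slice y i j) = (if plus_marker y j then gm else gp) + - ev \<phi>' (slice y i j) - (if plus_marker y i then gm else gp)"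
      using pot[OF consecutive_wi[OF c]] val[OF returnsI[OF c]] sign[OF y(4)] sign[OF y(5)]
      unfolding sl ev_wi \<phi>'_eq by simp
    then have "- (- val (slice y i j)) = - ((if plus_marker y j then gm else gp) + - ev \<phi>' (slice y i j) - (if plus_marker y i then gm else gp))"
      by (rule arg_cong)
    then show ?thesis by (simp add: group_norm del: add_uminus_conv_diff)
  qed
  have "\<exists>h. (\<forall>a\<in>A. h (Inl a) = act a (h (Inr a))) \<and> (\<forall>a b. [a, b] \<in> S \<longrightarrow> h (Inl a) = h (Inr b)) \<and>
    h (Inl (last w)) = cp \<and> h (Inr (hd w')) = cm"
  proof (rule rigidity[where Q = UNIV])
    show "inj_on (act a) UNIV" for a by (rule inj_onI) (simp add: act_def)
    fix y i j assume c: "consecutive y i j"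
    have ff: "fold act r k = - ev \<phi>' r + k + ev \<phi> r" for r k
      unfolding act_def using fold_conjugate[of \<phi>' \<phi> r k] by simp
    let ?r = "slice y i j"
    have eq: "(if plus_marker y i then gp else gm) + ev \<phi> ?r - (if plus_marker y j then gp else gm)
      = (if plus_marker y i then gm else gp) + ev \<phi>' ?r - (if plus_marker y j then gm else gp)"
      using pot[OF c] pot'[OF c] by simp
    have alg: "- E' + (- x' + x) + E = - u' + u" if "x + E - u = x' + E' - u'" for x x' u u' E E' :: 'g
    proof -
      have "x + E = x' + E' - u' + u" using that by (simp add: diff_eq_eq)
      then have "- E' + (- x' + (x + E)) = - E' + (- x' + (x' + E' - u' + u))" by simp
      then show ?thesis by (simp add: group_norm del: add_uminus_conv_diff)
    qed
    show "fold act ?r (if plus_marker y i then cp else cm) = (if plus_marker y j then cp else cm)"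
      using alg[OF eq] unfolding ff cp_def cm_def by (simp split: if_splits)
  qed simp_all
  then obtain h where h0: "(\<forall>a\<in>A. h (Inl a) = act a (h (Inr a))) \<and>
    (\<forall>a b. [a, b] \<in> S \<longrightarrow> h (Inl a) = h (Inr b)) \<and> h (Inl (last w)) = cp \<and> h (Inr (hd w')) = cm" ..
  have h: "h (Inl a) = act a (h (Inr a))" if "a \<in> A" for a using h0 that by simp
  have h_edge: "h (Inl a) = h (Inr b)" if "[a, b] \<in> S" for a b using h0 that by simp
  have h_end: "h (Inl (last w)) = cp" "h (Inr (hd w')) = cm" using h0 by simp_all
  obtain J where J: "\<And>a b. [a, b] \<in> S \<Longrightarrow> J a = (\<not> J (\<theta> b))"
    "\<And>a b. a \<in> A \<Longrightarrow> b \<in> A \<Longrightarrow> J a = J b \<Longrightarrow>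
       (Inl a, Inl b) \<in> {(x, y). {x, y} \<in> ext_edges A S []}\<^sup>*"
    by (rule empty_graph_sides) blast
  \<comment> \<open>\<open>P\<close> singles out the component of the left vertex of
    \<open>last w\<close>. \<open>R\<close> is its version for right vertices: the right vertex
    \<open>b\<close> and the left vertex \<open>\<theta> b\<close> lie in opposite
    components.\<close>
  define P where "P a = (J a = J (last w))" for a
  define R where "R b = (\<not> P (\<theta> b))" for b
  have edge: "P a = R b" if "[a, b] \<in> S" for a b
    using J(1)[OF that] by (auto simp: P_def R_def)
  obtain c where c: "[c, hd w'] \<in> S"
    using ext_left[OF S_prefix[of "[hd w']" "tl w'"]] w'_in w'_Nil by auto
  have cA: "c \<in> A" using S_lists[OF c] by simp
  have R_hd: "\<not> R (hd w')" using hd_w' last_w_in by (simp add: R_def P_def \<theta>_\<theta>)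
  have hl: "h (Inl a) = (if P a then cp else cm)" if "a \<in> A" for a
  proof (cases "P a")
    case True
    then show ?thesis
      using edge_invariant_sides[OF h_edge J(2)[OF that last_w_in]] h_end(1) by (simp add: P_def)
  next
    case False
    then have "J a = J c" using edge[OF c] R_hd by (auto simp: P_def)
    then show ?thesis
      using edge_invariant_sides[OF h_edge J(2)[OF that cA]] h_edge[OF c] h_end(2) False by simp
  qed
  have hr: "h (Inr b) = (if R b then cp else cm)" if b: "b \<in> A" for b
  proof -
    obtain a where a: "[a, b] \<in> S" using ext_left[OF letters[OF b]] by blast
    then show ?thesis using hl[of a] h_edge[OF a] edge[OF a] S_lists[OF a] by simp
  qed
  \<comment> \<open>Chosen so that \<open>gm + l b\<close> is \<open>gp\<close> or
    \<open>gm\<close>. Dividing \<open>cp\<close> evenly between the components is not possible in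
    general; the lopsided choice still respects inversion, because \<open>R (\<theta> a)\<close> is
    the negation of \<open>P a\<close> and \<open>P (\<theta> a)\<close> that of
    \<open>R a\<close>.\<close>
  define l where "l b = (if b then cp else 0)" for b
  define \<psi> where "\<psi> a = l (R a) + \<phi> a - l (P a)" for a
  have \<psi>_sym: "\<psi> (\<theta> a) = - \<psi> a" if a: "a \<in> A" for a
  proof -
    have "(if P a then cp else cm) = - \<phi>' a + (if R a then cp else cm) + \<phi> a"
      using h[OF a] hl[OF a] hr[OF a] by (simp add: act_def)
    then have "\<phi> (\<theta> a) = (if P a then cp else cm) - \<phi> a - (if R a then cp else cm)"
      by (simp add: \<phi>'_def group_norm del: add_uminus_conv_diff)
    moreover have "R (\<theta> a) = (\<not> P a)" "P (\<theta> a) = (\<not> R a)"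
      using a by (auto simp: R_def \<theta>_\<theta>)
    ultimately show ?thesis
      by (simp add: \<psi>_def l_def cm group_norm del: add_uminus_conv_diff)
  qed
  have \<psi>_val: "val r = gm + ev \<psi> r - gm" if rr: "r \<in> returns" for r
  proof -
    obtain y i j where r: "r = slice y i j" and cons: "consecutive y i j"
      using rr by (auto simp: returns_def)
    have y: "y \<in> S" "i < j" "j \<le> length y" "marker y i" "marker y j"
      using cons marker_le by (auto simp: consecutive_def)
    have rS: "r \<in> S" "r \<noteq> []" using r y length_slice[of j y i] by (auto simp: S_slice)
    have hd: "hd r = y ! i" using r y slice_Cons[of i j y] by simp
    have last: "last r = y ! (j - 1)"
      using r y slice_append[of i "j - 1" j y] slice_Suc[of "j - 1" y] by (metis Suc_diff_1 diff_le_self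
        gr_implies_not0 last_snoc less_Suc_eq_le less_le_trans lessI linorder_neqE_nat not_less_eq)
    \<comment> \<open>After a plus marker the return word is preceded by \<open>last w\<close>, to
      which its first letter is joined by an edge; otherwise it starts with \<open>hd w'\<close>.
      Both sides are known.\<close>
    have Rhd: "R (hd r) = plus_marker y i"
    proof (cases "plus_marker y i")
      case True
      then obtain k where k: "i = Suc k" "y ! k = last w" using letter_before_plus by blast
      have "P (last w) = R (y ! i)" using factor2[OF y(1), of k] edge k y by auto
      then show ?thesis using True hd by (simp add: P_def)
    next
      case False
      then show ?thesis using letter_after_minus[of y i] minus_marker_iff[OF y(1,4)] R_hd hd by simp
    qed
    have Plast: "P (last r) = plus_marker y j"
    proof (cases "plus_marker y j")
      case True
      then obtain k where "j = Suc k" "y ! k = last w" using letter_before_plus by blast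
      then show ?thesis using True last by (simp add: P_def)
    next
      case False
      then have o: "occurs_at y w' j" using minus_marker_iff[OF y(1,5)] by simp
      have "P (y ! (j - 1)) = R (y ! j)"
        using factor2[OF y(1), of "j - 1"] letter_after_minus[OF o] edge y by auto
      then show ?thesis using False last letter_after_minus[OF o] R_hd by simp
    qed
    have "ev \<psi> r = l (plus_marker y i) + ev \<phi> r - l (plus_marker y j)"
      using telescope_sides[of P R r l \<phi>, OF edge rS] Rhd Plast unfolding \<psi>_def by simp
    moreover have "(if b then gp else gm) = gm + l b" for b
      by (simp add: l_def cp_def)
    ultimately show ?thesis
      using pot[OF cons] unfolding r[symmetric] by (simp add: group_norm del: add_uminus_conv_diff)
  qed
  show ?thesis
  proof (intro exI conjI ballI)
    \<comment> \<open>Conjugation by \<open>gm\<close> removes the boundary term that is now common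
      to all return words.\<close>
    show "gm + \<psi> (\<theta> a) - gm = - (gm + \<psi> a - gm)" if "a \<in> A" for a
      using \<psi>_sym[OF that] by (simp add: group_norm del: add_uminus_conv_diff)
    show "ev (\<lambda>a. gm + \<psi> a - gm) r = val r" if "r \<in> returns" for r
      using \<psi>_val[OF that] by (simp only: ev_conjugate)
  qed
qed

end

section \<open>A free product realised by permutations\<close>

typedef 'b permutation = "{f :: 'b \<Rightarrow> 'b. bij f}"
  morphisms apply_perm Perm
  by (rule exI[of _ id]) simp

setup_lifting type_definition_permutation

text \<open>Potentials take values in a type of class \<open>group_add\<close>, so the free product
  has to be found inside such a type; permutations under composition provide one.\<close>

instantiation permutation :: (type) group_add
begin

lift_definition zero_permutation :: "'b permutation" is id by simp
lift_definition plus_permutation :: "'b permutation \<Rightarrow> 'b permutation \<Rightarrow> 'b permutation"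
  is "\<lambda>f g. f \<circ> g" by (rule bij_comp)
lift_definition uminus_permutation :: "'b permutation \<Rightarrow> 'b permutation" is "inv_into UNIV"
  by (rule bij_imp_bij_inv)
definition minus_permutation :: "'b permutation \<Rightarrow> 'b permutation \<Rightarrow> 'b permutation"
  where "minus_permutation f g = f + - g"

instance
proof
  fix f g h :: "'b permutation"
  show "f + g + h = f + (g + h)" by transfer (rule comp_assoc)
  show "0 + f = f" "f + 0 = f" by (transfer, simp)+
  show "- f + f = 0" by transfer (simp add: bij_def)
  show "f + - g = f - g" by (simp add: minus_permutation_def)
qed

end

text \<open>Left multiplication by \<open>x\<close> on reduced words, extended by the identity so that it is a bijection
  of the whole type.\<close>

definition push :: "'r set \<Rightarrow> ('r \<Rightarrow> 'r) \<Rightarrow> 'r \<Rightarrow> 'r list \<Rightarrow> 'r list" where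
  "push R \<iota> x ys = (if reduced R \<iota> ys then
     (if ys \<noteq> [] \<and> hd ys = \<iota> x then tl ys else x # ys) else ys)"

lemma reduced_Cons:
  assumes "x \<in> R"
  shows "reduced R \<iota> (x # ys) \<longleftrightarrow> reduced R \<iota> ys \<and> \<not> (ys \<noteq> [] \<and> hd ys = \<iota> x)"
proof -
  have "sublist [a, \<iota> a] (x # ys) \<longleftrightarrow> sublist [a, \<iota> a] ys \<or> a = x \<and> ys \<noteq> [] \<and> hd ys = \<iota> a" for a
    by (cases ys) (auto simp: sublist_Cons_right)
  then show ?thesis using assms by (auto simp: reduced_def)
qed

lemma push_push:
  assumes inv: "involution_on R \<iota>" and x: "x \<in> R"
  shows "push R \<iota> (\<iota> x) (push R \<iota> x ys) = ys"
proof (cases "reduced R \<iota> ys")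
  case True
  have \<iota>: "\<iota> x \<in> R" "\<iota> (\<iota> x) = x" using inv x by (auto simp: involution_on_def)
  show ?thesis
  proof (cases "ys \<noteq> [] \<and> hd ys = \<iota> x")
    case cons: True
    then have ys: "ys = \<iota> x # tl ys" by (cases ys) auto
    then have "reduced R \<iota> (tl ys)" "\<not> (tl ys \<noteq> [] \<and> hd (tl ys) = x)"
      using True reduced_Cons[OF \<iota>(1), of \<iota> "tl ys"] \<iota>(2) by auto
    then show ?thesis using True cons ys \<iota>(2) by (auto simp: push_def)
  next
    case False
    then have "reduced R \<iota> (x # ys)" using True x by (simp add: reduced_Cons)
    then show ?thesis using True False \<iota> by (auto simp: push_def)
  qed
qed (simp add: push_def)

text \<open>Van der Waerden's argument for normal forms: the product of the permutations along a
  reduced word sends the empty word to that word, so it is not the identity unless the word is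
  empty.\<close>

lemma free_involution_group:
  assumes inv: "involution_on R \<iota>"
  shows "\<exists>val :: 'r \<Rightarrow> 'r list permutation. (\<forall>x\<in>R. val (\<iota> x) = - val x) \<and>
    (\<forall>xs\<in>lists R. xs \<noteq> [] \<longrightarrow> (\<forall>k. Suc k < length xs \<longrightarrow> xs ! Suc k \<noteq> \<iota> (xs ! k)) \<longrightarrow>
       sum_list (map val xs) \<noteq> 0)"
proof -
  define val where "val x = Perm (push R \<iota> x)" for x
  have \<iota>: "\<iota> x \<in> R" "\<iota> (\<iota> x) = x" if "x \<in> R" for x using inv that by (auto simp: involution_on_def)
  have bij: "bij (push R \<iota> x)" if "x \<in> R" for x
    by (rule bij_betw_byWitness[of _ "push R \<iota> (\<iota> x)"])
       (use push_push[OF inv that] push_push[OF inv \<iota>(1)[OF that]] \<iota>(2)[OF that] in auto)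
  have app: "apply_perm (val x) = push R \<iota> x" if "x \<in> R" for x
    unfolding val_def by (rule Perm_inverse) (simp add: bij[OF that])
  have "val (\<iota> x) = - val x" if "x \<in> R" for x
  proof -
    have "push R \<iota> (\<iota> x) \<circ> push R \<iota> x = id" using push_push[OF inv that] by auto
    then have "apply_perm (val (\<iota> x) + val x) = apply_perm 0"
      using that \<iota> by (simp add: plus_permutation.rep_eq zero_permutation.rep_eq app)
    then have "val (\<iota> x) + val x = 0" by (simp add: apply_perm_inject)
    then show ?thesis by (simp add: eq_neg_iff_add_eq_0)
  qed
  moreover have "sum_list (map val xs) \<noteq> 0"
    if "xs \<in> lists R" "xs \<noteq> []" "\<And>k. Suc k < length xs \<Longrightarrow> xs ! Suc k \<noteq> \<iota> (xs ! k)" for xs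
  proof -
    have "apply_perm (sum_list (map val xs)) [] = xs \<and> reduced R \<iota> xs"
      using that(1,3)
    proof (induction xs)
      case Nil
      show ?case by (auto simp: zero_permutation.rep_eq reduced_def)
    next
      case (Cons x xs)
      have IH: "apply_perm (sum_list (map val xs)) [] = xs" "reduced R \<iota> xs"
        using Cons.IH Cons.prems(1)[of "Suc _"] by auto
      have "\<not> (xs \<noteq> [] \<and> hd xs = \<iota> x)"
        using Cons.prems(1)[of 0] by (cases xs) auto
      then show ?case
        using IH Cons.hyps app[of x] by (auto simp: plus_permutation.rep_eq push_def reduced_Cons)
    qed
    then show ?thesis using that(2) by (auto simp: zero_permutation.rep_eq)
  qed
  ultimately show ?thesis by blast
qed

section \<open>The basis property\<close>

context recurrent_specular_word
begin

interpretation G: group G by (rule group_G_theta)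

text \<open>The universal property of the presentation, on representatives: free cancellations and
  relators both have value zero.\<close>

lemma pres_eq_hom:
  fixes \<psi> :: "'a \<Rightarrow> 'g :: group_add"
  assumes "\<And>a. a \<in> A \<Longrightarrow> \<psi> (\<theta> a) = - \<psi> a"
    and "pres_eq A (theta_relators A \<theta>) u v"
  shows "sum_list (map (\<lambda>(a, s). if s then \<psi> a else - \<psi> a) u)
    = sum_list (map (\<lambda>(a, s). if s then \<psi> a else - \<psi> a) v)"
  using assms(2)
proof (induction rule: pres_eq.induct)
  case (pres_relator r x y)
  then show ?case using assms(1) by (auto simp: theta_relators_def)
qed auto

lemma foldr_elem:
  "rs \<in> lists returns \<Longrightarrow> foldr (\<otimes>\<^bsub>G\<^esub>) (map elem rs) \<one>\<^bsub>G\<^esub> = elem (concat rs)"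
  by (induction rs) (auto simp: elem_Nil elem_append S_lists[OF returns_in] concat_returns)

text \<open>If no two neighbours cancel in the group, no return word is followed by its inverse, so
  \<open>rs\<close> is reduced and its value in the free product is nonzero. Read letter by letter
  through \<open>\<psi>\<close>, that value depends only on the group element, and it would be zero
  if the product were trivial.\<close>

lemma returns_free:
  assumes rs: "rs \<in> lists returns" "rs \<noteq> []"
    and adj: "\<And>k. Suc k < length rs \<Longrightarrow> elem (rs ! k) \<otimes>\<^bsub>G\<^esub> elem (rs ! Suc k) \<noteq> \<one>\<^bsub>G\<^esub>"
  shows "elem (concat rs) \<noteq> \<one>\<^bsub>G\<^esub>"
proof
  assume one: "elem (concat rs) = \<one>\<^bsub>G\<^esub>"
  have inv: "involution_on returns wi"
    using returns_wi wi_wi[OF S_lists[OF returns_in]] by (auto simp: involution_on_def)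
  then obtain val :: "'a list \<Rightarrow> 'a list list permutation" where
    val: "\<forall>x\<in>returns. val (wi x) = - val x" and
    free: "\<forall>xs\<in>lists returns. xs \<noteq> [] \<longrightarrow> (\<forall>k. Suc k < length xs \<longrightarrow> xs ! Suc k \<noteq> wi (xs ! k)) \<longrightarrow>
       sum_list (map val xs) \<noteq> 0"
    using free_involution_group[OF inv] by (elim exE conjE) blast
  obtain \<psi> where \<psi>: "\<And>a. a \<in> A \<Longrightarrow> \<psi> (\<theta> a) = - \<psi> a" "\<And>r. r \<in> returns \<Longrightarrow> ev \<psi> r = val r"
    using extend_to_letters[of val] val by blast
  have "rs ! Suc k \<noteq> wi (rs ! k)" if k: "Suc k < length rs" for k
  proof
    assume *: "rs ! Suc k = wi (rs ! k)"
    have "rs ! k \<in> returns" using rs(1) k by (auto simp: in_lists_conv_set)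
    then have "rs ! k \<in> lists A" by (rule S_lists[OF returns_in])
    then have "elem (rs ! k) \<otimes>\<^bsub>G\<^esub> elem (rs ! Suc k) = \<one>\<^bsub>G\<^esub>"
      unfolding * by (simp add: elem_wi elem_carrier)
    then show False using adj[OF k] by simp
  qed
  then have "sum_list (map val rs) \<noteq> 0" using free rs by blast
  moreover have "sum_list (map val rs) = ev \<psi> (concat rs)"
    using rs(1) by (induction rs) (auto simp: \<psi>(2))
  moreover have "ev \<psi> (concat rs) = 0"
  proof -
    have "pres_eq A (theta_relators A \<theta>) (map (\<lambda>a. (a, True)) (concat rs)) []"
      using one elem_eq_iff[OF concat_returns[OF rs(1)], of "[]"] by (simp add: elem_Nil)
    from pres_eq_hom[of \<psi>, OF \<psi>(1) this] show ?thesis by (simp add: comp_def)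
  qed
  ultimately show False by simp
qed

lemma returns_monoidal_basis: "monoidal_basis G (elem ` returns)"
  unfolding monoidal_basis_def
proof (intro conjI ballI impI)
  have sub: "elem ` returns \<subseteq> carrier G" using elem_carrier S_lists[OF returns_in] by blast
  then show "elem ` returns \<subseteq> carrier G" .
  show "inv\<^bsub>G\<^esub> x \<in> elem ` returns" if "x \<in> elem ` returns" for x
    using that elem_wi[OF S_lists[OF returns_in], symmetric] returns_wi by auto
  show "(\<lambda>H. submonoid H G) hull elem ` returns = carrier G"
  proof
    show "(\<lambda>H. submonoid H G) hull elem ` returns \<subseteq> carrier G"
      by (rule hull_minimal[OF sub]) (rule submonoid.intro, auto)
    have "elem (concat rs) \<in> H" if H: "elem ` returns \<subseteq> H" "submonoid H G" and rs: "rs \<in> lists returns" for H rs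
      using rs
    proof (induction rs)
      case Nil
      show ?case using submonoid.one_closed[OF H(2)] by (simp add: elem_Nil)
    next
      case (Cons r rs)
      have "elem r \<in> H" using H(1) Cons.hyps by blast
      then have "elem r \<otimes>\<^bsub>G\<^esub> elem (concat rs) \<in> H" using submonoid.m_closed[OF H(2)] Cons.IH by blast
      moreover have "elem (concat (r # rs)) = elem r \<otimes>\<^bsub>G\<^esub> elem (concat rs)"
        using Cons.hyps by (simp add: elem_append S_lists[OF returns_in] concat_returns)
      ultimately show ?case by simp
    qed
    then have "generated \<subseteq> H" if "elem ` returns \<subseteq> H" "submonoid H G" for H
      using that by (auto simp: generated_def)
    then show "carrier G \<subseteq> (\<lambda>H. submonoid H G) hull elem ` returns"
      unfolding generated_all[symmetric] hull_def by blast
  qed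
  fix xs assume xs: "xs \<in> lists (elem ` returns)" "xs \<noteq> []"
    and adj: "\<forall>k. Suc k < length xs \<longrightarrow> xs ! k \<otimes>\<^bsub>G\<^esub> xs ! Suc k \<noteq> \<one>\<^bsub>G\<^esub>"
  obtain rs where rs: "rs \<in> lists returns" "xs = map elem rs"
    using xs(1) by (auto simp: lists_image)
  have "elem (concat rs) \<noteq> \<one>\<^bsub>G\<^esub>"
    by (rule returns_free[OF rs(1)]) (use xs(2) adj rs(2) in auto)
  then show "foldr (\<otimes>\<^bsub>G\<^esub>) xs \<one>\<^bsub>G\<^esub> \<noteq> \<one>\<^bsub>G\<^esub>"
    using foldr_elem[OF rs(1)] rs(2) by simp
qed

end

theorem theorem6p17:
  fixes A :: "'a set" and \<theta> :: "'a \<Rightarrow> 'a" and S :: "'a list set" and w :: "'a list"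
  assumes "finite A"
    and "involution_on A \<theta>"
    and "specular A \<theta> S"
    and "recurrent A S"
    and "w \<in> S" and "w \<noteq> []"
    and "\<not> overlap w (word_inv \<theta> w)"
  shows "monoidal_basis (G_theta A \<theta>) (word_elem A \<theta> ` mixed_return_words \<theta> S w)"
proof -
  interpret recurrent_specular_word A \<theta> S w
    using assms by unfold_locales
  show ?thesis unfolding mixed_return_words_eq by (rule returns_monoidal_basis)
qed

end
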